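(* Let $(B,g_B)$ and $(F,g_F)$ be two non-degenerate semi-Riemannian manifolds, $b\in C^\infty(B\times F)$, and suppose $db=0$ at all points where $b=0$. Let $P\in\Gamma(TF)$ and let $\overline R$ be the semi-symmetric metric curvature, with respect to $P$, of the twisted product $B\times_bF$. For all $X,Y,Z,T\in\Gamma(TB)$ and $U,V,W,Q\in\Gamma(TF)$: (1) $\overline R(X,Y,Z,T)=R_B(X,Y,Z,T)+b^2g_B(X,Z)g_B(Y,T)g_F(P,P)-b^2g_B(X,T)g_B(Y,Z)g_F(P,P)$; (2) $\overline R(X,Y,Z,W)=-\overline R(Z,W,X,Y)=-bX(b)g_B(Y,Z)g_F(P,W)+bY(b)g_B(X,Z)g_F(P,W)$; (3) $\overline R(X,Y,V,W)=\overline R(V,W,X,Y)=0$; (4) $\overline R(X,V,Y,W)=bXY(b)g_F(V,W)-bg_B^*(\nabla^\flat_XY,db)g_F(V,W)-b^4g_B(X,Y)g_F(V,P)g_F(P,W)+b^4g_B(X,Y)g_F(V,W)g_F(P,P)+bV(b)g_B(X,Y)g_F(P,W)+bP(b)g_B(X,Y)g_F(W,V)-bW(b)g_B(X,Y)g_F(V,P)+b^2g_B(X,Y)\mathcal K_F(V,P,W)$; (5) $\overline R(X,V,U,W)=bXU(b)g_F(W,V)-X(b)U(b)g_F(W,V)-bXW(b)g_F(U,V)+X(b)W(b)g_F(U,V)+b^3X(b)g_F(U,P)g_F(W,V)-b^3X(b)g_F(W,P)g_F(U,V)$; (6) $\overline R(U,W,X,V)=bXU(b)g_F(W,V)-X(b)U(b)g_F(W,V)-bXW(b)g_F(U,V)+X(b)W(b)g_F(U,V)-b^3X(b)g_F(U,P)g_F(W,V)+b^3X(b)g_F(W,P)g_F(U,V)$;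 (7) $\overline R(U,V,W,Q)=b^2R_F(U,V,W,Q)+\big(b^2g_B^*(db,db)+g_F^*(db,db)+2b^3P(b)+b^6g_F(P,P)\big)\big(g_F(U,W)g_F(V,Q)-g_F(V,W)g_F(U,Q)\big)+\big(bUW(b)-2U(b)W(b)+b^4\mathcal K_F(U,P,W)-bg_F^*(\nabla^\flat_UW,db)\big)g_F(V,Q)+\big(bVQ(b)-2V(b)Q(b)+b^4\mathcal K_F(V,P,Q)-bg_F^*(\nabla^\flat_VQ,db)\big)g_F(U,W)-\big(bVW(b)-2V(b)W(b)+b^4\mathcal K_F(V,P,W)-bg_F^*(\nabla^\flat_VW,db)\big)g_F(U,Q)-\big(bUQ(b)-2U(b)Q(b)+b^4\mathcal K_F(U,P,Q)-bg_F^*(\nabla^\flat_UQ,db)\big)g_F(V,W)+b^3Q(b)\big(g_F(U,P)g_F(V,W)-g_F(V,P)g_F(U,W)\big)+\big(b^6g_F(U,P)-b^3U(b)\big)\big(g_F(V,W)g_F(P,Q)-g_F(P,W)g_F(V,Q)\big)-\big(b^6g_F(V,P)-b^3V(b)\big)\big(g_F(U,W)g_F(P,Q)-g_F(P,W)g_F(U,Q)\big)-b^3W(b)\big(g_F(U,P)g_F(V,Q)-g_F(V,P)g_F(U,Q)\big)$.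
   Context: A singular semi-Riemannian manifold $(M,g)$ is a smooth manifold with a smooth symmetric bilinear form $g$ on $TM$, possibly degenerate and of variable signature; it is non-degenerate if $g$ is non-degenerate everywhere. Its Koszul form is $\mathcal K(X,Y,Z)=\frac12\{X(g(Y,Z))+Y(g(Z,X))-Z(g(X,Y))-g(X,[Y,Z])+g(Y,[Z,X])+g(Z,[X,Y])\}$, and $(\nabla^\flat_XY)(Z)=\mathcal K(X,Y,Z)$. Contraction: let $T_p^\bullet M=\{g_p(v,\cdot):v\in T_pM\}\subset T_p^*M$ with inner product $g_p^\bullet(g_p(v,\cdot),g_p(w,\cdot))=g_p(v,w)$. For 1-forms $\omega,\tau$ with values in $T^\bullet M$, $\omega(\bullet)\tau(\bullet)$ is the function $p\mapsto g^\bullet_p(\omega_p,\tau_p)$ on the dense open set where the rank of $g$ is locally constant; it is called smooth if it extends (uniquely) to a smooth function on $M$, and then the same symbol denotes the extension. $(M,g)$ is radical-stationary if $\mathcal K(X,Y,\cdot)$ takes values in $T^\bullet M$ for all vector fields $X,Y$, and semi-regular if moreover all $\mathcal K(X,Y,\bullet)\mathcal K(Z,T,\bullet)$ are smooth. On a semi-regular manifold $R(X,Y,Z,T)=X(\mathcal K(Y,Z,T))-Y(\mathcal K(X,Z,T))-\mathcal K([X,Y],Z,T)+\mathcal K(X,Z,\bullet)\mathcal K(Y,T,\bullet)-\mathcal K(Y,Z,\bullet)\mathcal K(X,T,\bullet)$. For a vector field $P$ on $M$, the semi-symmetric metric Koszul form is $\overline{\mathcal K}(X,Y,Z)=\mathcal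 K(X,Y,Z)+g(Y,P)g(X,Z)-g(X,Y)g(P,Z)$. The semi-symmetric metric curvature $\overline R$ is given by the formula for $R$ with $\mathcal K$ replaced everywhere by $\overline{\mathcal K}$ (well defined on semi-regular manifolds). The twisted product $B\times_bF$ with twisting function $b:B\times F\to\mathbb R$ (smooth, possibly vanishing) is $B\times F$ with $g=\pi_B^*(g_B)+b^2\pi_F^*(g_F)$, $\pi_B,\pi_F$ the canonical projections. Under the hypotheses of the claim it is semi-regular. Vector fields in $\Gamma(TB)$, $\Gamma(TF)$ are identified with their lifts to the product, and functions and tensors on the factors with their pullbacks. Subscripts $B$, $F$ denote objects of that factor. $g_B^*$, $g_F^*$ are the inverse metrics of $g_B$, $g_F$ applied to the restrictions of 1-forms to $TB$, resp. $TF$; in $g_B^*(\nabla^\flat_XY,db)$ one has $\nabla^\flat_XY=\mathcal K_B(X,Y,\cdot)$, and in $g_F^*(\nabla^\flat_UW,db)$ one has $\nabla^\flat_UW=\mathcal K_F(U,W,\cdot)$. $XY(f)$ means $X(Y(f))$. *)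

theory Defs
  imports "HOL-Analysis.Analysis" "HOL-Library.Function_Algebras"
begin

section \<open>Smooth manifolds\<close>

primrec C_k_on :: "nat \<Rightarrow> 'e::real_normed_vector set \<Rightarrow> ('e \<Rightarrow> 'f::real_normed_vector) \<Rightarrow> bool" where
  "C_k_on 0 S f \<longleftrightarrow> continuous_on S f"
| "C_k_on (Suc k) S f \<longleftrightarrow>
     (\<forall>x\<in>S. f differentiable (at x)) \<and> (\<forall>v. C_k_on k S (\<lambda>x. frechet_derivative f (at x) v))"

text \<open>Only meaningful for open \<open>S\<close>.\<close>

definition smooth_on :: "'e::real_normed_vector set \<Rightarrow> ('e \<Rightarrow> 'f::real_normed_vector) \<Rightarrow> bool" where
  "smooth_on S f \<longleftrightarrow> (\<forall>k. C_k_on k S f)"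

text \<open>The underlying set of a manifold is a whole type, with the topology of its type classes.
  The smooth structure is the one generated by an atlas that need not be maximal.\<close>

type_synonym ('a, 'e) atlas = "('a set \<times> ('a \<Rightarrow> 'e)) set"

definition smooth_atlas ::
    "('a::{t2_space, second_countable_topology}, 'e::euclidean_space) atlas \<Rightarrow> bool" where
  "smooth_atlas A \<longleftrightarrow>
     (\<Union>(U, \<phi>)\<in>A. U) = UNIV \<and>
     (\<forall>(U, \<phi>)\<in>A. open U \<and> open (\<phi> ` U) \<and> homeomorphism U (\<phi> ` U) \<phi> (inv_into U \<phi>)) \<and>
     (\<forall>(U, \<phi>)\<in>A. \<forall>(V, \<psi>)\<in>A. smooth_on (\<phi> ` (U \<inter> V)) (\<psi> \<circ> inv_into U \<phi>))"

definition smooth_fun :: "('a, 'e::euclidean_space) atlas \<Rightarrow> ('a \<Rightarrow> real) set" where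
  "smooth_fun A = {f. \<forall>(U, \<phi>)\<in>A. smooth_on (\<phi> ` U) (f \<circ> inv_into U \<phi>)}"

definition prod_atlas ::
    "('a, 'e::euclidean_space) atlas \<Rightarrow> ('b, 'f::euclidean_space) atlas \<Rightarrow> ('a \<times> 'b, 'e \<times> 'f) atlas" where
  "prod_atlas A A' = {(U \<times> V, map_prod \<phi> \<psi>) |U \<phi> V \<psi>. (U, \<phi>) \<in> A \<and> (V, \<psi>) \<in> A'}"

text \<open>Tangent vectors at \<open>p\<close> are the derivations at \<open>p\<close> of the algebra of smooth functions. They
  are represented by total functionals on \<^typ>\<open>'a \<Rightarrow> real\<close> that vanish on non-smooth arguments, so
  that a derivation has exactly one representative. Likewise covectors at \<open>p\<close> are functionals that
  vanish off the tangent space.\<close>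

type_synonym 'a tvec = "('a \<Rightarrow> real) \<Rightarrow> real"
type_synonym 'a vfield = "'a \<Rightarrow> 'a tvec"
type_synonym 'a covec = "'a tvec \<Rightarrow> real"
type_synonym 'a form1 = "'a vfield \<Rightarrow> 'a \<Rightarrow> real"

definition tangent_space :: "('a, 'e::euclidean_space) atlas \<Rightarrow> 'a \<Rightarrow> 'a tvec set" where
  "tangent_space A p = {v.
     (\<forall>f\<in>smooth_fun A. \<forall>h\<in>smooth_fun A. \<forall>a c. v (\<lambda>x. a * f x + c * h x) = a * v f + c * v h) \<and>
     (\<forall>f\<in>smooth_fun A. \<forall>h\<in>smooth_fun A. v (\<lambda>x. f x * h x) = f p * v h + h p * v f) \<and>
     (\<forall>f. f \<notin> smooth_fun A \<longrightarrow> v f = 0)}"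

definition vector_fields :: "('a, 'e::euclidean_space) atlas \<Rightarrow> 'a vfield set" where
  "vector_fields A = {X. (\<forall>p. X p \<in> tangent_space A p) \<and>
     (\<forall>f\<in>smooth_fun A. (\<lambda>p. X p f) \<in> smooth_fun A)}"

definition lie_bracket :: "'a vfield \<Rightarrow> 'a vfield \<Rightarrow> 'a vfield" where
  "lie_bracket X Y = (\<lambda>p f. X p (\<lambda>x. Y x f) - Y p (\<lambda>x. X x f))"

definition differential ::
    "('a, 'e::euclidean_space) atlas \<Rightarrow> ('a \<Rightarrow> real) \<Rightarrow> 'a \<Rightarrow> 'a covec" where
  "differential A f p = (\<lambda>v. if v \<in> tangent_space A p then v f else 0)"

text \<open>The tangent map of \<open>\<phi>\<close>; the first argument is the atlas of the codomain of \<open>\<phi>\<close>.\<close>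

definition pushforward ::
    "('b, 'f::euclidean_space) atlas \<Rightarrow> ('a \<Rightarrow> 'b) \<Rightarrow> 'a tvec \<Rightarrow> 'b tvec" where
  "pushforward A' \<phi> v = (\<lambda>f. if f \<in> smooth_fun A' then v (f \<circ> \<phi>) else 0)"

text \<open>Restriction of a covector of the codomain along the tangent map of \<open>\<phi>\<close> at \<open>p\<close>.\<close>

definition pullback_covec ::
    "('a, 'e::euclidean_space) atlas \<Rightarrow> ('b, 'f::euclidean_space) atlas \<Rightarrow> ('a \<Rightarrow> 'b) \<Rightarrow> 'a \<Rightarrow>
     'b covec \<Rightarrow> 'a covec" where
  "pullback_covec A A' \<phi> p \<alpha> =
     (\<lambda>v. if v \<in> tangent_space A p then \<alpha> (pushforward A' \<phi> v) else 0)"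

text \<open>A 1-form is given by its action on vector fields. Its value at \<open>p\<close> on a tangent vector \<open>v\<close> is
  its value on any vector field through \<open>v\<close>.\<close>

definition form_at ::
    "('a, 'e::euclidean_space) atlas \<Rightarrow> 'a form1 \<Rightarrow> 'a \<Rightarrow> 'a covec" where
  "form_at A \<omega> p = (\<lambda>v. if v \<in> tangent_space A p
     then (THE c. \<forall>Z\<in>vector_fields A. Z p = v \<longrightarrow> \<omega> Z p = c) else 0)"


section \<open>Singular semi-Riemannian geometry\<close>

type_synonym 'a metric = "'a \<Rightarrow> 'a tvec \<Rightarrow> 'a tvec \<Rightarrow> real"

definition field_inner :: "'a metric \<Rightarrow> 'a vfield \<Rightarrow> 'a vfield \<Rightarrow> 'a \<Rightarrow> real" where
  "field_inner g X Y = (\<lambda>p. g p (X p) (Y p))"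

definition singular_semi_riemannian ::
    "('a::{t2_space, second_countable_topology}, 'e::euclidean_space) atlas \<Rightarrow> 'a metric \<Rightarrow> bool" where
  "singular_semi_riemannian A g \<longleftrightarrow>
     smooth_atlas A \<and>
     (\<forall>p. \<forall>u\<in>tangent_space A p. \<forall>v\<in>tangent_space A p. g p u v = g p v u) \<and>
     (\<forall>p. \<forall>u\<in>tangent_space A p. \<forall>v\<in>tangent_space A p. \<forall>w\<in>tangent_space A p. \<forall>a c.
        g p (\<lambda>f. a * u f + c * v f) w = a * g p u w + c * g p v w) \<and>
     (\<forall>X\<in>vector_fields A. \<forall>Y\<in>vector_fields A. field_inner g X Y \<in> smooth_fun A)"

definition nondegenerate :: "('a, 'e::euclidean_space) atlas \<Rightarrow> 'a metric \<Rightarrow> bool" where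
  "nondegenerate A g \<longleftrightarrow>
     (\<forall>p. \<forall>v\<in>tangent_space A p. (\<forall>w\<in>tangent_space A p. g p v w = 0) \<longrightarrow> v = (\<lambda>_. 0))"

definition koszul :: "'a metric \<Rightarrow> 'a vfield \<Rightarrow> 'a vfield \<Rightarrow> 'a form1" where
  "koszul g X Y Z = (\<lambda>p. 1 / 2 *
     (X p (field_inner g Y Z) + Y p (field_inner g Z X) - Z p (field_inner g X Y)
      - field_inner g X (lie_bracket Y Z) p
      + field_inner g Y (lie_bracket Z X) p
      + field_inner g Z (lie_bracket X Y) p))"

definition flat :: "('a, 'e::euclidean_space) atlas \<Rightarrow> 'a metric \<Rightarrow> 'a \<Rightarrow> 'a tvec \<Rightarrow> 'a covec" where
  "flat A g p v = (\<lambda>w. if w \<in> tangent_space A p then g p v w else 0)"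

text \<open>The inner product of the covectors in the image of \<^const>\<open>flat\<close>. When \<open>g\<close> is non-degenerate
  this image is the whole cotangent space and \<open>cometric\<close> is the inverse metric.\<close>

definition cometric ::
    "('a, 'e::euclidean_space) atlas \<Rightarrow> 'a metric \<Rightarrow> 'a \<Rightarrow> 'a covec \<Rightarrow> 'a covec \<Rightarrow> real" where
  "cometric A g p \<alpha> \<beta> = (THE c. \<exists>v\<in>tangent_space A p. \<exists>w\<in>tangent_space A p.
     \<alpha> = flat A g p v \<and> \<beta> = flat A g p w \<and> c = g p v w)"

global_interpretation fun_space: vector_space "\<lambda>(c::real) (f::'b \<Rightarrow> real) x. c * f x"
  by unfold_locales (auto simp: fun_eq_iff algebra_simps)

definition metric_rank :: "('a, 'e::euclidean_space) atlas \<Rightarrow> 'a metric \<Rightarrow> 'a \<Rightarrow> nat" where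
  "metric_rank A g p = fun_space.dim (flat A g p ` tangent_space A p)"

definition regular_points ::
    "('a::topological_space, 'e::euclidean_space) atlas \<Rightarrow> 'a metric \<Rightarrow> 'a set" where
  "regular_points A g = {p. \<forall>\<^sub>F q in nhds p. metric_rank A g q = metric_rank A g p}"

text \<open>The smooth extension to the manifold of the pointwise contraction on the dense open set
  \<^const>\<open>regular_points\<close>; unspecified if there is none.\<close>

definition contraction ::
    "('a::topological_space, 'e::euclidean_space) atlas \<Rightarrow> 'a metric \<Rightarrow> 'a form1 \<Rightarrow> 'a form1 \<Rightarrow>
     'a \<Rightarrow> real" where
  "contraction A g \<omega> \<tau> = (THE h. h \<in> smooth_fun A \<and>
     (\<forall>p\<in>regular_points A g. h p = cometric A g p (form_at A \<omega> p) (form_at A \<tau> p)))"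

text \<open>The curvature formula as a function of the form \<open>K\<close> used in place of the Koszul form.\<close>

definition curvature_of ::
    "('a::topological_space, 'e::euclidean_space) atlas \<Rightarrow> 'a metric \<Rightarrow>
     ('a vfield \<Rightarrow> 'a vfield \<Rightarrow> 'a form1) \<Rightarrow>
     'a vfield \<Rightarrow> 'a vfield \<Rightarrow> 'a vfield \<Rightarrow> 'a vfield \<Rightarrow> 'a \<Rightarrow> real" where
  "curvature_of A g K X Y Z T = (\<lambda>p.
     X p (K Y Z T) - Y p (K X Z T) - K (lie_bracket X Y) Z T p
     + contraction A g (K X Z) (K Y T) p - contraction A g (K Y Z) (K X T) p)"

definition riemann_curvature ::
    "('a::topological_space, 'e::euclidean_space) atlas \<Rightarrow> 'a metric \<Rightarrow>
     'a vfield \<Rightarrow> 'a vfield \<Rightarrow> 'a vfield \<Rightarrow> 'a vfield \<Rightarrow> 'a \<Rightarrow> real" where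
  "riemann_curvature A g = curvature_of A g (koszul g)"

definition semi_symmetric_koszul ::
    "'a metric \<Rightarrow> 'a vfield \<Rightarrow> 'a vfield \<Rightarrow> 'a vfield \<Rightarrow> 'a form1" where
  "semi_symmetric_koszul g P X Y Z = (\<lambda>p.
     koszul g X Y Z p + field_inner g Y P p * field_inner g X Z p
       - field_inner g X Y p * field_inner g P Z p)"

definition semi_symmetric_curvature ::
    "('a::topological_space, 'e::euclidean_space) atlas \<Rightarrow> 'a metric \<Rightarrow> 'a vfield \<Rightarrow>
     'a vfield \<Rightarrow> 'a vfield \<Rightarrow> 'a vfield \<Rightarrow> 'a vfield \<Rightarrow> 'a \<Rightarrow> real" where
  "semi_symmetric_curvature A g P = curvature_of A g (semi_symmetric_koszul g P)"


section \<open>Twisted products\<close>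

definition twisted_metric ::
    "('a, 'e::euclidean_space) atlas \<Rightarrow> 'a metric \<Rightarrow> ('b, 'f::euclidean_space) atlas \<Rightarrow> 'b metric \<Rightarrow>
     ('a \<times> 'b \<Rightarrow> real) \<Rightarrow> ('a \<times> 'b) metric" where
  "twisted_metric A\<^sub>B g\<^sub>B A\<^sub>F g\<^sub>F b = (\<lambda>z v w.
     g\<^sub>B (fst z) (pushforward A\<^sub>B fst v) (pushforward A\<^sub>B fst w)
     + (b z)\<^sup>2 * g\<^sub>F (snd z) (pushforward A\<^sub>F snd v) (pushforward A\<^sub>F snd w))"

text \<open>The lift of a vector field on a factor is tangent to the slices parallel to that factor and
  is obtained by pushing the field forward along the inclusions of these slices.\<close>

definition lift_fst ::
    "('a, 'e::euclidean_space) atlas \<Rightarrow> ('b, 'f::euclidean_space) atlas \<Rightarrow> 'a vfield \<Rightarrow>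
     ('a \<times> 'b) vfield" where
  "lift_fst A\<^sub>B A\<^sub>F X = (\<lambda>(p, q). pushforward (prod_atlas A\<^sub>B A\<^sub>F) (\<lambda>x. (x, q)) (X p))"

definition lift_snd ::
    "('a, 'e::euclidean_space) atlas \<Rightarrow> ('b, 'f::euclidean_space) atlas \<Rightarrow> 'b vfield \<Rightarrow>
     ('a \<times> 'b) vfield" where
  "lift_snd A\<^sub>B A\<^sub>F U = (\<lambda>(p, q). pushforward (prod_atlas A\<^sub>B A\<^sub>F) (\<lambda>y. (p, y)) (U q))"

end

theory Submission
  imports Defs
begin

text \<open>
  Tangent vectors are derivations, so everything rests on the fact that they are exactly the
  directional derivatives in a chart (Hadamard's lemma and bump functions). This makes the Koszul form
  pointwise in its last argument, and it splits the tangent spaces of \<open>B \<times> F\<close> into lifts.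

  For lifts \<open>E, E'\<close>, the 1-form \<open>\<omega>\<close> obtained from the semi-symmetric Koszul form of \<open>E, E'\<close> is
  \<open>\<omega>(X) = g\<^sub>B(a, X)\<close> on lifts from \<open>B\<close> and \<open>\<omega>(U) = b g\<^sub>F(c, U)\<close> on lifts from \<open>F\<close>, with smooth sections
  \<open>a\<close> of \<open>TB\<close> and \<open>c\<close> of \<open>TF\<close> along the projections. The factor \<open>b\<close> in front of \<open>c\<close> is what compensates the
  \<open>b\<^sup>-\<^sup>2\<close> in the contraction: away from the zeros of \<open>b\<close> the contraction of two such forms is
  \<open>g\<^sub>B(a, a') + g\<^sub>F(c, c')\<close>. At the zeros of \<open>b\<close> the hypothesis \<open>db = 0\<close> forces \<open>c = 0\<close>, so that this smooth
  function agrees with the pointwise contraction there as well. The curvature formulas are then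
  polynomial identities modulo metric compatibility and vanishing torsion of the Koszul forms of the factors.
\<close>

section \<open>Calculus of smooth maps between Euclidean spaces\<close>

text \<open>The twisted metric degenerates where \<open>b\<close> vanishes, so a Levi-Civita
  connection need not exist on the product. There everything is phrased with Koszul forms;
  connections are used on the two factors only. Divisibility by \<open>b\<close> has a simple
  source: the values on lifts from F arise by differentiating b^2, which gives 2 b db, or already
  carry a factor b^2 or b^4. After division, \<open>c\<close> is a combination of terms with a
  factor \<open>b\<close> and terms with a first derivative of \<open>b\<close>, which is why db = 0
  on the zero set makes it vanish there. \<open>contraction\<close> is a definite description of a
  smooth extension, so each evaluation needs a smooth candidate and the density of the regular
  points. The vectors \<open>a\<close> and \<open>c\<close> depend on both factors and are therefore
  sections along the projections, not vector fields. Smoothness of g_B(a, a') and g_F(c, c') is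
  obtained from a frame together with a smooth metric dual of it, which replaces the inversion of a
  Gram matrix.\<close>

lemma C_k_on_SucD:
  assumes "C_k_on (Suc k) S f" "x \<in> S"
  shows "(f has_derivative frechet_derivative f (at x)) (at x)"
  using assms frechet_derivative_works by auto

text \<open>A derivative at a point of the open set \<open>S\<close> only sees values on
  \<open>S\<close>, so \<open>f\<close> and \<open>g\<close> share all derivatives there.\<close>

lemma C_k_on_cong:
  assumes "open S" "\<And>x. x \<in> S \<Longrightarrow> f x = g x" "C_k_on k S f"
  shows "C_k_on k S g"
  using assms(2,3)
proof (induction k arbitrary: f g)
  case 0
  then show ?case using continuous_on_eq by auto
next
  case (Suc k)
  have d: "(g has_derivative frechet_derivative f (at x)) (at x)" if "x \<in> S" for x
    using C_k_on_SucD[OF Suc.prems(2) that] has_derivative_transform_within_open[of f _ x UNIV S g]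
      assms(1) Suc.prems(1) that by auto
  have "frechet_derivative f (at x) = frechet_derivative g (at x)" if "x \<in> S" for x
    using d[OF that] frechet_derivative_at by blast
  then have "C_k_on k S (\<lambda>x. frechet_derivative g (at x) v)" for v
    using Suc.prems(2) by (auto intro: Suc.IH[of "\<lambda>x. frechet_derivative f (at x) v", rotated])
  then show ?case using d by (auto simp: differentiable_def)
qed

text \<open>\<open>frechet_derivative\<close> is a chosen object. Uniqueness of derivatives lets any
  explicit formula take its place, which is what the inductions on \<open>k\<close> for the closure
  properties rely on.\<close>

lemma C_k_on_SucI:
  assumes "open S" "\<And>x. x \<in> S \<Longrightarrow> (f has_derivative f' x) (at x)"
    "\<And>v. C_k_on k S (\<lambda>x. f' x v)"
  shows "C_k_on (Suc k) S f"
proof -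
  have "f' x = frechet_derivative f (at x)" if "x \<in> S" for x
    using assms(2)[OF that] frechet_derivative_at by blast
  then have "C_k_on k S (\<lambda>x. frechet_derivative f (at x) v)" for v
    by (intro C_k_on_cong[OF assms(1) _ assms(3)[of v]]) auto
  then show ?thesis using assms(2) by (auto simp: differentiable_def)
qed

lemma C_k_on_pred: "C_k_on (Suc k) S f \<Longrightarrow> C_k_on k S f"
proof (induction k arbitrary: f)
  case 0
  then show ?case
    by (auto intro!: continuous_at_imp_continuous_on differentiable_imp_continuous_within)
qed auto

lemma C_k_on_subset: "C_k_on k S f \<Longrightarrow> T \<subseteq> S \<Longrightarrow> C_k_on k T f"
  by (induction k arbitrary: f) (auto intro: continuous_on_subset)

lemma C_k_on_local:
  assumes "\<And>x. x \<in> S \<Longrightarrow> \<exists>T. open T \<and> x \<in> T \<and> C_k_on k T f"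
  shows "C_k_on k S f"
  using assms
proof (induction k arbitrary: f)
  case 0
  then show ?case
    by (metis C_k_on.simps(1) continuous_at_imp_continuous_on continuous_on_eq_continuous_at)
next
  case (Suc k)
  have "f differentiable at x" if "x \<in> S" for x
    using Suc.prems[OF that] by auto
  moreover have "C_k_on k S (\<lambda>x. frechet_derivative f (at x) v)" for v
    using Suc.prems by (intro Suc.IH) (metis C_k_on.simps(2))
  ultimately show ?case by simp
qed

lemma C_k_on_const: "open S \<Longrightarrow> C_k_on k S (\<lambda>x. c)"
proof (induction k arbitrary: c)
  case (Suc k)
  then show ?case by (auto intro!: C_k_on_SucI[where f'="\<lambda>x v. 0"] derivative_eq_intros)
qed simp

lemma C_k_on_bounded_linear:
  assumes "bounded_linear L" "open S"
  shows "C_k_on k S L"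
proof (cases k)
  case 0
  then show ?thesis using assms by (auto intro: linear_continuous_on)
next
  case (Suc k)
  show ?thesis unfolding Suc
    by (rule C_k_on_SucI[OF assms(2) bounded_linear_imp_has_derivative[OF assms(1)] C_k_on_const[OF assms(2)]])
qed

lemma C_k_on_add:
  assumes "open S" "C_k_on k S f" "C_k_on k S g"
  shows "C_k_on k S (\<lambda>x. f x + g x)"
  using assms(2,3)
proof (induction k arbitrary: f g)
  case (Suc k)
  show ?case
  proof (rule C_k_on_SucI[OF assms(1)])
    show "((\<lambda>x. f x + g x) has_derivative
        (\<lambda>v. frechet_derivative f (at x) v + frechet_derivative g (at x) v)) (at x)" if "x \<in> S" for x
      using C_k_on_SucD[OF Suc.prems(1) that] C_k_on_SucD[OF Suc.prems(2) that]
      by (rule has_derivative_add)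
    show "C_k_on k S (\<lambda>x. frechet_derivative f (at x) v + frechet_derivative g (at x) v)" for v
      using Suc by (intro Suc.IH) auto
  qed
qed (auto intro: continuous_intros)

lemma C_k_on_linear_compose:
  assumes "bounded_linear L" "open S" "C_k_on k S f"
  shows "C_k_on k S (\<lambda>x. L (f x))"
  using assms(3)
proof (induction k arbitrary: f)
  case 0
  then show ?case using assms(1) by (auto intro: bounded_linear.continuous_on)
next
  case (Suc k)
  show ?case
  proof (rule C_k_on_SucI[OF assms(2)])
    show "((\<lambda>x. L (f x)) has_derivative (\<lambda>v. L (frechet_derivative f (at x) v))) (at x)"
      if "x \<in> S" for x
      using C_k_on_SucD[OF Suc.prems that] by (rule bounded_linear.has_derivative[OF assms(1)])
    show "C_k_on k S (\<lambda>x. L (frechet_derivative f (at x) v))" for v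
      using Suc by (intro Suc.IH) auto
  qed
qed

text \<open>The chain rule yields the derivative of \<open>f\<close> at \<open>L x\<close> in the
  fixed direction \<open>L v\<close>, so the induction needs no basis and works for arbitrary normed
  spaces.\<close>

lemma C_k_on_compose_linear:
  assumes "bounded_linear L" "open S" "open T" "C_k_on k T f" "L ` S \<subseteq> T"
  shows "C_k_on k S (\<lambda>x. f (L x))"
  using assms(4)
proof (induction k arbitrary: f)
  case 0
  then show ?case using assms by (auto intro: continuous_on_compose2 linear_continuous_on)
next
  case (Suc k)
  show ?case
  proof (rule C_k_on_SucI[OF assms(2)])
    show "((\<lambda>x. f (L x)) has_derivative (\<lambda>v. frechet_derivative f (at (L x)) (L v))) (at x)"
      if "x \<in> S" for x
      using has_derivative_compose[OF bounded_linear_imp_has_derivative[OF assms(1)]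
        C_k_on_SucD[OF Suc.prems, of "L x"]] that assms(5) by auto
    show "C_k_on k S (\<lambda>x. frechet_derivative f (at (L x)) (L v))" for v
      using Suc by (intro Suc.IH[of "\<lambda>y. frechet_derivative f (at y) (L v)"]) auto
  qed
qed

lemma C_k_on_bilinear:
  assumes "bounded_bilinear B" "open S" "C_k_on k S f" "C_k_on k S g"
  shows "C_k_on k S (\<lambda>x. B (f x) (g x))"
  using assms(3,4)
proof (induction k arbitrary: f g)
  case 0
  then show ?case using assms(1) by (auto intro: bounded_bilinear.continuous_on)
next
  case (Suc k)
  show ?case
  proof (rule C_k_on_SucI[OF assms(2)])
    show "((\<lambda>x. B (f x) (g x)) has_derivative (\<lambda>v. B (f x) (frechet_derivative g (at x) v)
        + B (frechet_derivative f (at x) v) (g x))) (at x)" if "x \<in> S" for x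
      using C_k_on_SucD[OF Suc.prems(1) that] C_k_on_SucD[OF Suc.prems(2) that]
      by (rule bounded_bilinear.FDERIV[OF assms(1)])
    \<comment> \<open>The product rule mixes derivatives with undifferentiated factors, so both
      functions are also needed at order \<open>k\<close>.\<close>
    show "C_k_on k S (\<lambda>x. B (f x) (frechet_derivative g (at x) v)
        + B (frechet_derivative f (at x) v) (g x))" for v
      using Suc.prems C_k_on_pred[OF Suc.prems(1)] C_k_on_pred[OF Suc.prems(2)]
      by (intro C_k_on_add[OF assms(2)] Suc.IH) auto
  qed
qed

lemma C_k_on_sum:
  assumes "open S" "finite I" "\<And>i. i \<in> I \<Longrightarrow> C_k_on k S (f i)"
  shows "C_k_on k S (\<lambda>x. \<Sum>i\<in>I. f i x)"
  using assms(2,3)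
proof (induction I rule: finite_induct)
  case (insert i I)
  then have "C_k_on k S (\<lambda>x. f i x + (\<Sum>i\<in>I. f i x))"
    by (intro C_k_on_add[OF assms(1)]) auto
  then show ?case using insert by simp
qed (simp add: C_k_on_const[OF assms(1)])

text \<open>The chain rule evaluates the derivative of \<open>g\<close> in the moving direction
  f'(x) v, whereas \<open>C_k_on\<close> controls fixed directions. Expanding f'(x) v in the basis
  turns the derivative into a sum of products of functions covered by the induction.\<close>

lemma C_k_on_compose:
  fixes f :: "'e::real_normed_vector \<Rightarrow> 'f::euclidean_space" and g :: "'f \<Rightarrow> real"
  assumes "open S" "open T" "C_k_on k T g" "C_k_on k S f" "f ` S \<subseteq> T"
  shows "C_k_on k S (\<lambda>x. g (f x))"
  using assms(3,4)
proof (induction k arbitrary: g)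
  case 0
  then show ?case using assms by (auto intro: continuous_on_compose2)
next
  case (Suc k)
  have df: "(f has_derivative frechet_derivative f (at x)) (at x)" if "x \<in> S" for x
    using C_k_on_SucD[OF Suc.prems(2) that] .
  have dg: "(g has_derivative frechet_derivative g (at (f x))) (at (f x))" if "x \<in> S" for x
    using C_k_on_SucD[OF Suc.prems(1)] that assms(5) by auto
  show ?case
  proof (rule C_k_on_SucI[OF assms(1)])
    show "((\<lambda>x. g (f x)) has_derivative (\<lambda>v. \<Sum>i\<in>Basis. (frechet_derivative f (at x) v \<bullet> i) *
        frechet_derivative g (at (f x)) i)) (at x)" if "x \<in> S" for x
    proof (rule has_derivative_eq_rhs[OF has_derivative_compose[OF df[OF that] dg[OF that]]], rule ext)
      interpret linear "frechet_derivative g (at (f x))"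
        using dg[OF that] has_derivative_linear by blast
      fix v
      show "frechet_derivative g (at (f x)) (frechet_derivative f (at x) v) =
        (\<Sum>i\<in>Basis. (frechet_derivative f (at x) v \<bullet> i) * frechet_derivative g (at (f x)) i)"
        by (subst euclidean_representation[symmetric, of "frechet_derivative f (at x) v"])
          (simp only: sum scale real_scaleR_def)
    qed
    show "C_k_on k S (\<lambda>x. \<Sum>i\<in>Basis. (frechet_derivative f (at x) v \<bullet> i) *
        frechet_derivative g (at (f x)) i)" for v
    proof (intro C_k_on_sum[OF assms(1)] finite_Basis C_k_on_bilinear[OF bounded_bilinear_mult assms(1)])
      fix i :: 'f
      show "C_k_on k S (\<lambda>x. frechet_derivative f (at x) v \<bullet> i)"
        using Suc.prems(2) by (intro C_k_on_linear_compose[OF bounded_linear_inner_left assms(1)]) auto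
      show "C_k_on k S (\<lambda>x. frechet_derivative g (at (f x)) i)"
        using Suc.prems(1) C_k_on_pred[OF Suc.prems(2)] by (intro Suc.IH) auto
    qed
  qed
qed

lemma C_k_on_inverse:
  fixes f :: "'e::real_normed_vector \<Rightarrow> real"
  assumes "open S" "C_k_on k S f" "\<And>x. x \<in> S \<Longrightarrow> f x \<noteq> 0"
  shows "C_k_on k S (\<lambda>x. inverse (f x))"
  using assms(2)
proof (induction k)
  case 0
  then show ?case using assms(3) by (auto intro: continuous_intros)
next
  case (Suc k)
  show ?case
  proof (rule C_k_on_SucI[OF assms(1)])
    show "((\<lambda>x. inverse (f x)) has_derivative
        (\<lambda>v. - (inverse (f x) * frechet_derivative f (at x) v * inverse (f x)))) (at x)" if "x \<in> S" for x
      by (rule Deriv.has_derivative_inverse[OF assms(3)[OF that] C_k_on_SucD[OF Suc.prems that]])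
    show "C_k_on k S (\<lambda>x. - (inverse (f x) * frechet_derivative f (at x) v * inverse (f x)))" for v
      using Suc.prems Suc.IH[OF C_k_on_pred[OF Suc.prems]]
      by (intro C_k_on_linear_compose[OF bounded_linear_minus[OF bounded_linear_ident] assms(1)]
          C_k_on_bilinear[OF bounded_bilinear_mult assms(1)]) auto
  qed
qed

text \<open>Differentiation under the integral sign, one direction \<open>(v, 0)\<close> at a time.
  The open set \<open>U\<close> is there because \<open>C_k_on\<close> is meaningful on open sets
  only, while the interval of integration is compact.\<close>

lemma C_k_on_parametric_integral:
  fixes F :: "'e::euclidean_space \<times> real \<Rightarrow> real"
  assumes "open S" "convex S" "open U" "S \<times> {0..1} \<subseteq> U" "C_k_on k U F"
  shows "C_k_on k S (\<lambda>x. integral {0..1} (\<lambda>t. F (x, t)))"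
  using assms(5)
proof (induction k arbitrary: F)
  case 0
  then have "continuous_on (S \<times> cbox 0 1) (\<lambda>(x, t). F (x, t))"
    using assms(4) by (auto intro: continuous_on_subset)
  from integral_continuous_on_param[OF this] show ?case by simp
next
  case (Suc k)
  have dF: "(F has_derivative frechet_derivative F (at (x, t))) (at (x, t))"
    if "x \<in> S" "t \<in> {0..1}" for x t
    by (rule C_k_on_SucD[OF Suc.prems]) (use that assms(4) in blast)
  \<comment> \<open>\<open>leibniz_rule\<close> expects the partial derivative as a continuous map
    into bounded linear operators; its continuity is checked on basis vectors.\<close>
  define F' where "F' x t = Blinfun (\<lambda>v. frechet_derivative F (at (x, t)) (v, 0))" for x t
  have F': "blinfun_apply (F' x t) v = frechet_derivative F (at (x, t)) (v, 0)"
    if "x \<in> S" "t \<in> {0..1}" for x t v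
  proof -
    have "bounded_linear (\<lambda>v. frechet_derivative F (at (x, t)) (v, 0))"
      using has_derivative_bounded_linear[OF dF[OF that]]
        bounded_linear_Pair[OF bounded_linear_ident bounded_linear_zero]
      by (rule bounded_linear_compose)
    then show ?thesis by (simp add: F'_def bounded_linear_Blinfun_apply)
  qed
  have contF: "continuous_on U F" using Suc.prems
    by (auto intro!: continuous_at_imp_continuous_on differentiable_imp_continuous_within)
  have cont_slice: "continuous_on {0..1} (\<lambda>t. F (x, t))" if "x \<in> S" for x
    using that assms(4) by (auto intro!: continuous_on_compose2[OF contF] continuous_intros)
  have k0: "C_k_on k U G \<Longrightarrow> continuous_on U G" for G :: "'e \<times> real \<Rightarrow> real"
    by (induction k arbitrary: G) (auto intro!: continuous_at_imp_continuous_on differentiable_imp_continuous_within)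
  have cont': "continuous_on U (\<lambda>z. frechet_derivative F (at z) w)" for w
    using Suc.prems by (intro k0) (cases w, simp)
  have contF': "continuous_on (S \<times> {0..1}) (\<lambda>(x, t). F' x t)"
  proof (rule continuous_on_blinfun_componentwise)
    fix i :: 'e
    have "continuous_on (S \<times> {0..1}) (\<lambda>z. frechet_derivative F (at z) (i, 0))"
      using cont' assms(4) by (rule continuous_on_subset)
    then show "continuous_on (S \<times> {0..1}) (\<lambda>x. blinfun_apply (case x of (x, t) \<Rightarrow> F' x t) i)"
      by (rule continuous_on_eq) (auto simp: F')
  qed
  have contF'_slice: "continuous_on {0..1} (F' x)" if "x \<in> S" for x
  proof -
    have "continuous_on {0..1} (\<lambda>t. case (x, t) of (x, t) \<Rightarrow> F' x t)"
      using that by (intro continuous_on_compose2[OF contF']) (auto intro!: continuous_intros)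
    then show ?thesis by simp
  qed
  show ?case
  proof (rule C_k_on_SucI[OF assms(1)])
    fix x assume x: "x \<in> S"
    have "((\<lambda>x. integral (cbox 0 1) (\<lambda>t. F (x, t))) has_derivative integral (cbox 0 1) (F' x)) (at x within S)"
    proof (rule leibniz_rule[OF _ _ _ x assms(2)])
      fix x t assume xt: "x \<in> S" "t \<in> cbox (0::real) 1"
      have "((\<lambda>x. F (x, t)) has_derivative (\<lambda>v. frechet_derivative F (at (x, t)) (v, 0))) (at x within S)"
      proof (rule has_derivative_compose[of "\<lambda>x. (x, t)" "\<lambda>v. (v, 0)"])
        show "((\<lambda>x. (x, t)) has_derivative (\<lambda>v. (v, 0))) (at x within S)"
          by (auto intro!: derivative_eq_intros)
      qed (use dF xt in auto)
      then show "((\<lambda>x. F (x, t)) has_derivative blinfun_apply (F' x t)) (at x within S)"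
        by (rule has_derivative_eq_rhs) (use F' xt in auto)
    next
      show "(\<lambda>t. F (x, t)) integrable_on cbox 0 1" if "x \<in> S" for x
        using cont_slice[OF that] integrable_continuous_real by auto
      show "continuous_on (S \<times> cbox 0 1) (\<lambda>(x, t). F' x t)" using contF' by simp
    qed
    then show "((\<lambda>x. integral {0..1} (\<lambda>t. F (x, t))) has_derivative integral {0..1} (F' x)) (at x)"
      using x assms(1) at_within_open by (metis cbox_interval)
  next
    fix v :: 'e
    have "C_k_on k S (\<lambda>x. integral {0..1} (\<lambda>t. frechet_derivative F (at (x, t)) (v, 0)))"
      using Suc.prems by (intro Suc.IH[of "\<lambda>z. frechet_derivative F (at z) (v, 0)"]) auto
    then show "C_k_on k S (\<lambda>x. blinfun_apply (integral {0..1} (F' x)) v)"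
    proof (rule C_k_on_cong[OF assms(1), rotated])
      fix x assume x: "x \<in> S"
      have "blinfun_apply (integral {0..1} (F' x)) v = integral {0..1} (\<lambda>t. blinfun_apply (F' x t) v)"
        using contF'_slice[OF x] by (intro blinfun_apply_integral integrable_continuous_real)
      also have "\<dots> = integral {0..1} (\<lambda>t. frechet_derivative F (at (x, t)) (v, 0))"
        using x by (intro integral_cong) (simp add: F')
      finally show "integral {0..1} (\<lambda>t. frechet_derivative F (at (x, t)) (v, 0))
        = blinfun_apply (integral {0..1} (F' x)) v" by simp
    qed
  qed
qed


section \<open>Smooth maps\<close>

lemma smooth_on_cong:
  assumes "open S" "\<And>x. x \<in> S \<Longrightarrow> f x = g x" "smooth_on S f"
  shows "smooth_on S g"
  using assms C_k_on_cong unfolding smooth_on_def by blast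

lemma smooth_on_subset: "smooth_on S f \<Longrightarrow> T \<subseteq> S \<Longrightarrow> smooth_on T f"
  using C_k_on_subset unfolding smooth_on_def by blast

lemma smooth_on_local:
  assumes "\<And>x. x \<in> S \<Longrightarrow> \<exists>T. open T \<and> x \<in> T \<and> smooth_on T f"
  shows "smooth_on S f"
  using assms C_k_on_local unfolding smooth_on_def by meson

lemma smooth_on_frechet_derivative:
  "smooth_on S f \<Longrightarrow> smooth_on S (\<lambda>x. frechet_derivative f (at x) v)"
  unfolding smooth_on_def by (metis C_k_on.simps(2))

lemma smooth_on_has_derivative:
  "smooth_on S f \<Longrightarrow> x \<in> S \<Longrightarrow> (f has_derivative frechet_derivative f (at x)) (at x)"
  unfolding smooth_on_def using C_k_on_SucD by blast

lemma smooth_on_imp_continuous_on: "smooth_on S f \<Longrightarrow> continuous_on S f"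
  unfolding smooth_on_def by (metis C_k_on.simps(1))

lemma smooth_on_const: "open S \<Longrightarrow> smooth_on S (\<lambda>x. c)"
  by (simp add: smooth_on_def C_k_on_const)

lemma smooth_on_bounded_linear: "bounded_linear L \<Longrightarrow> open S \<Longrightarrow> smooth_on S L"
  by (simp add: smooth_on_def C_k_on_bounded_linear)

lemma smooth_on_add:
  "open S \<Longrightarrow> smooth_on S f \<Longrightarrow> smooth_on S g \<Longrightarrow> smooth_on S (\<lambda>x. f x + g x)"
  by (simp add: smooth_on_def C_k_on_add)

lemma smooth_on_linear_compose:
  "bounded_linear L \<Longrightarrow> open S \<Longrightarrow> smooth_on S f \<Longrightarrow> smooth_on S (\<lambda>x. L (f x))"
  by (simp add: smooth_on_def C_k_on_linear_compose)

lemma smooth_on_compose_linear: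
  "bounded_linear L \<Longrightarrow> open S \<Longrightarrow> open T \<Longrightarrow> smooth_on T f \<Longrightarrow> L ` S \<subseteq> T \<Longrightarrow>
    smooth_on S (\<lambda>x. f (L x))"
  unfolding smooth_on_def using C_k_on_compose_linear by blast

lemma smooth_on_bilinear:
  "bounded_bilinear B \<Longrightarrow> open S \<Longrightarrow> smooth_on S f \<Longrightarrow> smooth_on S g \<Longrightarrow>
    smooth_on S (\<lambda>x. B (f x) (g x))"
  by (simp add: smooth_on_def C_k_on_bilinear)

lemmas smooth_on_mult = smooth_on_bilinear[OF bounded_bilinear_mult]
lemmas smooth_on_scaleR = smooth_on_bilinear[OF bounded_bilinear_scaleR]

lemma smooth_on_minus:
  "open S \<Longrightarrow> smooth_on S f \<Longrightarrow> smooth_on S g \<Longrightarrow> smooth_on S (\<lambda>x. f x - g x)"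
  using smooth_on_add[of S f "\<lambda>x. - g x"]
    smooth_on_linear_compose[OF bounded_linear_minus[OF bounded_linear_ident], of S g] by simp

lemma smooth_on_sum:
  "open S \<Longrightarrow> finite I \<Longrightarrow> (\<And>i. i \<in> I \<Longrightarrow> smooth_on S (f i)) \<Longrightarrow> smooth_on S (\<lambda>x. \<Sum>i\<in>I. f i x)"
  by (simp add: smooth_on_def C_k_on_sum)

lemma smooth_on_Pair:
  assumes "open S" "smooth_on S f" "smooth_on S g"
  shows "smooth_on S (\<lambda>x. (f x, g x))"
proof -
  have "bounded_linear (\<lambda>x. (x, 0))" "bounded_linear (\<lambda>y. (0, y))"
    by (intro bounded_linear_Pair bounded_linear_ident bounded_linear_zero)+
  from smooth_on_linear_compose[OF this(1) assms(1,2)] smooth_on_linear_compose[OF this(2) assms(1,3)]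
  show ?thesis using smooth_on_add[OF assms(1)] by fastforce
qed

lemma smooth_on_compose:
  fixes f :: "'e::real_normed_vector \<Rightarrow> 'f::euclidean_space" and g :: "'f \<Rightarrow> real"
  shows "open S \<Longrightarrow> open T \<Longrightarrow> smooth_on T g \<Longrightarrow> smooth_on S f \<Longrightarrow> f ` S \<subseteq> T \<Longrightarrow>
    smooth_on S (\<lambda>x. g (f x))"
  unfolding smooth_on_def using C_k_on_compose by blast

lemma smooth_on_inverse:
  fixes f :: "'e::real_normed_vector \<Rightarrow> real"
  shows "open S \<Longrightarrow> smooth_on S f \<Longrightarrow> (\<And>x. x \<in> S \<Longrightarrow> f x \<noteq> 0) \<Longrightarrow> smooth_on S (\<lambda>x. inverse (f x))"
  by (simp add: smooth_on_def C_k_on_inverse)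

text \<open>Integrating the derivative of \<open>f\<close> along the segment from \<open>a\<close>
  to \<open>x\<close> exhibits \<open>h i x\<close> as the mean of the i-th partial derivative over
  that segment; convexity keeps the segment in \<open>S\<close>. The factors that vanish at
  \<open>a\<close> are what the Leibniz rule exploits in \<open>tangent_chart\<close>.\<close>

lemma hadamard_lemma:
  fixes f :: "'e::euclidean_space \<Rightarrow> real"
  assumes "open S" "convex S" "a \<in> S" "smooth_on S f"
  shows "\<exists>h. (\<forall>i\<in>Basis. smooth_on S (h i) \<and> h i a = frechet_derivative f (at a) i) \<and>
    (\<forall>x\<in>S. f x = f a + (\<Sum>i\<in>Basis. ((x - a) \<bullet> i) * h i x))"
proof -
  define m where "m = (\<lambda>z::'e \<times> real. a + snd z *\<^sub>R (fst z - a))"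
  \<comment> \<open>An open set of pairs \<open>(x, t)\<close> that contains \<open>S\<close> times
    [0, 1], as \<open>C_k_on_parametric_integral\<close> requires.\<close>
  define U where "U = m -` S"
  define h where "h i x = integral {0..1} (\<lambda>t. frechet_derivative f (at (m (x, t))) i)" for i x
  have "continuous_on UNIV m" unfolding m_def by (intro continuous_intros)
  then have U: "open U" unfolding U_def using assms(1) by (simp add: open_vimage)
  have seg: "m (x, t) \<in> S" if "x \<in> S" "t \<in> {0..1}" for x t
  proof -
    have "(1 - t) *\<^sub>R a + t *\<^sub>R x \<in> S"
      using convexD[OF assms(2,3) that(1), of "1 - t" t] that(2) by simp
    then show ?thesis unfolding m_def by (simp add: algebra_simps)
  qed
  have sm: "smooth_on U m" unfolding m_def
    by (intro smooth_on_add smooth_on_const smooth_on_scaleR smooth_on_minus U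
        smooth_on_bounded_linear bounded_linear_fst bounded_linear_snd)
  have h: "smooth_on S (h i)" for i
  proof -
    have "smooth_on U (\<lambda>z. frechet_derivative f (at (m z)) i)"
      using U_def by (intro smooth_on_compose[OF U assms(1) _ sm]
          smooth_on_frechet_derivative assms(4)) auto
    moreover have "S \<times> {0..1} \<subseteq> U" using seg by (auto simp: U_def)
    ultimately show ?thesis unfolding smooth_on_def h_def
      using C_k_on_parametric_integral[OF assms(1,2) U, of _ "\<lambda>z. frechet_derivative f (at (m z)) i"]
      by blast
  qed
  have "h i a = frechet_derivative f (at a) i" for i
    unfolding h_def m_def by simp
  moreover have "f x = f a + (\<Sum>i\<in>Basis. ((x - a) \<bullet> i) * h i x)" if x: "x \<in> S" for x
  proof -
    have dm: "((\<lambda>t. m (x, t)) has_vector_derivative (x - a)) (at t within T)" for t T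
      unfolding m_def by (auto intro!: derivative_eq_intros simp: has_vector_derivative_def)
    have df: "(f has_derivative frechet_derivative f (at (m (x, t)))) (at (m (x, t)))"
      if "t \<in> {0..1}" for t
      using smooth_on_has_derivative[OF assms(4) seg[OF x that]] .
    have lin: "frechet_derivative f (at (m (x, t))) v = (\<Sum>i\<in>Basis. (v \<bullet> i) * frechet_derivative f (at (m (x, t))) i)"
      if "t \<in> {0..1}" for t v
    proof -
      interpret linear "frechet_derivative f (at (m (x, t)))"
        using df[OF that] has_derivative_linear by blast
      show ?thesis
        by (subst euclidean_representation[symmetric, of v]) (simp only: sum scale real_scaleR_def)
    qed
    have "((\<lambda>t. f (m (x, t))) has_vector_derivative
        frechet_derivative f (at (m (x, t))) (x - a)) (at t within {0..1})" if "t \<in> {0..1}" for t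
      using vector_derivative_diff_chain_within[OF dm[of t "{0..1}"]
        has_derivative_at_withinI[OF df[OF that]]] by (simp add: o_def)
    then have "((\<lambda>t. frechet_derivative f (at (m (x, t))) (x - a)) has_integral (f (m (x, 1)) - f (m (x, 0)))) {0..1}"
      by (intro fundamental_theorem_of_calculus) auto
    then have "f (m (x, 1)) - f (m (x, 0)) = integral {0..1} (\<lambda>t. frechet_derivative f (at (m (x, t))) (x - a))"
      by (simp add: integral_unique)
    also have "\<dots> = integral {0..1} (\<lambda>t. \<Sum>i\<in>Basis. ((x - a) \<bullet> i) * frechet_derivative f (at (m (x, t))) i)"
      using lin by (intro integral_cong) auto
    also have "\<dots> = (\<Sum>i\<in>Basis. integral {0..1} (\<lambda>t. ((x - a) \<bullet> i) * frechet_derivative f (at (m (x, t))) i))"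
    proof (intro integral_sum finite_Basis integrable_continuous_real continuous_on_mult_left)
      fix i
      have "continuous_on S (\<lambda>y. frechet_derivative f (at y) i)"
        by (intro smooth_on_imp_continuous_on smooth_on_frechet_derivative assms(4))
      moreover have "continuous_on {0..1} (\<lambda>t. m (x, t))"
        unfolding m_def by (intro continuous_intros)
      ultimately show "continuous_on {0..1} (\<lambda>t. frechet_derivative f (at (m (x, t))) i)"
        using seg[OF x] by (auto intro: continuous_on_compose2)
    qed
    finally show ?thesis unfolding h_def m_def by simp
  qed
  ultimately show ?thesis using h by blast
qed

text \<open>The derivatives of \<open>exp (- 1 / t)\<close> on \<open>t > 0\<close> are combinations of these functions, which
  makes the class stable under differentiation.\<close>

definition flat_exp :: "nat \<Rightarrow> real \<Rightarrow> real" where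
  "flat_exp n t = (if t \<le> 0 then 0 else exp (- inverse t) * inverse t ^ n)"

lemma flat_exp_has_derivative:
  "(flat_exp n has_field_derivative flat_exp (n + 2) t - n * flat_exp (n + 1) t) (at t)"
proof -
  consider "t < 0" | "t = 0" | "t > 0" by linarith
  then show ?thesis
  proof cases
    case 1
    have "((\<lambda>t. 0) has_field_derivative 0) (at t)" by simp
    then have "(flat_exp n has_field_derivative 0) (at t)"
      by (rule has_field_derivative_transform_within_open[of _ _ _ "{..<0}"])
        (use 1 in \<open>auto simp: flat_exp_def\<close>)
    then show ?thesis using 1 by (simp add: flat_exp_def)
  next
    case 2
    \<comment> \<open>With x = 1 / h the difference quotient from the right becomes x^(n + 1) / exp
      x as x tends to infinity.\<close>
    have "((\<lambda>h. exp (- inverse h) * inverse h ^ (n + 1)) \<longlongrightarrow> 0) (at_right (0::real))"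
    proof -
      have "((\<lambda>x::real. x ^ (n + 1) / exp x) \<longlongrightarrow> 0) at_top" by (rule tendsto_power_div_exp_0)
      from filterlim_compose[OF this filterlim_inverse_at_top_right]
      show ?thesis by (simp add: exp_minus field_simps)
    qed
    then have "((\<lambda>h. flat_exp n h / h) \<longlongrightarrow> 0) (at_right 0)"
      by (rule Lim_transform_eventually)
        (auto simp: eventually_at_filter flat_exp_def divide_inverse)
    moreover have "((\<lambda>h. flat_exp n h / h) \<longlongrightarrow> 0) (at_left 0)"
      by (rule Lim_transform_eventually[OF tendsto_const])
        (auto simp: eventually_at_filter flat_exp_def)
    ultimately have "((\<lambda>h. flat_exp n h / h) \<longlongrightarrow> 0) (at 0)"
      using filterlim_split_at by blast
    then show ?thesis using 2 by (simp add: DERIV_def flat_exp_def)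
  next
    case 3
    have "((\<lambda>t. exp (- inverse t) * inverse t ^ n) has_field_derivative
        flat_exp (n + 2) t - n * flat_exp (n + 1) t) (at t)"
    proof (rule DERIV_cong)
      show "((\<lambda>t. exp (- inverse t) * inverse t ^ n) has_field_derivative
          exp (- inverse t) * (inverse t * inverse t) * inverse t ^ n
          + (n * inverse t ^ (n - 1) * (- (inverse t * inverse t))) * exp (- inverse t)) (at t)"
        using 3 by (auto intro!: derivative_eq_intros)
      \<comment> \<open>For \<open>n = 0\<close> the exponent \<open>n - 1\<close> is truncated to
        0, which is harmless because of the factor \<open>n\<close>.\<close>
      show "exp (- inverse t) * (inverse t * inverse t) * inverse t ^ n
          + (n * inverse t ^ (n - 1) * (- (inverse t * inverse t))) * exp (- inverse t)
          = flat_exp (n + 2) t - n * flat_exp (n + 1) t"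
        using 3 by (cases n) (simp_all add: flat_exp_def algebra_simps)
    qed
    then show ?thesis
      by (rule has_field_derivative_transform_within_open[of _ _ _ "{0<..}"])
        (use 3 in \<open>auto simp: flat_exp_def\<close>)
  qed
qed

lemma smooth_on_flat_exp: "smooth_on UNIV (flat_exp n)"
  unfolding smooth_on_def
proof
  fix k
  show "C_k_on k UNIV (flat_exp n)"
  proof (induction k arbitrary: n)
    case 0
    then show ?case
      using DERIV_isCont[OF flat_exp_has_derivative] by (auto simp: continuous_on_eq_continuous_at)
  next
    case (Suc k)
    show ?case
    proof (rule C_k_on_SucI)
      show "(flat_exp n has_derivative (\<lambda>v. (flat_exp (n + 2) t + (- n) * flat_exp (n + 1) t) * v)) (at t)" for t
        using flat_exp_has_derivative[of n t] by (simp add: has_field_derivative_def)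
      show "C_k_on k UNIV (\<lambda>t. (flat_exp (n + 2) t + (- n) * flat_exp (n + 1) t) * v)" for v
        by (intro C_k_on_bilinear[OF bounded_bilinear_mult] C_k_on_add C_k_on_const Suc.IH) auto
    qed auto
  qed
qed

text \<open>The quotient u / (u + w) works: \<open>u\<close> is positive exactly inside the ball of
  radius r and \<open>w\<close> exactly outside the closed ball of radius r / 2, so the denominator
  never vanishes. Squared distances are used because they are smooth everywhere.\<close>

lemma smooth_bump_euclidean:
  fixes a :: "'e::euclidean_space"
  assumes "r > 0"
  shows "\<exists>\<rho>::'e \<Rightarrow> real. smooth_on UNIV \<rho> \<and> (\<forall>x\<in>ball a (r / 2). \<rho> x = 1) \<and> (\<forall>x. x \<notin> ball a r \<longrightarrow> \<rho> x = 0)"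
proof -
  define s where "s x = (x - a) \<bullet> (x - a)" for x :: 'e
  define u where "u x = flat_exp 0 (r\<^sup>2 - s x)" for x
  define w where "w x = flat_exp 0 (s x - r\<^sup>2 / 4)" for x
  have s: "s x = (dist a x)\<^sup>2" for x
    by (simp add: s_def dist_norm power2_norm_eq_inner[symmetric] norm_minus_commute)
  have sms: "smooth_on UNIV s" unfolding s_def
    by (intro smooth_on_bilinear[OF bounded_bilinear_inner] smooth_on_minus smooth_on_const
        smooth_on_bounded_linear bounded_linear_ident open_UNIV)
  have smu: "smooth_on UNIV u" and smw: "smooth_on UNIV w" unfolding u_def w_def
    by (intro smooth_on_compose[OF _ _ smooth_on_flat_exp] smooth_on_minus smooth_on_const sms; simp)+
  have pos: "u x + w x > 0" for x
  proof -
    have "r\<^sup>2 - s x > 0 \<or> s x - r\<^sup>2 / 4 > 0" using assms by (auto simp: field_simps) (smt (verit) zero_less_power)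
    then show ?thesis by (auto simp: u_def w_def flat_exp_def add_pos_nonneg add_nonneg_pos)
  qed
  define \<rho> where "\<rho> x = u x * inverse (u x + w x)" for x
  have "smooth_on UNIV \<rho>" unfolding \<rho>_def
    using pos by (intro smooth_on_mult smooth_on_inverse smooth_on_add smu smw) (auto simp: less_le)
  moreover have "\<rho> x = 1" if "x \<in> ball a (r / 2)" for x
  proof -
    have "s x \<le> r\<^sup>2 / 4"
      using that power_mono[of "dist a x" "r / 2" 2] by (simp add: s power_divide)
    then have "w x = 0" by (simp add: w_def flat_exp_def)
    then show ?thesis using pos[of x] by (simp add: \<rho>_def)
  qed
  moreover have "\<rho> x = 0" if "x \<notin> ball a r" for x
  proof -
    have "r\<^sup>2 \<le> s x" using that assms power_mono[of r "dist a x" 2] by (simp add: s)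
    then show ?thesis by (simp add: \<rho>_def u_def flat_exp_def)
  qed
  ultimately show ?thesis by blast
qed

section \<open>Tangent spaces in charts\<close>

locale smooth_manifold =
  fixes A :: "('a::{t2_space, second_countable_topology}, 'e::euclidean_space) atlas"
  assumes atlas: "smooth_atlas A"
begin

lemma chart_cover: "\<exists>U \<phi>. (U, \<phi>) \<in> A \<and> p \<in> U"
proof -
  have "p \<in> (\<Union>(U, \<phi>)\<in>A. U)" using atlas by (simp add: smooth_atlas_def)
  then show ?thesis by auto
qed

lemma
  assumes "(U, \<phi>) \<in> A"
  shows chart_open: "open U" and chart_image_open: "open (\<phi> ` U)"
    and chart_homeo: "homeomorphism U (\<phi> ` U) \<phi> (inv_into U \<phi>)"
  using atlas assms unfolding smooth_atlas_def by auto

lemma chart_inv: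
  assumes "(U, \<phi>) \<in> A"
  shows "x \<in> U \<Longrightarrow> inv_into U \<phi> (\<phi> x) = x" and "y \<in> \<phi> ` U \<Longrightarrow> \<phi> (inv_into U \<phi> y) = y"
    and "y \<in> \<phi> ` U \<Longrightarrow> inv_into U \<phi> y \<in> U"
  using chart_homeo[OF assms] unfolding homeomorphism_def by auto

lemma chart_transition:
  "(U, \<phi>) \<in> A \<Longrightarrow> (V, \<psi>) \<in> A \<Longrightarrow> smooth_on (\<phi> ` (U \<inter> V)) (\<psi> \<circ> inv_into U \<phi>)"
  using atlas unfolding smooth_atlas_def by fast

lemma chart_image_open_subset:
  assumes "(U, \<phi>) \<in> A" "open W" "W \<subseteq> U"
  shows "open (\<phi> ` W)"
proof -
  have "openin (top_of_set (\<phi> ` U)) (\<phi> ` W)"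
    using homeomorphism_imp_open_map[OF chart_homeo[OF assms(1)]] assms
    by (simp add: chart_open openin_open_eq)
  then show ?thesis using chart_image_open[OF assms(1)] openin_open_trans by blast
qed

lemma chart_vimage_open:
  assumes "(U, \<phi>) \<in> A" "open S"
  shows "open (U \<inter> \<phi> -` S)"
  using chart_homeo[OF assms(1)] chart_open[OF assms(1)] assms(2) unfolding homeomorphism_def
  by (metis continuous_on_open_vimage Int_commute)

section \<open>Smooth functions on a manifold\<close>

lemma smooth_fun_chart: "f \<in> smooth_fun A \<Longrightarrow> (U, \<phi>) \<in> A \<Longrightarrow> smooth_on (\<phi> ` U) (f \<circ> inv_into U \<phi>)"
  unfolding smooth_fun_def by auto

text \<open>Transition maps carry smoothness near a point from one chart to all others, so a single
  chart around each point suffices.\<close>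

lemma smooth_funI_chart:
  assumes "\<And>p. \<exists>U \<phi> S. (U, \<phi>) \<in> A \<and> p \<in> U \<and> open S \<and> \<phi> p \<in> S \<and> S \<subseteq> \<phi> ` U
    \<and> smooth_on S (f \<circ> inv_into U \<phi>)"
  shows "f \<in> smooth_fun A"
proof -
  have "smooth_on (\<psi> ` V) (f \<circ> inv_into V \<psi>)" if V: "(V, \<psi>) \<in> A" for V \<psi>
  proof (rule smooth_on_local)
    fix y assume "y \<in> \<psi> ` V"
    then obtain p where p: "p \<in> V" "y = \<psi> p" by auto
    obtain U \<phi> S where U: "(U, \<phi>) \<in> A" "p \<in> U" "open S" "\<phi> p \<in> S" "S \<subseteq> \<phi> ` U"
      "smooth_on S (f \<circ> inv_into U \<phi>)" using assms[of p] by (elim exE conjE)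
    define T where "T = \<psi> ` (V \<inter> (U \<inter> \<phi> -` S))"
    have T: "open T" unfolding T_def
      by (rule chart_image_open_subset[OF V]) (auto intro: chart_open V chart_vimage_open U)
    have "smooth_on T (\<lambda>z. (f \<circ> inv_into U \<phi>) ((\<phi> \<circ> inv_into V \<psi>) z))"
    proof (rule smooth_on_compose[OF T U(3,6)])
      show "smooth_on T (\<phi> \<circ> inv_into V \<psi>)"
        by (rule smooth_on_subset[OF chart_transition[OF V U(1)]]) (auto simp: T_def)
      show "(\<phi> \<circ> inv_into V \<psi>) ` T \<subseteq> S"
        using chart_inv(1)[OF V] by (auto simp: T_def)
    qed
    then have "smooth_on T (f \<circ> inv_into V \<psi>)"
      by (rule smooth_on_cong[OF T, rotated]) (auto simp: T_def chart_inv(1)[OF V] chart_inv(1)[OF U(1)])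
    then show "\<exists>T. open T \<and> y \<in> T \<and> smooth_on T (f \<circ> inv_into V \<psi>)"
      using T p U(2,4) by (auto simp: T_def)
  qed
  then show ?thesis unfolding smooth_fun_def by auto
qed

lemma smooth_fun_local:
  assumes "\<And>p. \<exists>N g. open N \<and> p \<in> N \<and> g \<in> smooth_fun A \<and> (\<forall>x\<in>N. f x = g x)"
  shows "f \<in> smooth_fun A"
proof (rule smooth_funI_chart)
  fix p
  obtain N g where N: "open N" "p \<in> N" "g \<in> smooth_fun A" "\<And>x. x \<in> N \<Longrightarrow> f x = g x"
    using assms by metis
  obtain U \<phi> where U: "(U, \<phi>) \<in> A" "p \<in> U" using chart_cover by blast
  define S where "S = \<phi> ` (U \<inter> N)"
  have S: "open S" unfolding S_def
    by (rule chart_image_open_subset[OF U(1)]) (auto intro: chart_open U N)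
  have "smooth_on S (g \<circ> inv_into U \<phi>)"
    by (rule smooth_on_subset[OF smooth_fun_chart[OF N(3) U(1)]]) (auto simp: S_def)
  then have "smooth_on S (f \<circ> inv_into U \<phi>)"
    by (rule smooth_on_cong[OF S, rotated]) (auto simp: S_def N chart_inv(1)[OF U(1)])
  then show "\<exists>U \<phi> S. (U, \<phi>) \<in> A \<and> p \<in> U \<and> open S \<and> \<phi> p \<in> S \<and> S \<subseteq> \<phi> ` U
    \<and> smooth_on S (f \<circ> inv_into U \<phi>)"
    using U S N(2) by (intro exI[of _ U] exI[of _ \<phi>] exI[of _ S]) (auto simp: S_def)
qed

lemma smooth_fun_const [simp, intro]: "(\<lambda>x. c) \<in> smooth_fun A"
  unfolding smooth_fun_def using chart_image_open by (auto simp: o_def intro: smooth_on_const)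

lemma smooth_fun_add [intro]:
  "f \<in> smooth_fun A \<Longrightarrow> g \<in> smooth_fun A \<Longrightarrow> (\<lambda>x. f x + g x) \<in> smooth_fun A"
  unfolding smooth_fun_def using chart_image_open by (auto simp: o_def intro!: smooth_on_add)

lemma smooth_fun_diff [intro]:
  "f \<in> smooth_fun A \<Longrightarrow> g \<in> smooth_fun A \<Longrightarrow> (\<lambda>x. f x - g x) \<in> smooth_fun A"
  unfolding smooth_fun_def using chart_image_open by (auto simp: o_def intro!: smooth_on_minus)

lemma smooth_fun_mult [intro]:
  "f \<in> smooth_fun A \<Longrightarrow> g \<in> smooth_fun A \<Longrightarrow> (\<lambda>x. f x * g x) \<in> smooth_fun A"
  unfolding smooth_fun_def using chart_image_open by (auto simp: o_def intro!: smooth_on_mult)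

lemma smooth_fun_scale: "f \<in> smooth_fun A \<Longrightarrow> (\<lambda>x. c * f x) \<in> smooth_fun A"
  using smooth_fun_mult[of "\<lambda>x. c" f] by simp

lemma smooth_fun_minus [intro]: "f \<in> smooth_fun A \<Longrightarrow> (\<lambda>x. - f x) \<in> smooth_fun A"
  using smooth_fun_diff[of "\<lambda>x. 0" f] by simp

lemma smooth_fun_power [intro]: "f \<in> smooth_fun A \<Longrightarrow> (\<lambda>x. f x ^ n) \<in> smooth_fun A"
  by (induction n) auto

lemma smooth_fun_sum:
  "finite I \<Longrightarrow> (\<And>i. i \<in> I \<Longrightarrow> f i \<in> smooth_fun A) \<Longrightarrow> (\<lambda>x. \<Sum>i\<in>I. f i x) \<in> smooth_fun A"
  by (induction I rule: finite_induct) auto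

lemma smooth_fun_continuous:
  assumes "f \<in> smooth_fun A"
  shows "continuous_on UNIV f"
proof -
  have "continuous_on U f" if U: "(U, \<phi>) \<in> A" for U \<phi>
  proof -
    have "continuous_on U \<phi>" using chart_homeo[OF U] by (simp add: homeomorphism_def)
    then have "continuous_on U ((f \<circ> inv_into U \<phi>) \<circ> \<phi>)"
      using smooth_on_imp_continuous_on[OF smooth_fun_chart[OF assms U]]
      by (rule continuous_on_compose)
    then show ?thesis by (rule continuous_on_eq) (simp add: chart_inv(1)[OF U])
  qed
  then have "isCont f p" for p
    using chart_cover[of p] chart_open by (metis continuous_on_eq_continuous_at)
  then show ?thesis by (simp add: continuous_on_eq_continuous_at)
qed

text \<open>At a point where the extension is 0 by definition it has to vanish on a whole
  neighbourhood. The image \<open>K'\<close> of \<open>K\<close> in the manifold is compact, hence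
  closed by the Hausdorff property, and its complement is such a neighbourhood.\<close>

lemma smooth_fun_extend:
  assumes U: "(U, \<phi>) \<in> A" and S: "open S" "S \<subseteq> \<phi> ` U" and K: "compact K" "K \<subseteq> S"
    and u: "smooth_on S u" "\<And>y. y \<in> S - K \<Longrightarrow> u y = 0"
  shows "(\<lambda>x. if x \<in> U \<and> \<phi> x \<in> S then u (\<phi> x) else 0) \<in> smooth_fun A" (is "?f \<in> _")
proof (rule smooth_funI_chart)
  fix p
  show "\<exists>U \<phi> S. (U, \<phi>) \<in> A \<and> p \<in> U \<and> open S \<and> \<phi> p \<in> S \<and> S \<subseteq> \<phi> ` U
    \<and> smooth_on S (?f \<circ> inv_into U \<phi>)"
  proof (cases "p \<in> U \<and> \<phi> p \<in> S")
    case True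
    have "smooth_on S (?f \<circ> inv_into U \<phi>)"
      by (rule smooth_on_cong[OF S(1) _ u(1)]) (use S(2) chart_inv(2,3)[OF U] in force)
    then show ?thesis using U S True by (intro exI[of _ U] exI[of _ \<phi>] exI[of _ S]) simp
  next
    case False
    define K' where "K' = inv_into U \<phi> ` K"
    have "continuous_on (\<phi> ` U) (inv_into U \<phi>)"
      using chart_homeo[OF U] by (simp add: homeomorphism_def)
    then have "continuous_on K (inv_into U \<phi>)"
      by (rule continuous_on_subset) (use K(2) S(2) in blast)
    then have "closed K'" unfolding K'_def
      using K(1) compact_continuous_image compact_imp_closed by blast
    obtain V \<psi> where V: "(V, \<psi>) \<in> A" "p \<in> V" using chart_cover by blast
    define T where "T = \<psi> ` (V - K')"
    have T: "open T" unfolding T_def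
      by (rule chart_image_open_subset[OF V(1)]) (auto intro: chart_open V \<open>closed K'\<close>)
    have "p \<notin> K'"
    proof
      assume "p \<in> K'"
      then obtain y where "y \<in> K" "p = inv_into U \<phi> y" by (auto simp: K'_def)
      moreover from this have "y \<in> S" "y \<in> \<phi> ` U" using K(2) S(2) by blast+
      ultimately show False using False chart_inv(2,3)[OF U, of y] by simp
    qed
    moreover have zero: "?f x = 0" if "x \<notin> K'" for x
    proof (cases "x \<in> U \<and> \<phi> x \<in> S")
      case True
      then have "\<phi> x \<notin> K" using that chart_inv(1)[OF U, of x] unfolding K'_def by (metis imageI)
      then show ?thesis using True u(2) by simp
    qed auto
    have "smooth_on T (?f \<circ> inv_into V \<psi>)"
    proof (rule smooth_on_cong[OF T _ smooth_on_const[OF T]])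
      fix y assume "y \<in> T"
      then obtain x where x: "x \<in> V" "x \<notin> K'" "y = \<psi> x" by (auto simp: T_def)
      show "0 = (?f \<circ> inv_into V \<psi>) y"
        unfolding o_apply x(3) chart_inv(1)[OF V(1) x(1)] using zero[OF x(2)] by (rule sym)
    qed
    ultimately show ?thesis using V T by (intro exI[of _ V] exI[of _ \<psi>] exI[of _ T]) (auto simp: T_def)
  qed
qed

section \<open>Derivations at a point\<close>

lemma tv_lincomb:
  "v \<in> tangent_space A p \<Longrightarrow> f \<in> smooth_fun A \<Longrightarrow> h \<in> smooth_fun A \<Longrightarrow>
    v (\<lambda>x. a * f x + c * h x) = a * v f + c * v h"
  unfolding tangent_space_def by blast

lemma tv_mult:
  "v \<in> tangent_space A p \<Longrightarrow> f \<in> smooth_fun A \<Longrightarrow> h \<in> smooth_fun A \<Longrightarrow>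
    v (\<lambda>x. f x * h x) = f p * v h + h p * v f"
  unfolding tangent_space_def by blast

lemma tv_nonsmooth: "v \<in> tangent_space A p \<Longrightarrow> f \<notin> smooth_fun A \<Longrightarrow> v f = 0"
  unfolding tangent_space_def by blast

lemma tv_add:
  "v \<in> tangent_space A p \<Longrightarrow> f \<in> smooth_fun A \<Longrightarrow> h \<in> smooth_fun A \<Longrightarrow>
    v (\<lambda>x. f x + h x) = v f + v h"
  using tv_lincomb[of v p f h 1 1] by simp

lemma tv_diff:
  "v \<in> tangent_space A p \<Longrightarrow> f \<in> smooth_fun A \<Longrightarrow> h \<in> smooth_fun A \<Longrightarrow>
    v (\<lambda>x. f x - h x) = v f - v h"
  using tv_lincomb[of v p f h 1 "-1"] by simp

lemma tv_scale: "v \<in> tangent_space A p \<Longrightarrow> f \<in> smooth_fun A \<Longrightarrow> v (\<lambda>x. c * f x) = c * v f"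
  using tv_lincomb[of v p f f c 0] by simp

lemma tv_minus: "v \<in> tangent_space A p \<Longrightarrow> f \<in> smooth_fun A \<Longrightarrow> v (\<lambda>x. - f x) = - v f"
  using tv_scale[of v p f "-1"] by simp

text \<open>The Leibniz rule applied to 1 = 1 * 1 gives v(1) = 2 v(1).\<close>

lemma tv_const: "v \<in> tangent_space A p \<Longrightarrow> v (\<lambda>x. c) = 0"
  using tv_mult[of v p "\<lambda>x. 1" "\<lambda>x. 1"] tv_scale[of v p "\<lambda>x. 1" c] by simp

lemma tv_sum:
  assumes "v \<in> tangent_space A p" "finite I" "\<And>i. i \<in> I \<Longrightarrow> f i \<in> smooth_fun A"
  shows "v (\<lambda>x. \<Sum>i\<in>I. f i x) = (\<Sum>i\<in>I. v (f i))"
  using assms(2,3)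
proof (induction I rule: finite_induct)
  case (insert i I)
  then show ?case using tv_add[OF assms(1), of "f i" "\<lambda>x. \<Sum>i\<in>I. f i x"] smooth_fun_sum by auto
qed (simp add: tv_const[OF assms(1)])

lemma tv_power:
  assumes "v \<in> tangent_space A p" "f \<in> smooth_fun A"
  shows "v (\<lambda>x. f x ^ n) = n * f p ^ (n - 1) * v f"
proof (induction n)
  case (Suc n)
  have "v (\<lambda>x. f x ^ Suc n) = f p * v (\<lambda>x. f x ^ n) + f p ^ n * v f"
    using tv_mult[OF assms smooth_fun_power[OF assms(2)], of n] by simp
  then show ?case using Suc by (cases n) (auto simp: algebra_simps)
qed (simp add: tv_const[OF assms(1)])

lemma tangent_space_eqI:
  assumes "v \<in> tangent_space A p" "w \<in> tangent_space A p" "\<And>f. f \<in> smooth_fun A \<Longrightarrow> v f = w f"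
  shows "v = w"
  using assms tv_nonsmooth by (metis ext)

lemma tangent_space_lincomb:
  "v \<in> tangent_space A p \<Longrightarrow> w \<in> tangent_space A p \<Longrightarrow> (\<lambda>f. a * v f + c * w f) \<in> tangent_space A p"
  unfolding tangent_space_def by (auto simp: algebra_simps)

lemma tangent_space_zero [simp]: "(\<lambda>f. 0) \<in> tangent_space A p"
  unfolding tangent_space_def by auto

lemma tangent_space_scale: "v \<in> tangent_space A p \<Longrightarrow> (\<lambda>f. a * v f) \<in> tangent_space A p"
  using tangent_space_lincomb[of v p v a 0] by simp

lemma tangent_space_add:
  "v \<in> tangent_space A p \<Longrightarrow> w \<in> tangent_space A p \<Longrightarrow> (\<lambda>f. v f + w f) \<in> tangent_space A p"
  using tangent_space_lincomb[of v p w 1 1] by simp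

lemma tangent_space_diff:
  "v \<in> tangent_space A p \<Longrightarrow> w \<in> tangent_space A p \<Longrightarrow> (\<lambda>f. v f - w f) \<in> tangent_space A p"
  using tangent_space_lincomb[of v p w 1 "-1"] by simp

lemma tangent_space_sum:
  "finite I \<Longrightarrow> (\<And>i. i \<in> I \<Longrightarrow> v i \<in> tangent_space A p) \<Longrightarrow>
    (\<lambda>f. \<Sum>i\<in>I. c i * v i f) \<in> tangent_space A p"
proof (induction I rule: finite_induct)
  case (insert i I)
  then show ?case
    using tangent_space_add[OF tangent_space_scale[of "v i" p "c i"], of "\<lambda>f. \<Sum>i\<in>I. c i * v i f"] by simp
qed simp

lemma bump:
  assumes "open N" "p \<in> N"
  obtains \<rho> N' where "\<rho> \<in> smooth_fun A" "open N'" "p \<in> N'" "N' \<subseteq> N"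
    "\<And>x. x \<in> N' \<Longrightarrow> \<rho> x = 1" "\<And>x. x \<notin> N \<Longrightarrow> \<rho> x = 0"
proof -
  obtain U \<phi> where U: "(U, \<phi>) \<in> A" "p \<in> U" using chart_cover by blast
  define S where "S = \<phi> ` (U \<inter> N)"
  have S: "open S" "S \<subseteq> \<phi> ` U" unfolding S_def
    by (rule chart_image_open_subset[OF U(1)]) (auto intro: chart_open U assms)
  have "\<phi> p \<in> S" using U assms by (auto simp: S_def)
  then obtain r where r: "r > 0" "cball (\<phi> p) r \<subseteq> S" using S(1) open_contains_cball by blast
  obtain u where u: "smooth_on UNIV u" "\<And>x. x \<in> ball (\<phi> p) (r / 2) \<Longrightarrow> u x = 1"
    "\<And>x. x \<notin> ball (\<phi> p) r \<Longrightarrow> u x = (0::real)"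
    using smooth_bump_euclidean[OF r(1), of "\<phi> p"] by blast
  define \<rho> where "\<rho> x = (if x \<in> U \<and> \<phi> x \<in> S then u (\<phi> x) else 0)" for x
  have "\<rho> \<in> smooth_fun A" unfolding \<rho>_def
    by (rule smooth_fun_extend[OF U(1) S compact_cball r(2) smooth_on_subset[OF u(1)]])
      (auto simp: u(3))
  moreover have "open (U \<inter> \<phi> -` ball (\<phi> p) (r / 2))"
    by (rule chart_vimage_open[OF U(1)]) simp
  moreover have ball: "ball (\<phi> p) (r / 2) \<subseteq> S"
    using r by (auto simp: subset_iff)
  moreover have "x \<in> N" if "x \<in> U" "\<phi> x \<in> S" for x
  proof -
    obtain x' where "x' \<in> U \<inter> N" "\<phi> x = \<phi> x'" using \<open>\<phi> x \<in> S\<close> by (auto simp: S_def)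
    then show ?thesis using chart_inv(1)[OF U(1)] that(1) by (metis IntD1 IntD2)
  qed
  ultimately show thesis using U(2) r(1)
    by (intro that[of \<rho> "U \<inter> \<phi> -` ball (\<phi> p) (r / 2)"]) (auto simp: \<rho>_def u(2))
qed

text \<open>For a bump function \<rho> vanishing off \<open>N\<close>, the product of \<rho> and f -
  g is identically 0. As f - g vanishes at \<open>p\<close>, the Leibniz rule leaves \<rho>(p) v(f -
  g) = v(f - g).\<close>

lemma tv_local:
  assumes v: "v \<in> tangent_space A p" and f: "f \<in> smooth_fun A" and g: "g \<in> smooth_fun A"
    and N: "open N" "p \<in> N" "\<And>x. x \<in> N \<Longrightarrow> f x = g x"
  shows "v f = v g"
proof -
  obtain \<rho> N' where \<rho>: "\<rho> \<in> smooth_fun A" and "open N'" and \<rho>': "p \<in> N'" and "N' \<subseteq> N"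
    and \<rho>1: "\<And>x. x \<in> N' \<Longrightarrow> \<rho> x = 1" and \<rho>0: "\<And>x. x \<notin> N \<Longrightarrow> \<rho> x = 0"
    using N(1,2) by (rule bump) (rule that)
  have d: "(\<lambda>x. f x - g x) \<in> smooth_fun A" using f g by auto
  have "(\<lambda>x. \<rho> x * (f x - g x)) = (\<lambda>x. 0)" using \<rho>0 N(3) by fastforce
  moreover have "v (\<lambda>x. \<rho> x * (f x - g x)) = \<rho> p * v (\<lambda>x. f x - g x) + (f p - g p) * v \<rho>"
    using tv_mult[OF v \<rho> d] .
  ultimately show ?thesis using \<rho>1[OF \<rho>'] N(2,3) tv_const[OF v, of 0] tv_diff[OF v f g] by simp
qed

text \<open>The value 0 off \<open>smooth_fun A\<close> is the normalisation that
  \<open>tangent_space\<close> imposes on representatives.\<close>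

definition chart_deriv :: "'a set \<Rightarrow> ('a \<Rightarrow> 'e) \<Rightarrow> 'a \<Rightarrow> 'e \<Rightarrow> 'a tvec" where
  "chart_deriv U \<phi> p e f = (if f \<in> smooth_fun A
     then frechet_derivative (f \<circ> inv_into U \<phi>) (at (\<phi> p)) e else 0)"

lemma chart_has_derivative:
  assumes "(U, \<phi>) \<in> A" "p \<in> U" "f \<in> smooth_fun A"
  shows "((f \<circ> inv_into U \<phi>) has_derivative (\<lambda>e. chart_deriv U \<phi> p e f)) (at (\<phi> p))"
  using smooth_on_has_derivative[OF smooth_fun_chart[OF assms(3,1)], of "\<phi> p"] assms
  by (simp add: chart_deriv_def)

lemma chart_deriv_eqI:
  assumes "(U, \<phi>) \<in> A" "p \<in> U" "f \<in> smooth_fun A"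
    and "((f \<circ> inv_into U \<phi>) has_derivative D) (at (\<phi> p))"
  shows "chart_deriv U \<phi> p e f = D e"
  using has_derivative_unique[OF chart_has_derivative[OF assms(1-3)] assms(4)] by meson

lemma chart_deriv_linear:
  assumes "(U, \<phi>) \<in> A" "p \<in> U" "f \<in> smooth_fun A"
  shows "linear (\<lambda>e. chart_deriv U \<phi> p e f)"
  using chart_has_derivative[OF assms] has_derivative_linear by blast

lemma chart_deriv_lincomb:
  assumes "(U, \<phi>) \<in> A" "p \<in> U"
  shows "chart_deriv U \<phi> p (a *\<^sub>R e + c *\<^sub>R e') = (\<lambda>f. a * chart_deriv U \<phi> p e f + c * chart_deriv U \<phi> p e' f)"
proof
  fix f
  show "chart_deriv U \<phi> p (a *\<^sub>R e + c *\<^sub>R e') f = a * chart_deriv U \<phi> p e f + c * chart_deriv U \<phi> p e' f"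
  proof (cases "f \<in> smooth_fun A")
    case True
    interpret linear "\<lambda>e. chart_deriv U \<phi> p e f" by (rule chart_deriv_linear[OF assms True])
    show ?thesis by (simp add: add scale)
  qed (simp add: chart_deriv_def)
qed

lemma chart_deriv_tangent:
  assumes U: "(U, \<phi>) \<in> A" "p \<in> U"
  shows "chart_deriv U \<phi> p e \<in> tangent_space A p"
proof -
  have "chart_deriv U \<phi> p e (\<lambda>x. a * f x + c * h x) = a * chart_deriv U \<phi> p e f + c * chart_deriv U \<phi> p e h"
    if "f \<in> smooth_fun A" "h \<in> smooth_fun A" for f h a c
  proof (rule chart_deriv_eqI[OF U])
    show "((\<lambda>x. a * f x + c * h x) \<circ> inv_into U \<phi> has_derivative
      (\<lambda>e. a * chart_deriv U \<phi> p e f + c * chart_deriv U \<phi> p e h)) (at (\<phi> p))"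
      using chart_has_derivative[OF U that(1)] chart_has_derivative[OF U that(2)]
      by (auto simp: o_def intro!: derivative_intros)
  qed (intro smooth_fun_add smooth_fun_scale that)
  moreover have "chart_deriv U \<phi> p e (\<lambda>x. f x * h x) = f p * chart_deriv U \<phi> p e h + h p * chart_deriv U \<phi> p e f"
    if "f \<in> smooth_fun A" "h \<in> smooth_fun A" for f h
  proof (rule chart_deriv_eqI[OF U])
    show "((\<lambda>x. f x * h x) \<circ> inv_into U \<phi> has_derivative
      (\<lambda>e. f p * chart_deriv U \<phi> p e h + h p * chart_deriv U \<phi> p e f)) (at (\<phi> p))"
      using has_derivative_mult[OF chart_has_derivative[OF U that(1)] chart_has_derivative[OF U that(2)]]
      by (simp add: o_def chart_inv(1)[OF U] mult.commute)
  qed (use that in auto)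
  moreover have "chart_deriv U \<phi> p e f = 0" if "f \<notin> smooth_fun A" for f
    using that by (simp add: chart_deriv_def)
  ultimately show ?thesis unfolding tangent_space_def by blast
qed

text \<open>Derivations act on global functions, so the chart coordinates are cut off by a bump
  function. Their values near \<open>p\<close> survive, and a derivation sees no more than
  that.\<close>

lemma chart_coordinates:
  assumes U: "(U, \<phi>) \<in> A" "p \<in> U"
  shows "\<exists>\<xi> N. open N \<and> p \<in> N \<and> N \<subseteq> U \<and> (\<forall>i. \<xi> i \<in> smooth_fun A) \<and> (\<forall>x\<in>N. \<forall>i. \<xi> i x = \<phi> x \<bullet> i)"
proof -
  obtain r where r: "r > 0" "cball (\<phi> p) r \<subseteq> \<phi> ` U"
    using chart_image_open[OF U(1)] open_contains_cball U(2) by blast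
  obtain u where u: "smooth_on UNIV u" "\<And>x. x \<in> ball (\<phi> p) (r / 2) \<Longrightarrow> u x = 1"
    "\<And>x. x \<notin> ball (\<phi> p) r \<Longrightarrow> u x = (0::real)"
    using smooth_bump_euclidean[OF r(1), of "\<phi> p"] by blast
  define \<xi> where "\<xi> i x = (if x \<in> U \<and> \<phi> x \<in> \<phi> ` U then u (\<phi> x) * (\<phi> x \<bullet> i) else 0)" for i x
  have "\<xi> i \<in> smooth_fun A" for i unfolding \<xi>_def
  proof (rule smooth_fun_extend[OF U(1) chart_image_open[OF U(1)] subset_refl compact_cball r(2)])
    show "smooth_on (\<phi> ` U) (\<lambda>y. u y * (y \<bullet> i))"
      by (intro smooth_on_mult chart_image_open[OF U(1)] smooth_on_subset[OF u(1)]
        smooth_on_bounded_linear bounded_linear_inner_left) auto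
  qed (auto simp: u(3))
  moreover have "open (U \<inter> \<phi> -` ball (\<phi> p) (r / 2))"
    by (rule chart_vimage_open[OF U(1)]) simp
  ultimately show ?thesis using U(2) r(1)
    by (intro exI[of _ \<xi>] exI[of _ "U \<inter> \<phi> -` ball (\<phi> p) (r / 2)"]) (auto simp: \<xi>_def u(2))
qed

lemma chart_deriv_coordinate:
  assumes U: "(U, \<phi>) \<in> A" and N: "open N" "p \<in> N" "N \<subseteq> U" and \<xi>: "\<xi> \<in> smooth_fun A"
    and eq: "\<And>x. x \<in> N \<Longrightarrow> \<xi> x = \<phi> x \<bullet> i"
  shows "chart_deriv U \<phi> p e \<xi> = e \<bullet> i"
proof (rule chart_deriv_eqI[OF U _ \<xi>])
  show "p \<in> U" using N by auto
  have "((\<lambda>y. y \<bullet> i) has_derivative (\<lambda>y. y \<bullet> i)) (at (\<phi> p))"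
    by (rule bounded_linear_imp_has_derivative[OF bounded_linear_inner_left])
  then show "(\<xi> \<circ> inv_into U \<phi> has_derivative (\<lambda>y. y \<bullet> i)) (at (\<phi> p))"
    by (rule has_derivative_transform_within_open[of _ _ _ _ "\<phi> ` N"])
      (use N eq chart_inv(1)[OF U] chart_image_open_subset[OF U] in auto)
qed

text \<open>Near \<open>p\<close>, Hadamard's lemma gives f = f(p) + sum \<xi>_i \<eta>_i with
  \<xi>_i(p) = 0. The Leibniz rule then yields v(f) = sum v(\<xi>_i) \<eta>_i(p), and \<eta>_i(p) is
  the i-th partial derivative of \<open>f\<close>; so the direction of \<open>v\<close> has the
  components v(\<xi>_i).\<close>

lemma tangent_chart:
  assumes U: "(U, \<phi>) \<in> A" and p: "p \<in> U" and v: "v \<in> tangent_space A p"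
  shows "\<exists>e. v = chart_deriv U \<phi> p e"
proof -
  obtain r where r: "r > 0" "ball (\<phi> p) r \<subseteq> \<phi> ` U"
    using chart_image_open[OF U] open_contains_ball p by blast
  define S where "S = ball (\<phi> p) r"
  have S: "open S" "convex S" "\<phi> p \<in> S" "S \<subseteq> \<phi> ` U" using r by (auto simp: S_def)
  have K: "cball (\<phi> p) (r / 2) \<subseteq> S" using r by (auto simp: S_def)
  \<comment> \<open>The support of \<open>u\<close> lies in the closed ball of radius r / 2, hence
    in \<open>S\<close>, and \<open>u\<close> is 1 on the ball of radius r / 4.\<close>
  obtain u where u: "smooth_on UNIV u" "\<And>x. x \<in> ball (\<phi> p) (r / 2 / 2) \<Longrightarrow> u x = 1"
    "\<And>x. x \<notin> ball (\<phi> p) (r / 2) \<Longrightarrow> u x = (0::real)"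
    using smooth_bump_euclidean[of "r / 2" "\<phi> p"] r(1) by auto
  have ext: "(\<lambda>x. if x \<in> U \<and> \<phi> x \<in> S then u (\<phi> x) * k (\<phi> x) else 0) \<in> smooth_fun A"
    if "smooth_on S k" for k
    by (rule smooth_fun_extend[OF U S(1,4) compact_cball K, where u="\<lambda>y. u y * k y"])
      (auto simp: u(3) intro!: smooth_on_mult S that smooth_on_subset[OF u(1)])
  define \<xi> where "\<xi> i x = (if x \<in> U \<and> \<phi> x \<in> S then u (\<phi> x) * ((\<phi> x - \<phi> p) \<bullet> i) else 0)" for i x
  have \<xi>: "\<xi> i \<in> smooth_fun A" for i unfolding \<xi>_def
    by (intro ext[of "\<lambda>y. (y - \<phi> p) \<bullet> i"] smooth_on_linear_compose[OF bounded_linear_inner_left]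
        smooth_on_minus smooth_on_const smooth_on_bounded_linear bounded_linear_ident S)
  have \<xi>p: "\<xi> i p = 0" for i by (simp add: \<xi>_def)
  define e where "e = (\<Sum>i\<in>Basis. v (\<xi> i) *\<^sub>R i)"
  have "v f = chart_deriv U \<phi> p e f" if f: "f \<in> smooth_fun A" for f
  proof -
    define k where "k = f \<circ> inv_into U \<phi>"
    have "smooth_on S k" unfolding k_def
      using smooth_fun_chart[OF f U] S(4) smooth_on_subset by blast
    from hadamard_lemma[OF S(1-3) this] obtain h where
      h: "\<And>i. i \<in> Basis \<Longrightarrow> smooth_on S (h i)" "\<And>i. i \<in> Basis \<Longrightarrow> h i (\<phi> p) = frechet_derivative k (at (\<phi> p)) i"
        "\<And>x. x \<in> S \<Longrightarrow> k x = k (\<phi> p) + (\<Sum>i\<in>Basis. ((x - \<phi> p) \<bullet> i) * h i x)" by blast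
    define \<eta> where "\<eta> i x = (if x \<in> U \<and> \<phi> x \<in> S then u (\<phi> x) * h i (\<phi> x) else 0)" for i x
    have \<eta>: "\<eta> i \<in> smooth_fun A" if "i \<in> Basis" for i
      unfolding \<eta>_def by (rule ext[OF h(1)[OF that]])
    have prod: "(\<lambda>x. \<xi> i x * \<eta> i x) \<in> smooth_fun A" if "i \<in> Basis" for i
      using \<xi> \<eta>[OF that] by auto
    then have sm: "(\<lambda>x. \<Sum>i\<in>Basis. \<xi> i x * \<eta> i x) \<in> smooth_fun A"
      by (intro smooth_fun_sum) auto
    have up: "u (\<phi> p) = 1" using u(2) r(1) by simp
    \<comment> \<open>Both cut-off factors are 1 near \<open>p\<close>, so the expansion is
      undisturbed there and \<open>tv_local\<close> applies.\<close>
    have "v f = v (\<lambda>x. f p + (\<Sum>i\<in>Basis. \<xi> i x * \<eta> i x))"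
    proof (rule tv_local[OF v f])
      show "open (U \<inter> \<phi> -` ball (\<phi> p) (r / 2 / 2))"
        by (rule chart_vimage_open[OF U]) simp
      fix x assume x: "x \<in> U \<inter> \<phi> -` ball (\<phi> p) (r / 2 / 2)"
      then have "\<phi> x \<in> S" using r(1) by (auto simp: S_def)
      then show "f x = f p + (\<Sum>i\<in>Basis. \<xi> i x * \<eta> i x)"
        using h(3)[of "\<phi> x"] x p by (simp add: k_def chart_inv(1)[OF U] \<xi>_def \<eta>_def u(2))
    qed (use sm p r(1) in auto)
    also have "\<dots> = (\<Sum>i\<in>Basis. v (\<lambda>x. \<xi> i x * \<eta> i x))"
      using tv_add[OF v smooth_fun_const sm] tv_const[OF v] tv_sum[OF v finite_Basis prod] by simp
    also have "\<dots> = (\<Sum>i\<in>Basis. v (\<xi> i) * chart_deriv U \<phi> p i f)"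
    proof (rule sum.cong[OF refl])
      fix i :: 'e assume i: "i \<in> Basis"
      have "\<eta> i p = chart_deriv U \<phi> p i f"
        using f p S(3) h(2)[OF i] up by (simp add: \<eta>_def chart_deriv_def k_def)
      then show "v (\<lambda>x. \<xi> i x * \<eta> i x) = v (\<xi> i) * chart_deriv U \<phi> p i f"
        using tv_mult[OF v \<xi> \<eta>[OF i], of i] \<xi>p by simp
    qed
    also have "\<dots> = chart_deriv U \<phi> p e f"
    proof -
      interpret linear "\<lambda>e. chart_deriv U \<phi> p e f" by (rule chart_deriv_linear[OF U p f])
      show ?thesis by (simp add: e_def sum scale)
    qed
    finally show ?thesis .
  qed
  then show ?thesis
    using tangent_space_eqI[OF v chart_deriv_tangent[OF U p]] by blast
qed

lemma chart_deriv_inj: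
  assumes U: "(U, \<phi>) \<in> A" "p \<in> U" and eq: "chart_deriv U \<phi> p e = chart_deriv U \<phi> p e'"
  shows "e = e'"
proof -
  obtain \<xi> N where \<xi>: "open N" "p \<in> N" "N \<subseteq> U" "\<And>i. \<xi> i \<in> smooth_fun A" "\<And>x i. x \<in> N \<Longrightarrow> \<xi> i x = \<phi> x \<bullet> i"
    using chart_coordinates[OF U] by blast
  have "e \<bullet> i = e' \<bullet> i" for i
    using chart_deriv_coordinate[OF U(1) \<xi>(1-4), of i i] \<xi>(5) eq by metis
  then show ?thesis by (metis euclidean_eqI)
qed

section \<open>Vector fields and Lie brackets\<close>

lemma vf_tangent [intro]: "X \<in> vector_fields A \<Longrightarrow> X p \<in> tangent_space A p"
  unfolding vector_fields_def by blast

lemma vf_smooth: "X \<in> vector_fields A \<Longrightarrow> f \<in> smooth_fun A \<Longrightarrow> (\<lambda>p. X p f) \<in> smooth_fun A"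
  unfolding vector_fields_def by blast

lemma vf_zero [simp]: "(\<lambda>p f. 0) \<in> vector_fields A"
  unfolding vector_fields_def by auto

lemma vf_scale: "h \<in> smooth_fun A \<Longrightarrow> X \<in> vector_fields A \<Longrightarrow> (\<lambda>p f. h p * X p f) \<in> vector_fields A"
  unfolding vector_fields_def by (auto intro: tangent_space_scale)

lemma vf_add: "X \<in> vector_fields A \<Longrightarrow> Y \<in> vector_fields A \<Longrightarrow> (\<lambda>p f. X p f + Y p f) \<in> vector_fields A"
  unfolding vector_fields_def by (auto intro: tangent_space_add)

lemma vf_diff: "X \<in> vector_fields A \<Longrightarrow> Y \<in> vector_fields A \<Longrightarrow> (\<lambda>p f. X p f - Y p f) \<in> vector_fields A"
  unfolding vector_fields_def by (auto intro: tangent_space_diff)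

lemma vf_sum:
  "finite I \<Longrightarrow> (\<And>i. i \<in> I \<Longrightarrow> h i \<in> smooth_fun A) \<Longrightarrow> (\<And>i. i \<in> I \<Longrightarrow> X i \<in> vector_fields A) \<Longrightarrow>
    (\<lambda>p f. \<Sum>i\<in>I. h i p * X i p f) \<in> vector_fields A"
  by (induction I rule: finite_induct) (auto intro!: vf_add vf_scale)

lemma vf_eqI:
  assumes "X \<in> vector_fields A" "Y \<in> vector_fields A" "\<And>p f. f \<in> smooth_fun A \<Longrightarrow> X p f = Y p f"
  shows "X = Y"
  using assms tangent_space_eqI vf_tangent by (metis ext)

text \<open>In the Leibniz rule for the commutator the mixed products of first derivatives, X(f)
  Y(h) and X(h) Y(f), cancel.\<close>

lemma lie_bracket_vf:
  assumes X: "X \<in> vector_fields A" and Y: "Y \<in> vector_fields A"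
  shows "lie_bracket X Y \<in> vector_fields A"
proof -
  have "lie_bracket X Y p \<in> tangent_space A p" for p
  proof -
    note [simp] = tv_lincomb[OF vf_tangent[OF X]] tv_lincomb[OF vf_tangent[OF Y]]
      tv_mult[OF vf_tangent[OF X]] tv_mult[OF vf_tangent[OF Y]]
      tv_add[OF vf_tangent[OF X]] tv_add[OF vf_tangent[OF Y]]
      vf_smooth[OF X] vf_smooth[OF Y] smooth_fun_mult
    have "lie_bracket X Y p (\<lambda>x. a * f x + c * h x) = a * lie_bracket X Y p f + c * lie_bracket X Y p h"
      if "f \<in> smooth_fun A" "h \<in> smooth_fun A" for f h a c
      using that by (simp add: lie_bracket_def algebra_simps)
    moreover have "lie_bracket X Y p (\<lambda>x. f x * h x) = f p * lie_bracket X Y p h + h p * lie_bracket X Y p f"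
      if "f \<in> smooth_fun A" "h \<in> smooth_fun A" for f h
      using that by (simp add: lie_bracket_def algebra_simps)
    \<comment> \<open>On a non-smooth \<open>f\<close> both inner functions are constantly 0, and
      derivations kill constants.\<close>
    moreover have "lie_bracket X Y p f = 0" if "f \<notin> smooth_fun A" for f
    proof -
      have "(\<lambda>x. X x f) = (\<lambda>x. 0)" "(\<lambda>x. Y x f) = (\<lambda>x. 0)"
        using that tv_nonsmooth vf_tangent X Y by blast+
      then show ?thesis by (simp add: lie_bracket_def tv_const[OF vf_tangent[OF X]] tv_const[OF vf_tangent[OF Y]])
    qed
    ultimately show ?thesis unfolding tangent_space_def by blast
  qed
  moreover have "(\<lambda>p. lie_bracket X Y p f) \<in> smooth_fun A" if "f \<in> smooth_fun A" for f
    unfolding lie_bracket_def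
    using smooth_fun_diff[OF vf_smooth[OF X vf_smooth[OF Y that]] vf_smooth[OF Y vf_smooth[OF X that]]] .
  ultimately show ?thesis unfolding vector_fields_def by blast
qed

text \<open>Evaluating a tangent vector on the coordinates reads off its components. One family of
  coordinate functions serves all points of \<open>N\<close>, so for a vector field these components
  are smooth functions of the point.\<close>

lemma tangent_coordinates:
  assumes U: "(U, \<phi>) \<in> A" "p \<in> U"
  obtains \<xi> N where "open N" "p \<in> N" "N \<subseteq> U" "\<And>i. \<xi> i \<in> smooth_fun A"
    and "\<And>q e i. q \<in> N \<Longrightarrow> chart_deriv U \<phi> q e (\<xi> i) = e \<bullet> i"
    and "\<And>q v f. q \<in> N \<Longrightarrow> v \<in> tangent_space A q \<Longrightarrow>
      v f = (\<Sum>i\<in>(Basis::'e set). v (\<xi> i) * chart_deriv U \<phi> q i f)"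
proof -
  obtain \<xi> N where \<xi>: "open N" "p \<in> N" "N \<subseteq> U" "\<And>i. \<xi> i \<in> smooth_fun A" "\<And>x i. x \<in> N \<Longrightarrow> \<xi> i x = \<phi> x \<bullet> i"
    using chart_coordinates[OF U] by blast
  have coord: "chart_deriv U \<phi> q e (\<xi> i) = e \<bullet> i" if "q \<in> N" for q e i
    using chart_deriv_coordinate[OF U(1) \<xi>(1) _ \<xi>(3,4)] \<xi>(5) that by auto
  have "v f = (\<Sum>i\<in>(Basis::'e set). v (\<xi> i) * chart_deriv U \<phi> q i f)"
    if q: "q \<in> N" and v: "v \<in> tangent_space A q" for q v f
  proof (cases "f \<in> smooth_fun A")
    case True
    have qU: "q \<in> U" using q \<xi>(3) by auto
    obtain e where e: "v = chart_deriv U \<phi> q e" using tangent_chart[OF U(1) qU v] by blast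
    interpret linear "\<lambda>e. chart_deriv U \<phi> q e f" by (rule chart_deriv_linear[OF U(1) qU True])
    have "chart_deriv U \<phi> q e f = (\<Sum>i\<in>Basis. (e \<bullet> i) * chart_deriv U \<phi> q i f)"
      by (subst euclidean_representation[symmetric, of e]) (simp only: sum scale real_scaleR_def)
    then show ?thesis by (simp add: e coord[OF q])
  qed (use v in \<open>simp add: tv_nonsmooth chart_deriv_def\<close>)
  then show thesis using \<xi>(1-4) coord by (intro that[of N \<xi>]) auto
qed

text \<open>Members of \<open>vector_fields\<close> are global, so the coordinate fields are
  multiplied by a bump function; on a smaller neighbourhood they remain the coordinate
  derivations.\<close>

lemma local_frame:
  obtains N \<xi> E where "open N" "p \<in> N"
    and "\<And>i. i \<in> Basis \<Longrightarrow> \<xi> i \<in> smooth_fun A" "\<And>i. i \<in> Basis \<Longrightarrow> E i \<in> vector_fields A"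
    and "\<And>q i j. q \<in> N \<Longrightarrow> i \<in> Basis \<Longrightarrow> j \<in> Basis \<Longrightarrow> E i q (\<xi> j) = (if i = j then 1 else 0)"
    and "\<And>q v f. q \<in> N \<Longrightarrow> v \<in> tangent_space A q \<Longrightarrow> v f = (\<Sum>i\<in>(Basis::'e set). v (\<xi> i) * E i q f)"
proof -
  obtain U \<phi> where U: "(U, \<phi>) \<in> A" "p \<in> U" using chart_cover by blast
  obtain \<xi> N where \<xi>: "open N" "p \<in> N" "N \<subseteq> U" "\<And>i. \<xi> i \<in> smooth_fun A"
    and coord: "\<And>q e i. q \<in> N \<Longrightarrow> chart_deriv U \<phi> q e (\<xi> i) = e \<bullet> i"
    and rep: "\<And>q v f. q \<in> N \<Longrightarrow> v \<in> tangent_space A q \<Longrightarrow>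
      v f = (\<Sum>i\<in>(Basis::'e set). v (\<xi> i) * chart_deriv U \<phi> q i f)"
    using U by (rule tangent_coordinates) (rule that)
  obtain r where r: "r > 0" "cball (\<phi> p) r \<subseteq> \<phi> ` U"
    using chart_image_open[OF U(1)] open_contains_cball U(2) by blast
  obtain u where u: "smooth_on UNIV u" "\<And>x. x \<in> ball (\<phi> p) (r / 2) \<Longrightarrow> u x = 1"
    "\<And>x. x \<notin> ball (\<phi> p) r \<Longrightarrow> u x = (0::real)"
    using smooth_bump_euclidean[OF r(1), of "\<phi> p"] by blast
  \<comment> \<open>The condition has the shape of the one in \<open>smooth_fun_extend\<close>,
    which supplies smoothness.\<close>
  define E where "E i q f = (if q \<in> U \<and> \<phi> q \<in> \<phi> ` U then u (\<phi> q) * chart_deriv U \<phi> q i f else 0)" for i q f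
  have "E i \<in> vector_fields A" for i
  proof -
    have "E i q \<in> tangent_space A q" for q
      using tangent_space_scale[OF chart_deriv_tangent[OF U(1)]]
      by (cases "q \<in> U") (auto simp: E_def[abs_def])
    moreover have "(\<lambda>q. E i q f) \<in> smooth_fun A" if f: "f \<in> smooth_fun A" for f
    proof -
      have "(\<lambda>q. if q \<in> U \<and> \<phi> q \<in> \<phi> ` U then u (\<phi> q) * frechet_derivative (f \<circ> inv_into U \<phi>) (at (\<phi> q)) i else 0) \<in> smooth_fun A"
      proof (rule smooth_fun_extend[OF U(1) chart_image_open[OF U(1)] subset_refl compact_cball r(2)])
        show "smooth_on (\<phi> ` U) (\<lambda>y. u y * frechet_derivative (f \<circ> inv_into U \<phi>) (at y) i)"
          by (intro smooth_on_mult chart_image_open[OF U(1)] smooth_on_subset[OF u(1)]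
            smooth_on_frechet_derivative smooth_fun_chart f U(1)) auto
      qed (auto simp: u(3))
      then show ?thesis using f by (simp add: E_def chart_deriv_def cong: if_cong)
    qed
    ultimately show ?thesis unfolding vector_fields_def by blast
  qed
  moreover define N' where "N' = N \<inter> (U \<inter> \<phi> -` ball (\<phi> p) (r / 2))"
  have "open N'" "p \<in> N'" unfolding N'_def
    using \<xi>(1,2) U r(1) by (auto intro: chart_vimage_open)
  moreover have E: "E i q = chart_deriv U \<phi> q i" if "q \<in> N'" for i q
    using that by (auto simp: E_def[abs_def] N'_def u(2))
  have "v f = (\<Sum>i\<in>(Basis::'e set). v (\<xi> i) * E i q f)" if "q \<in> N'" "v \<in> tangent_space A q" for q v f
    unfolding E[OF that(1)] by (rule rep) (use that in \<open>auto simp: N'_def\<close>)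
  moreover have "E i q (\<xi> j) = i \<bullet> j" if "q \<in> N'" for i j q
    unfolding E[OF that] by (rule coord) (use that in \<open>auto simp: N'_def\<close>)
  ultimately show thesis
    using \<xi>(4) by (intro that[of N' \<xi> E]) (auto simp: inner_Basis)
qed

end

section \<open>Tensoriality, dual frames and sharps\<close>

locale semi_riemannian =
  fixes A :: "('a::{t2_space, second_countable_topology}, 'e::euclidean_space) atlas"
    and g :: "'a metric"
  assumes ssr: "singular_semi_riemannian A g"
begin

sublocale smooth_manifold A
  using ssr by unfold_locales (simp add: singular_semi_riemannian_def)

lemma g_sym: "u \<in> tangent_space A p \<Longrightarrow> v \<in> tangent_space A p \<Longrightarrow> g p u v = g p v u"
  using ssr unfolding singular_semi_riemannian_def by blast

lemma g_lincomb_left: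
  "u \<in> tangent_space A p \<Longrightarrow> v \<in> tangent_space A p \<Longrightarrow> w \<in> tangent_space A p \<Longrightarrow>
    g p (\<lambda>f. a * u f + c * v f) w = a * g p u w + c * g p v w"
  using ssr unfolding singular_semi_riemannian_def by blast

lemma g_lincomb_right:
  "u \<in> tangent_space A p \<Longrightarrow> v \<in> tangent_space A p \<Longrightarrow> w \<in> tangent_space A p \<Longrightarrow>
    g p w (\<lambda>f. a * u f + c * v f) = a * g p w u + c * g p w v"
  using g_lincomb_left[of u p v w a c] g_sym tangent_space_lincomb[of u p v a c] by metis

lemma g_zero_left: "w \<in> tangent_space A p \<Longrightarrow> g p (\<lambda>f. 0) w = 0"
  using g_lincomb_left[of w p w w 0 0] by simp

lemma g_scale_left:
  "u \<in> tangent_space A p \<Longrightarrow> w \<in> tangent_space A p \<Longrightarrow> g p (\<lambda>f. a * u f) w = a * g p u w"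
  using g_lincomb_left[of u p u w a 0] by simp

lemma g_scale_right:
  "u \<in> tangent_space A p \<Longrightarrow> w \<in> tangent_space A p \<Longrightarrow> g p w (\<lambda>f. a * u f) = a * g p w u"
  using g_lincomb_right[of u p u w a 0] by simp

lemma g_add_left:
  "u \<in> tangent_space A p \<Longrightarrow> v \<in> tangent_space A p \<Longrightarrow> w \<in> tangent_space A p \<Longrightarrow>
    g p (\<lambda>f. u f + v f) w = g p u w + g p v w"
  using g_lincomb_left[of u p v w 1 1] by simp

lemma g_add_right:
  "u \<in> tangent_space A p \<Longrightarrow> v \<in> tangent_space A p \<Longrightarrow> w \<in> tangent_space A p \<Longrightarrow>
    g p w (\<lambda>f. u f + v f) = g p w u + g p w v"
  using g_lincomb_right[of u p v w 1 1] by simp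

lemma g_diff_left:
  "u \<in> tangent_space A p \<Longrightarrow> v \<in> tangent_space A p \<Longrightarrow> w \<in> tangent_space A p \<Longrightarrow>
    g p (\<lambda>f. u f - v f) w = g p u w - g p v w"
  using g_lincomb_left[of u p v w 1 "-1"] by simp

lemma g_diff_right:
  "u \<in> tangent_space A p \<Longrightarrow> v \<in> tangent_space A p \<Longrightarrow> w \<in> tangent_space A p \<Longrightarrow>
    g p w (\<lambda>f. u f - v f) = g p w u - g p w v"
  using g_lincomb_right[of u p v w 1 "-1"] by simp

lemma g_sum_left:
  assumes "finite I" "\<And>i. i \<in> I \<Longrightarrow> u i \<in> tangent_space A p" "w \<in> tangent_space A p"
  shows "g p (\<lambda>f. \<Sum>i\<in>I. c i * u i f) w = (\<Sum>i\<in>I. c i * g p (u i) w)"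
  using assms(1,2)
proof (induction I rule: finite_induct)
  case (insert i I)
  then show ?case
    using g_lincomb_left[of "u i" p "\<lambda>f. \<Sum>i\<in>I. c i * u i f" w "c i" 1] tangent_space_sum[of I u p c] assms(3)
    by simp
qed (simp add: g_zero_left[OF assms(3)])

lemma g_sum_right:
  assumes "finite I" "\<And>i. i \<in> I \<Longrightarrow> u i \<in> tangent_space A p" "w \<in> tangent_space A p"
  shows "g p w (\<lambda>f. \<Sum>i\<in>I. c i * u i f) = (\<Sum>i\<in>I. c i * g p w (u i))"
proof -
  have "g p w (\<lambda>f. \<Sum>i\<in>I. c i * u i f) = g p (\<lambda>f. \<Sum>i\<in>I. c i * u i f) w"
    by (rule g_sym[OF assms(3) tangent_space_sum[OF assms(1,2)]])
  also have "\<dots> = (\<Sum>i\<in>I. c i * g p (u i) w)" by (rule g_sum_left[OF assms])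
  also have "\<dots> = (\<Sum>i\<in>I. c i * g p w (u i))"
    using g_sym assms(2,3) by (intro sum.cong) auto
  finally show ?thesis .
qed

lemma field_inner_smooth:
  "X \<in> vector_fields A \<Longrightarrow> Y \<in> vector_fields A \<Longrightarrow> field_inner g X Y \<in> smooth_fun A"
  using ssr unfolding singular_semi_riemannian_def by blast

lemma field_inner_sym: "X \<in> vector_fields A \<Longrightarrow> Y \<in> vector_fields A \<Longrightarrow> field_inner g X Y = field_inner g Y X"
  by (auto simp: field_inner_def intro!: g_sym)

lemma field_inner_scale_right:
  "X \<in> vector_fields A \<Longrightarrow> Y \<in> vector_fields A \<Longrightarrow>
    field_inner g X (\<lambda>p f. h p * Y p f) = (\<lambda>p. h p * field_inner g X Y p)"
  by (auto simp: field_inner_def intro!: g_scale_right)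

lemma field_inner_add_right:
  "X \<in> vector_fields A \<Longrightarrow> Y \<in> vector_fields A \<Longrightarrow> Z \<in> vector_fields A \<Longrightarrow>
    field_inner g X (\<lambda>p f. Y p f + Z p f) = (\<lambda>p. field_inner g X Y p + field_inner g X Z p)"
  by (auto simp: field_inner_def intro!: g_add_right)

lemma field_inner_diff_right:
  "X \<in> vector_fields A \<Longrightarrow> Y \<in> vector_fields A \<Longrightarrow> Z \<in> vector_fields A \<Longrightarrow>
    field_inner g X (\<lambda>p f. Y p f - Z p f) = (\<lambda>p. field_inner g X Y p - field_inner g X Z p)"
  by (auto simp: field_inner_def intro!: g_diff_right)

end

section \<open>Bracket identities and tensorial 1-forms\<close>

context smooth_manifold
begin

lemma lie_bracket_swap: "lie_bracket X Y = (\<lambda>p f. - lie_bracket Y X p f)"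
  by (simp add: lie_bracket_def fun_eq_iff)

lemma lie_bracket_add_right:
  assumes X: "X \<in> vector_fields A" and Y: "Y \<in> vector_fields A" and Z: "Z \<in> vector_fields A"
  shows "lie_bracket X (\<lambda>p f. Y p f + Z p f) = (\<lambda>p f. lie_bracket X Y p f + lie_bracket X Z p f)"
proof (rule vf_eqI)
  fix p f assume f: "f \<in> smooth_fun A"
  show "lie_bracket X (\<lambda>p f. Y p f + Z p f) p f = lie_bracket X Y p f + lie_bracket X Z p f"
    using tv_add[OF vf_tangent[OF X] vf_smooth[OF Y f] vf_smooth[OF Z f]] by (simp add: lie_bracket_def)
qed (intro lie_bracket_vf vf_add assms)+

lemma lie_bracket_scale_right:
  assumes h: "h \<in> smooth_fun A" and X: "X \<in> vector_fields A" and Y: "Y \<in> vector_fields A"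
  shows "lie_bracket X (\<lambda>p f. h p * Y p f) = (\<lambda>p f. h p * lie_bracket X Y p f + X p h * Y p f)"
proof (rule vf_eqI)
  fix p f assume f: "f \<in> smooth_fun A"
  show "lie_bracket X (\<lambda>p f. h p * Y p f) p f = h p * lie_bracket X Y p f + X p h * Y p f"
    using tv_mult[OF vf_tangent[OF X] h vf_smooth[OF Y f]] by (simp add: lie_bracket_def algebra_simps)
next
  show "lie_bracket X (\<lambda>p f. h p * Y p f) \<in> vector_fields A"
    by (rule lie_bracket_vf[OF X vf_scale[OF h Y]])
  show "(\<lambda>p f. h p * lie_bracket X Y p f + X p h * Y p f) \<in> vector_fields A"
    by (rule vf_add[OF vf_scale[OF h lie_bracket_vf[OF X Y]] vf_scale[OF vf_smooth[OF X h] Y]])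
qed

text \<open>Linearity over the smooth functions, the property that makes \<open>form_at\<close> well
  defined.\<close>

definition tensorial :: "'a form1 \<Rightarrow> bool" where
  "tensorial \<omega> \<longleftrightarrow>
    (\<forall>Y\<in>vector_fields A. \<forall>Z\<in>vector_fields A. \<omega> (\<lambda>p f. Y p f + Z p f) = (\<lambda>p. \<omega> Y p + \<omega> Z p)) \<and>
    (\<forall>h\<in>smooth_fun A. \<forall>Z\<in>vector_fields A. \<omega> (\<lambda>p f. h p * Z p f) = (\<lambda>p. h p * \<omega> Z p))"

lemma tensorialD:
  assumes "tensorial \<omega>"
  shows "Y \<in> vector_fields A \<Longrightarrow> Z \<in> vector_fields A \<Longrightarrow> \<omega> (\<lambda>p f. Y p f + Z p f) = (\<lambda>p. \<omega> Y p + \<omega> Z p)"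
    and "h \<in> smooth_fun A \<Longrightarrow> Z \<in> vector_fields A \<Longrightarrow> \<omega> (\<lambda>p f. h p * Z p f) = (\<lambda>p. h p * \<omega> Z p)"
  using assms unfolding tensorial_def by blast+

lemma tensorial_sum:
  assumes \<omega>: "tensorial \<omega>" and "finite I"
    and "\<And>i. i \<in> I \<Longrightarrow> h i \<in> smooth_fun A" "\<And>i. i \<in> I \<Longrightarrow> Z i \<in> vector_fields A"
  shows "\<omega> (\<lambda>p f. \<Sum>i\<in>I. h i p * Z i p f) = (\<lambda>p. \<Sum>i\<in>I. h i p * \<omega> (Z i) p)"
  using assms(2-4)
proof (induction I rule: finite_induct)
  case empty
  then show ?case using tensorialD(2)[OF \<omega> smooth_fun_const[of 0] vf_zero] by simp
next
  case (insert i I)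
  then have "\<omega> (\<lambda>p f. h i p * Z i p f + (\<Sum>i\<in>I. h i p * Z i p f))
      = (\<lambda>p. \<omega> (\<lambda>p f. h i p * Z i p f) p + \<omega> (\<lambda>p f. \<Sum>i\<in>I. h i p * Z i p f) p)"
    by (intro tensorialD(1)[OF \<omega>] vf_scale vf_sum) auto
  then show ?case using insert tensorialD(2)[OF \<omega>, of "h i" "Z i"] by simp
qed

text \<open>A bump function turns the local frame expansion of \<open>Z\<close> into a global
  identity, to which linearity of \<omega> applies. The coefficients \<open>Z q (\<xi> i)\<close>
  vanish at \<open>q = p\<close>.\<close>

lemma tensorial_pointwise_zero:
  assumes \<omega>: "tensorial \<omega>" and Z: "Z \<in> vector_fields A" "Z p = (\<lambda>f. 0)"
  shows "\<omega> Z p = 0"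
proof -
  obtain N \<xi> E where N: "open N" "p \<in> N"
    and \<xi>: "\<And>i. i \<in> Basis \<Longrightarrow> \<xi> i \<in> smooth_fun A" and E: "\<And>i. i \<in> Basis \<Longrightarrow> E i \<in> vector_fields A"
    and "\<And>q i j. q \<in> N \<Longrightarrow> i \<in> Basis \<Longrightarrow> j \<in> Basis \<Longrightarrow> E i q (\<xi> j) = (if i = j then 1 else 0)"
    and rep: "\<And>q v f. q \<in> N \<Longrightarrow> v \<in> tangent_space A q \<Longrightarrow> v f = (\<Sum>i\<in>(Basis::'e set). v (\<xi> i) * E i q f)"
    by (rule local_frame) (rule that)
  obtain \<rho> N' where \<rho>: "\<rho> \<in> smooth_fun A" "open N'" "p \<in> N'" "N' \<subseteq> N"
    "\<And>x. x \<in> N' \<Longrightarrow> \<rho> x = 1" "\<And>x. x \<notin> N \<Longrightarrow> \<rho> x = 0"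
    using N by (rule bump) (rule that)
  have "\<rho> p * \<omega> Z p = \<omega> (\<lambda>q f. \<rho> q * Z q f) p"
    using tensorialD(2)[OF \<omega> \<rho>(1) Z(1)] by simp
  also have "(\<lambda>q f. \<rho> q * Z q f) = (\<lambda>q f. \<Sum>i\<in>Basis. Z q (\<xi> i) * (\<rho> q * E i q f))"
  proof (intro ext)
    fix q f
    show "\<rho> q * Z q f = (\<Sum>i\<in>Basis. Z q (\<xi> i) * (\<rho> q * E i q f))"
    proof (cases "q \<in> N")
      case True
      show ?thesis
        by (subst rep[OF True vf_tangent[OF Z(1)], of f]) (simp add: sum_distrib_left algebra_simps)
    qed (simp add: \<rho>(6))
  qed
  also have "\<omega> \<dots> p = (\<Sum>i\<in>Basis. Z p (\<xi> i) * \<omega> (\<lambda>q f. \<rho> q * E i q f) p)"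
    by (subst tensorial_sum[OF \<omega> finite_Basis, of "\<lambda>i q. Z q (\<xi> i)" "\<lambda>i q f. \<rho> q * E i q f"])
      (auto intro: vf_smooth[OF Z(1)] \<xi> vf_scale \<rho>(1) E)
  finally show ?thesis using Z(2) \<rho>(3,5) by simp
qed

lemma tensorial_pointwise:
  assumes \<omega>: "tensorial \<omega>" and Z: "Y \<in> vector_fields A" "Z \<in> vector_fields A" "Y p = Z p"
  shows "\<omega> Y p = \<omega> Z p"
proof -
  have m: "(\<lambda>p f. (-1) * Z p f) \<in> vector_fields A"
    using vf_scale[OF smooth_fun_const Z(2)] .
  have "\<omega> (\<lambda>p f. Y p f + (-1) * Z p f) p = 0"
    using Z by (intro tensorial_pointwise_zero[OF \<omega>] vf_add[OF Z(1) m]) auto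
  then show ?thesis
    using tensorialD(1)[OF \<omega> Z(1) m] tensorialD(2)[OF \<omega> smooth_fun_const[of "-1"] Z(2)] by simp
qed

lemma tangent_field:
  assumes "v \<in> tangent_space A p"
  shows "\<exists>Z\<in>vector_fields A. Z p = v"
proof -
  obtain N \<xi> E where N: "open N" "p \<in> N"
    and \<xi>: "\<And>i. i \<in> Basis \<Longrightarrow> \<xi> i \<in> smooth_fun A" and E: "\<And>i. i \<in> Basis \<Longrightarrow> E i \<in> vector_fields A"
    and "\<And>q i j. q \<in> N \<Longrightarrow> i \<in> Basis \<Longrightarrow> j \<in> Basis \<Longrightarrow> E i q (\<xi> j) = (if i = j then 1 else 0)"
    and rep: "\<And>q v f. q \<in> N \<Longrightarrow> v \<in> tangent_space A q \<Longrightarrow> v f = (\<Sum>i\<in>(Basis::'e set). v (\<xi> i) * E i q f)"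
    by (rule local_frame) (rule that)
  have "(\<lambda>q f. \<Sum>i\<in>Basis. v (\<xi> i) * E i q f) \<in> vector_fields A"
    by (rule vf_sum) (auto intro: E)
  then show ?thesis by (rule bexI[rotated]) (rule ext, rule rep[OF N(2) assms, symmetric])
qed

lemma form_at_field:
  assumes \<omega>: "tensorial \<omega>" and Z: "Z \<in> vector_fields A"
  shows "form_at A \<omega> p (Z p) = \<omega> Z p"
proof -
  have "(THE c. \<forall>Y\<in>vector_fields A. Y p = Z p \<longrightarrow> \<omega> Y p = c) = \<omega> Z p"
  proof (rule the_equality)
    show "\<forall>Y\<in>vector_fields A. Y p = Z p \<longrightarrow> \<omega> Y p = \<omega> Z p"
      using tensorial_pointwise[OF \<omega> _ Z] by blast
  qed (use Z in blast)
  then show ?thesis using vf_tangent[OF Z] by (simp add: form_at_def)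
qed

text \<open>The set where two continuous functions differ is open, so it would meet
  \<open>D\<close>. This supplies the uniqueness needed for the description in
  \<open>contraction\<close>.\<close>

lemma smooth_fun_eq_of_dense:
  assumes "f \<in> smooth_fun A" "h \<in> smooth_fun A"
    and dense: "\<And>N. open N \<Longrightarrow> N \<noteq> {} \<Longrightarrow> N \<inter> D \<noteq> {}" and "\<And>p. p \<in> D \<Longrightarrow> f p = h p"
  shows "f = h"
proof (rule ccontr)
  have "open ((\<lambda>x. f x - h x) -` (- {0}))"
    using smooth_fun_continuous[OF smooth_fun_diff[OF assms(1,2)]] by (intro open_vimage) auto
  moreover assume "f \<noteq> h"
  then obtain x where "f x \<noteq> h x" by blast
  then have "x \<in> (\<lambda>x. f x - h x) -` (- {0})" by simp
  then have "(\<lambda>x. f x - h x) -` (- {0}) \<noteq> {}" by blast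
  ultimately have "((\<lambda>x. f x - h x) -` (- {0})) \<inter> D \<noteq> {}" by (rule dense)
  then show False using assms(4) by auto
qed

lemma smooth_fun_local_inverse:
  assumes f: "f \<in> smooth_fun A" and "f p \<noteq> 0"
  shows "\<exists>r N. r \<in> smooth_fun A \<and> open N \<and> p \<in> N \<and> (\<forall>x\<in>N. r x * f x = 1)"
proof -
  define N where "N = {x. f x \<noteq> 0}"
  have "N = f -` (- {0})" by (auto simp: N_def)
  then have N: "open N" using smooth_fun_continuous[OF f] by (auto intro: open_vimage)
  have "p \<in> N" using assms(2) by (simp add: N_def)
  obtain \<rho> N' where \<rho>: "\<rho> \<in> smooth_fun A" "open N'" "p \<in> N'" "N' \<subseteq> N"
    and \<rho>1: "\<And>x. x \<in> N' \<Longrightarrow> \<rho> x = 1" and supp: "\<And>x. x \<notin> N \<Longrightarrow> \<rho> x = 0"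
    using N \<open>p \<in> N\<close> by (rule bump) (rule that)
  text \<open>Unlike \<open>f\<^sup>2\<close>, the function \<open>d\<close> vanishes nowhere, and \<open>d = f\<^sup>2\<close> near \<open>p\<close>.\<close>
  define d where "d x = (f x)\<^sup>2 + (1 - \<rho> x)\<^sup>2" for x
  have d: "d \<in> smooth_fun A" unfolding d_def[abs_def]
    by (intro smooth_fun_add smooth_fun_power smooth_fun_diff smooth_fun_const f \<rho>(1))
  have pos: "d x > 0" for x
  proof (cases "x \<in> N")
    case True
    then show ?thesis by (simp add: d_def N_def add_pos_nonneg)
  next
    case False
    then show ?thesis by (simp add: d_def supp add_nonneg_pos)
  qed
  have "(\<lambda>x. inverse (d x)) \<in> smooth_fun A"
    unfolding smooth_fun_def
  proof clarify
    fix U \<phi> assume U: "(U, \<phi>) \<in> A"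
    have "d (inv_into U \<phi> y) \<noteq> 0" for y using pos[of "inv_into U \<phi> y"] by simp
    then show "smooth_on (\<phi> ` U) ((\<lambda>x. inverse (d x)) \<circ> inv_into U \<phi>)"
      using smooth_on_inverse[OF chart_image_open[OF U] smooth_fun_chart[OF d U]] by (simp add: o_def)
  qed
  then have "(\<lambda>x. f x * inverse (d x)) \<in> smooth_fun A" using f by auto
  moreover have "f x * inverse (d x) * f x = 1" if "x \<in> N'" for x
    using pos[of x] that by (auto simp: d_def \<rho>1 power2_eq_square field_simps)
  ultimately show ?thesis using \<rho>(2,3) by blast
qed

end

section \<open>Koszul form, cometric and rank of a metric\<close>

context semi_riemannian
begin

text \<open>Replacing \<open>Z\<close> by h Z produces X(h) g(Y, Z) and Y(h) g(Z, X) from the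
  derivatives of the metric; the brackets [Y, h Z] and [h Z, X] produce the same terms with the
  opposite sign.\<close>

lemma tensorial_koszul:
  assumes X: "X \<in> vector_fields A" and Y: "Y \<in> vector_fields A"
  shows "tensorial (koszul g X Y)"
  unfolding tensorial_def
proof (intro conjI ballI)
  fix Z Z' assume Z: "Z \<in> vector_fields A" and Z': "Z' \<in> vector_fields A"
  note sm = field_inner_smooth
  have zz: "(\<lambda>p f. Z p f + Z' p f) \<in> vector_fields A" by (rule vf_add[OF Z Z'])
  have s: "field_inner g (\<lambda>p f. Z p f + Z' p f) X = (\<lambda>p. field_inner g Z X p + field_inner g Z' X p)"
    by (simp add: field_inner_sym[OF zz X] field_inner_sym[OF Z X] field_inner_sym[OF Z' X] field_inner_add_right[OF X Z Z'])
  have s2: "field_inner g (\<lambda>p f. Z p f + Z' p f) (lie_bracket X Y)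
      = (\<lambda>p. field_inner g Z (lie_bracket X Y) p + field_inner g Z' (lie_bracket X Y) p)"
    using lie_bracket_vf[OF X Y]
    by (simp add: field_inner_sym[OF zz] field_inner_sym[OF Z] field_inner_sym[OF Z'] field_inner_add_right Z Z')
  have s3: "lie_bracket (\<lambda>p f. Z p f + Z' p f) X = (\<lambda>p f. lie_bracket Z X p f + lie_bracket Z' X p f)"
    using lie_bracket_add_right[OF X Z Z']
    by (simp add: lie_bracket_swap[of _ X] fun_eq_iff) 
  show "koszul g X Y (\<lambda>p f. Z p f + Z' p f) = (\<lambda>p. koszul g X Y Z p + koszul g X Y Z' p)"
    unfolding koszul_def field_inner_add_right[OF Y Z Z'] s s2 s3 lie_bracket_add_right[OF Y Z Z']
      field_inner_add_right[OF X lie_bracket_vf[OF Y Z] lie_bracket_vf[OF Y Z']]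
      field_inner_add_right[OF Y lie_bracket_vf[OF Z X] lie_bracket_vf[OF Z' X]]
      tv_add[OF vf_tangent[OF X] sm[OF Y Z] sm[OF Y Z']] tv_add[OF vf_tangent[OF Y] sm[OF Z X] sm[OF Z' X]]
    by (simp add: fun_eq_iff algebra_simps)
next
  fix h Z assume h: "h \<in> smooth_fun A" and Z: "Z \<in> vector_fields A"
  note sm = field_inner_smooth
  have hz: "(\<lambda>p f. h p * Z p f) \<in> vector_fields A" by (rule vf_scale[OF h Z])
  have s: "field_inner g (\<lambda>p f. h p * Z p f) X = (\<lambda>p. h p * field_inner g Z X p)"
    by (simp add: field_inner_sym[OF hz X] field_inner_sym[OF Z X] field_inner_scale_right[OF X Z])
  have s2: "field_inner g (\<lambda>p f. h p * Z p f) (lie_bracket X Y)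
      = (\<lambda>p. h p * field_inner g Z (lie_bracket X Y) p)"
    using lie_bracket_vf[OF X Y]
    by (simp add: field_inner_sym[OF hz] field_inner_sym[OF Z] field_inner_scale_right Z)
  have s3: "lie_bracket (\<lambda>p f. h p * Z p f) X = (\<lambda>p f. h p * lie_bracket Z X p f - X p h * Z p f)"
    using lie_bracket_scale_right[OF h X Z]
    by (simp add: lie_bracket_swap[of _ X] fun_eq_iff)
  have v1: "(\<lambda>p f. h p * lie_bracket Y Z p f) \<in> vector_fields A" "(\<lambda>p f. Y p h * Z p f) \<in> vector_fields A"
    "(\<lambda>p f. h p * lie_bracket Z X p f) \<in> vector_fields A" "(\<lambda>p f. X p h * Z p f) \<in> vector_fields A"
    using vf_scale[OF h lie_bracket_vf[OF Y Z]] vf_scale[OF vf_smooth[OF Y h] Z]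
      vf_scale[OF h lie_bracket_vf[OF Z X]] vf_scale[OF vf_smooth[OF X h] Z] by auto
  show "koszul g X Y (\<lambda>p f. h p * Z p f) = (\<lambda>p. h p * koszul g X Y Z p)"
    unfolding koszul_def field_inner_scale_right[OF Y Z] s s2 s3 lie_bracket_scale_right[OF h Y Z]
      field_inner_add_right[OF X v1(1,2)] field_inner_diff_right[OF Y v1(3,4)]
      field_inner_scale_right[OF X lie_bracket_vf[OF Y Z]] field_inner_scale_right[OF X Z]
      field_inner_scale_right[OF Y lie_bracket_vf[OF Z X]] field_inner_scale_right[OF Y Z]
      tv_mult[OF vf_tangent[OF X] h sm[OF Y Z]] tv_mult[OF vf_tangent[OF Y] h sm[OF Z X]]
    by (simp add: fun_eq_iff field_inner_sym[OF Z X] algebra_simps)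
qed

lemma koszul_smooth:
  assumes "X \<in> vector_fields A" "Y \<in> vector_fields A" "Z \<in> vector_fields A"
  shows "koszul g X Y Z \<in> smooth_fun A"
  unfolding koszul_def
  by (intro smooth_fun_scale smooth_fun_add smooth_fun_diff vf_smooth[OF assms(1)] vf_smooth[OF assms(2)]
      vf_smooth[OF assms(3)] field_inner_smooth lie_bracket_vf assms)

text \<open>Metric compatibility of the Levi-Civita connection, in a form that makes sense for
  degenerate metrics.\<close>

lemma koszul_metric:
  assumes X: "X \<in> vector_fields A" and Y: "Y \<in> vector_fields A" and Z: "Z \<in> vector_fields A"
  shows "X p (field_inner g Y Z) = koszul g X Y Z p + koszul g X Z Y p"
proof -
  have "field_inner g V (lie_bracket U W) p = - field_inner g V (lie_bracket W U) p"
    if "U \<in> vector_fields A" "V \<in> vector_fields A" "W \<in> vector_fields A" for U V W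
    using g_scale_right[OF vf_tangent[OF lie_bracket_vf[OF that(3,1)]] vf_tangent[OF that(2)], of p "-1"]
    by (simp add: field_inner_def lie_bracket_swap[of U W])
  from this[OF Y X Z] this[OF Z Y X] this[OF X Z Y] show ?thesis
    by (simp add: koszul_def field_inner_sym[OF X Y] field_inner_sym[OF Z X] field_inner_sym[OF Y Z] field_simps)
qed

text \<open>Vanishing torsion, paired with a third field and hence again free of any
  connection.\<close>

lemma koszul_torsion:
  assumes X: "X \<in> vector_fields A" and Y: "Y \<in> vector_fields A" and Z: "Z \<in> vector_fields A"
  shows "koszul g X Y Z p - koszul g Y X Z p = field_inner g (lie_bracket X Y) Z p"
proof -
  have "field_inner g V (lie_bracket U W) p = - field_inner g V (lie_bracket W U) p"
    if "U \<in> vector_fields A" "V \<in> vector_fields A" "W \<in> vector_fields A" for U V W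
    using g_scale_right[OF vf_tangent[OF lie_bracket_vf[OF that(3,1)]] vf_tangent[OF that(2)], of p "-1"]
    by (simp add: field_inner_def lie_bracket_swap[of U W])
  from this[OF Y X Z] this[OF Z Y X] this[OF X Z Y] show ?thesis
    by (simp add: koszul_def field_inner_sym[OF lie_bracket_vf[OF X Y] Z] field_inner_sym[OF X Y]
        field_inner_sym[OF Z X] field_inner_sym[OF Y Z] field_simps)
qed

text \<open>Vectors with the same image under \<open>flat\<close> differ by an element of the
  radical, so the inner product does not depend on the representatives and the description in
  \<open>cometric\<close> has a unique solution.\<close>

lemma cometric_flat:
  assumes v: "v \<in> tangent_space A p" and w: "w \<in> tangent_space A p"
  shows "cometric A g p (flat A g p v) (flat A g p w) = g p v w"
  unfolding cometric_def
proof (rule the_equality)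
  fix c assume "\<exists>v'\<in>tangent_space A p. \<exists>w'\<in>tangent_space A p.
    flat A g p v = flat A g p v' \<and> flat A g p w = flat A g p w' \<and> c = g p v' w'"
  then obtain v' w' where *: "v' \<in> tangent_space A p" "w' \<in> tangent_space A p"
    "flat A g p v = flat A g p v'" "flat A g p w = flat A g p w'" "c = g p v' w'" by blast
  have "g p v u = g p v' u" "g p w u = g p w' u" if "u \<in> tangent_space A p" for u
    using that fun_cong[OF *(3), of u] fun_cong[OF *(4), of u] by (simp_all add: flat_def)
  then show "c = g p v w" using *(1,2,5) v w g_sym by metis
qed (use assms in blast)

text \<open>Smoothness of \<open>h\<close> and its agreement with the pointwise contraction give
  existence of the extension; density of the regular points gives uniqueness.\<close>

lemma contraction_eqI:
  assumes "h \<in> smooth_fun A"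
    and "\<And>p. cometric A g p (form_at A \<omega> p) (form_at A \<tau> p) = h p"
    and dense: "\<And>N. open N \<Longrightarrow> N \<noteq> {} \<Longrightarrow> N \<inter> regular_points A g \<noteq> {}"
  shows "contraction A g \<omega> \<tau> = h"
  unfolding contraction_def using assms
  by (intro the_equality) (auto intro: smooth_fun_eq_of_dense[OF _ _ dense])

text \<open>The rank is a dimension inside a space of functions. Parametrising the image of
  \<open>flat\<close> by an injective linear map from a Euclidean space reduces it to the dimension
  of that space.\<close>

lemma metric_rank_eqI:
  fixes L :: "'d::euclidean_space \<Rightarrow> 'a covec"
  assumes lin: "\<And>x y. L (x + y) = (\<lambda>w. L x w + L y w)" "\<And>c x. L (c *\<^sub>R x) = (\<lambda>w. c * L x w)"
    and inj: "\<And>x. L x = (\<lambda>w. 0) \<Longrightarrow> x = 0"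
    and ran: "flat A g p ` tangent_space A p = range L"
  shows "metric_rank A g p = DIM('d)"
proof -
  \<comment> \<open>Only the source is finite-dimensional here; the target is a function
    space.\<close>
  interpret pr: finite_dimensional_vector_space_pair_1 "(*\<^sub>R) :: real \<Rightarrow> 'd \<Rightarrow> 'd" Basis
    "\<lambda>(c::real) (f::'a tvec \<Rightarrow> real) x. c * f x"
    by unfold_locales
  have L: "Vector_Spaces.linear (*\<^sub>R) (\<lambda>(c::real) (f::'a tvec \<Rightarrow> real) x. c * f x) L"
    by unfold_locales (auto simp: lin fun_eq_iff)
  have "inj L"
  proof (rule injI)
    fix x y assume "L x = L y"
    then have "L (x + (-1) *\<^sub>R y) = (\<lambda>w. 0)" by (subst lin, subst lin) simp
    then show "x = y" using inj by force
  qed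
  then have "fun_space.dim (L ` UNIV) = vector_space.dim (*\<^sub>R) (UNIV :: 'd set)"
    by (intro pr.dim_image_eq[OF L]) (rule inj_on_subset, assumption, simp)
  also have "\<dots> = dim (UNIV :: 'd set)" by (simp only: dim_raw_def)
  finally have "fun_space.dim (L ` UNIV) = dim (UNIV :: 'd set)" .
  then show ?thesis unfolding metric_rank_def ran by simp
qed

lemma flat_lincomb:
  assumes "v \<in> tangent_space A p" "w \<in> tangent_space A p"
  shows "flat A g p (\<lambda>f. a * v f + c * w f) = (\<lambda>u. a * flat A g p v u + c * flat A g p w u)"
  using assms g_lincomb_left by (auto simp: flat_def)

lemma metric_rank_nondegenerate:
  assumes nd: "\<And>v. v \<in> tangent_space A p \<Longrightarrow> (\<And>w. w \<in> tangent_space A p \<Longrightarrow> g p v w = 0) \<Longrightarrow> v = (\<lambda>f. 0)"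
  shows "metric_rank A g p = DIM('e)"
proof -
  obtain U \<phi> where U: "(U, \<phi>) \<in> A" "p \<in> U" using chart_cover by blast
  define d where "d = chart_deriv U \<phi> p"
  have d: "d e \<in> tangent_space A p" for e using chart_deriv_tangent[OF U] by (simp add: d_def)
  have ran: "tangent_space A p = range d"
  proof
    show "tangent_space A p \<subseteq> range d" using tangent_chart[OF U] unfolding d_def by blast
  qed (use d in blast)
  have lin: "d (a *\<^sub>R x + c *\<^sub>R y) = (\<lambda>f. a * d x f + c * d y f)" for a c x y
    unfolding d_def by (rule chart_deriv_lincomb[OF U])
  show ?thesis
  proof (rule metric_rank_eqI[of "\<lambda>e. flat A g p (d e)"])
    show "flat A g p (d (x + y)) = (\<lambda>w. flat A g p (d x) w + flat A g p (d y) w)" for x y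
      using lin[of 1 x 1 y] flat_lincomb[OF d d, of 1 x 1 y] by simp
    show "flat A g p (d (c *\<^sub>R x)) = (\<lambda>w. c * flat A g p (d x) w)" for c x
      using lin[of c x 0 x] flat_lincomb[OF d d, of c x 0 x] by simp
    show "x = 0" if "flat A g p (d x) = (\<lambda>w. 0)" for x
    proof -
      have "d x = (\<lambda>f. 0)"
        by (rule nd[OF d]) (use fun_cong[OF that] in \<open>auto simp: flat_def split: if_splits; metis\<close>)
      moreover have "d 0 = (\<lambda>f. 0)" using lin[of 0 0 0 0] by simp
      ultimately show ?thesis using chart_deriv_inj[OF U, of x 0] by (simp add: d_def)
    qed
  qed (auto simp: ran)
qed

lemma g_scale_both:
  "u \<in> tangent_space A p \<Longrightarrow> v \<in> tangent_space A p \<Longrightarrow> g p (\<lambda>f. a * u f) (\<lambda>f. c * v f) = a * c * g p u v"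
  using g_scale_left[of u p "\<lambda>f. c * v f" a] g_scale_right[of v p u c] by (simp add: tangent_space_scale)

text \<open>Six is the number of summands in \<open>snd_component\<close>.\<close>

lemma g_lincomb6_left:
  assumes "v1 \<in> tangent_space A p" "v2 \<in> tangent_space A p" "v3 \<in> tangent_space A p"
    "v4 \<in> tangent_space A p" "v5 \<in> tangent_space A p" "v6 \<in> tangent_space A p" "w \<in> tangent_space A p"
  shows "g p (\<lambda>f. c1 * v1 f + c2 * v2 f + c3 * v3 f + c4 * v4 f + c5 * v5 f + c6 * v6 f) w
    = c1 * g p v1 w + c2 * g p v2 w + c3 * g p v3 w + c4 * g p v4 w + c5 * g p v5 w + c6 * g p v6 w"
  by (simp add: g_add_left g_scale_left tangent_space_add tangent_space_scale assms)

lemma g_lincomb6_right: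
  assumes "v1 \<in> tangent_space A p" "v2 \<in> tangent_space A p" "v3 \<in> tangent_space A p"
    "v4 \<in> tangent_space A p" "v5 \<in> tangent_space A p" "v6 \<in> tangent_space A p" "w \<in> tangent_space A p"
  shows "g p w (\<lambda>f. c1 * v1 f + c2 * v2 f + c3 * v3 f + c4 * v4 f + c5 * v5 f + c6 * v6 f)
    = c1 * g p w v1 + c2 * g p w v2 + c3 * g p w v3 + c4 * g p w v4 + c5 * g p w v5 + c6 * g p w v6"
  by (simp add: g_add_right g_scale_right tangent_space_add tangent_space_scale assms)

lemma tangent_space_lincomb6:
  assumes "v1 \<in> tangent_space A p" "v2 \<in> tangent_space A p" "v3 \<in> tangent_space A p"
    "v4 \<in> tangent_space A p" "v5 \<in> tangent_space A p" "v6 \<in> tangent_space A p"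
  shows "(\<lambda>f. c1 * v1 f + c2 * v2 f + c3 * v3 f + c4 * v4 f + c5 * v5 f + c6 * v6 f) \<in> tangent_space A p"
  by (intro tangent_space_add tangent_space_scale assms)

lemma tensorial_semi_symmetric_koszul:
  assumes P: "P \<in> vector_fields A" and X: "X \<in> vector_fields A" and Y: "Y \<in> vector_fields A"
  shows "tensorial (semi_symmetric_koszul g P X Y)"
  unfolding tensorial_def semi_symmetric_koszul_def
  using tensorialD[OF tensorial_koszul[OF X Y]]
  by (simp add: fun_eq_iff field_inner_add_right field_inner_scale_right P X algebra_simps)

lemma semi_symmetric_koszul_smooth:
  assumes P: "P \<in> vector_fields A" and X: "X \<in> vector_fields A" and Y: "Y \<in> vector_fields A"
    and Z: "Z \<in> vector_fields A"
  shows "semi_symmetric_koszul g P X Y Z \<in> smooth_fun A"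
  unfolding semi_symmetric_koszul_def
  by (intro smooth_fun_add smooth_fun_diff smooth_fun_mult koszul_smooth field_inner_smooth assms)

text \<open>\<open>a\<close> is a vector field along \<pi>, smooth in the sense that it sends smooth
  functions to smooth functions on the source. Near a point it is a combination of frame fields with
  the smooth coefficients \<open>a z (\<xi> i)\<close>.\<close>

lemma inner_along_field_smooth:
  assumes C: "smooth_manifold C" and \<pi>: "continuous_on UNIV \<pi>"
    and \<pi>_smooth: "\<And>h. h \<in> smooth_fun A \<Longrightarrow> (\<lambda>z. h (\<pi> z)) \<in> smooth_fun C"
    and a: "\<And>z. a z \<in> tangent_space A (\<pi> z)"
    and sm: "\<And>h. h \<in> smooth_fun A \<Longrightarrow> (\<lambda>z. a z h) \<in> smooth_fun C"
    and Z: "Z \<in> vector_fields A"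
  shows "(\<lambda>z. g (\<pi> z) (a z) (Z (\<pi> z))) \<in> smooth_fun C"
proof -
  interpret C: smooth_manifold C by fact
  show ?thesis
  proof (rule C.smooth_fun_local)
    fix z0
    obtain N \<xi> E where N: "open N" "\<pi> z0 \<in> N"
      and \<xi>: "\<And>i. i \<in> Basis \<Longrightarrow> \<xi> i \<in> smooth_fun A" and E: "\<And>i. i \<in> Basis \<Longrightarrow> E i \<in> vector_fields A"
      and "\<And>q i j. q \<in> N \<Longrightarrow> i \<in> Basis \<Longrightarrow> j \<in> Basis \<Longrightarrow> E i q (\<xi> j) = (if i = j then 1 else 0)"
      and rep: "\<And>q v f. q \<in> N \<Longrightarrow> v \<in> tangent_space A q \<Longrightarrow> v f = (\<Sum>i\<in>(Basis::'e set). v (\<xi> i) * E i q f)"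
      by (rule local_frame) (rule that)
    define h where "h z = (\<Sum>i\<in>(Basis::'e set). a z (\<xi> i) * field_inner g (E i) Z (\<pi> z))" for z
    have "h \<in> smooth_fun C" unfolding h_def[abs_def]
    proof (intro C.smooth_fun_sum C.smooth_fun_mult finite_Basis)
      fix i :: 'e assume i: "i \<in> Basis"
      show "(\<lambda>z. a z (\<xi> i)) \<in> smooth_fun C" by (rule sm[OF \<xi>[OF i]])
      show "(\<lambda>z. field_inner g (E i) Z (\<pi> z)) \<in> smooth_fun C"
        by (rule \<pi>_smooth[OF field_inner_smooth[OF E[OF i] Z]])
    qed
    moreover have "g (\<pi> z) (a z) (Z (\<pi> z)) = h z" if "\<pi> z \<in> N" for z
    proof -
      have "a z = (\<lambda>f. \<Sum>i\<in>Basis. a z (\<xi> i) * E i (\<pi> z) f)"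
        by (rule ext) (rule rep[OF that a])
      from arg_cong[OF this, of "\<lambda>v. g (\<pi> z) v (Z (\<pi> z))"]
      have "g (\<pi> z) (a z) (Z (\<pi> z)) = g (\<pi> z) (\<lambda>f. \<Sum>i\<in>Basis. a z (\<xi> i) * E i (\<pi> z) f) (Z (\<pi> z))" .
      also have "\<dots> = h z" unfolding h_def field_inner_def
        using E vf_tangent vf_tangent[OF Z] by (intro g_sum_left) auto
      finally show ?thesis .
    qed
    ultimately show "\<exists>N g'. open N \<and> z0 \<in> N \<and> g' \<in> smooth_fun C \<and> (\<forall>z\<in>N. g (\<pi> z) (a z) (Z (\<pi> z)) = g' z)"
      using N open_vimage[OF N(1) \<pi>] by (intro exI[of _ "\<pi> -` N"] exI[of _ h]) auto
  qed
qed

end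

section \<open>Non-degenerate metrics: dual frames, sharps and connections\<close>

locale nondegenerate_semi_riemannian = semi_riemannian +
  assumes nondeg: "nondegenerate A g"
begin

lemma nondegenerateD:
  "v \<in> tangent_space A p \<Longrightarrow> (\<And>w. w \<in> tangent_space A p \<Longrightarrow> g p v w = 0) \<Longrightarrow> v = (\<lambda>f. 0)"
  using nondeg unfolding nondegenerate_def by blast

lemma regular_points_UNIV: "regular_points A g = UNIV"
  using metric_rank_nondegenerate[OF nondegenerateD] by (auto simp: regular_points_def)

text \<open>The exchange argument of Steinitz, carried out with smooth coefficients: starting from the
  coordinate functionals, the functionals \<open>g(\<cdot>, E\<^sub>j)\<close> are inserted one at a time. Nondegeneracy at
  \<open>p\<close> guarantees a pivot.\<close>

lemma dual_frame:
  obtains N E F where "open N" "p \<in> N"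
    and "\<And>i. i \<in> Basis \<Longrightarrow> E i \<in> vector_fields A" "\<And>i. i \<in> Basis \<Longrightarrow> F i \<in> vector_fields A"
    and "\<And>q v f. q \<in> N \<Longrightarrow> v \<in> tangent_space A q \<Longrightarrow> v f = (\<Sum>i\<in>(Basis::'b set). g q v (E i q) * F i q f)"
proof -
  obtain N0 \<xi> E where N0: "open N0" "p \<in> N0"
    and \<xi>: "\<And>i. i \<in> Basis \<Longrightarrow> \<xi> i \<in> smooth_fun A" and E: "\<And>i. i \<in> Basis \<Longrightarrow> E i \<in> vector_fields A"
    and dual: "\<And>q i j. q \<in> N0 \<Longrightarrow> i \<in> Basis \<Longrightarrow> j \<in> Basis \<Longrightarrow> E i q (\<xi> j) = (if i = j then 1 else 0)"
    and rep: "\<And>q v f. q \<in> N0 \<Longrightarrow> v \<in> tangent_space A q \<Longrightarrow> v f = (\<Sum>i\<in>(Basis::'b set). v (\<xi> i) * E i q f)"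
    by (rule local_frame) (rule that)
  have Et: "i \<in> Basis \<Longrightarrow> E i q \<in> tangent_space A q" for i q using E vf_tangent by blast
  \<comment> \<open>The invariant: \<open>v\<close> is recovered from its products with the
    \<open>E i\<close> for \<open>i\<close> in \<open>J\<close> and from the coordinate functionals
    left in \<open>K\<close>. The cardinality condition forces \<open>K\<close> to be empty once
    \<open>J\<close> is the whole basis.\<close>
  have "\<exists>N K F H. open N \<and> p \<in> N \<and> K \<subseteq> Basis \<and> card K + card J = card (Basis :: 'b set) \<and>
    (\<forall>i\<in>J. F i \<in> vector_fields A) \<and> (\<forall>i\<in>K. H i \<in> vector_fields A) \<and>
    (\<forall>q\<in>N. \<forall>v\<in>tangent_space A q. \<forall>f.
      v f = (\<Sum>i\<in>J. g q v (E i q) * F i q f) + (\<Sum>i\<in>K. v (\<xi> i) * H i q f))"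
    if "finite J" "J \<subseteq> Basis" for J
    using that
  proof (induction J rule: finite_induct)
    case empty
    show ?case using N0 E rep by (intro exI[of _ N0] exI[of _ Basis] exI[of _ E]) auto
  next
    case (insert j J)
    then have j: "j \<in> Basis" and J: "finite J" "J \<subseteq> Basis" "j \<notin> J" by auto
    from insert.IH[OF J(2)] obtain N K F H where N: "open N" "p \<in> N"
      and K: "K \<subseteq> Basis" "card K + card J = card (Basis :: 'b set)"
      and F0: "\<forall>i\<in>J. F i \<in> vector_fields A" and H0: "\<forall>i\<in>K. H i \<in> vector_fields A"
      and IH0: "\<forall>q\<in>N. \<forall>v\<in>tangent_space A q. \<forall>f.
        v f = (\<Sum>i\<in>J. g q v (E i q) * F i q f) + (\<Sum>i\<in>K. v (\<xi> i) * H i q f)"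
      by (elim exE conjE)
    have F: "\<And>i. i \<in> J \<Longrightarrow> F i \<in> vector_fields A" and H: "\<And>i. i \<in> K \<Longrightarrow> H i \<in> vector_fields A"
      using F0 H0 by blast+
    have IH: "\<And>q v f. q \<in> N \<Longrightarrow> v \<in> tangent_space A q \<Longrightarrow>
        v f = (\<Sum>i\<in>J. g q v (E i q) * F i q f) + (\<Sum>i\<in>K. v (\<xi> i) * H i q f)"
      using IH0 by blast
    have finK: "finite K" using K(1) finite_Basis finite_subset by blast
    define \<mu> where "\<mu> q v = g q v (E j q)" for q v
    have \<mu>: "\<mu> q v = (\<Sum>i\<in>J. g q v (E i q) * \<mu> q (F i q)) + (\<Sum>i\<in>K. v (\<xi> i) * \<mu> q (H i q))"
      if "q \<in> N" "v \<in> tangent_space A q" for q v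
    proof -
      have t: "(\<lambda>f. \<Sum>i\<in>J. g q v (E i q) * F i q f) \<in> tangent_space A q"
        "(\<lambda>f. \<Sum>i\<in>K. v (\<xi> i) * H i q f) \<in> tangent_space A q"
        using J(1) finK F H vf_tangent by (intro tangent_space_sum; auto)+
      have "v = (\<lambda>f. (\<Sum>i\<in>J. g q v (E i q) * F i q f) + (\<Sum>i\<in>K. v (\<xi> i) * H i q f))"
        by (rule ext) (rule IH[OF that])
      from arg_cong[OF this, of "\<lambda>v. g q v (E j q)"]
      have "\<mu> q v = g q (\<lambda>f. (\<Sum>i\<in>J. g q v (E i q) * F i q f) + (\<Sum>i\<in>K. v (\<xi> i) * H i q f)) (E j q)"
        by (simp only: \<mu>_def)
      also have "\<dots> = (\<Sum>i\<in>J. g q v (E i q) * \<mu> q (F i q)) + (\<Sum>i\<in>K. v (\<xi> i) * \<mu> q (H i q))"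
        using J(1) finK F H vf_tangent
        by (simp add: g_add_left[OF t Et[OF j]] \<mu>_def g_sum_left[OF J(1) _ Et[OF j]] g_sum_left[OF finK _ Et[OF j]])
      finally show ?thesis .
    qed
    \<comment> \<open>Without a pivot, g(., E_j) would at \<open>p\<close> be a combination of the
      g(., E_i) inserted before. Nondegeneracy would make \<open>E j p\<close> the same combination
      of the \<open>E i p\<close>, which evaluation on \<open>\<xi> j\<close> refutes.\<close>
    have "\<exists>k\<in>K. \<mu> p (H k p) \<noteq> 0"
    proof (rule ccontr)
      assume "\<not> (\<exists>k\<in>K. \<mu> p (H k p) \<noteq> 0)"
      then have \<mu>0: "\<mu> p v = (\<Sum>i\<in>J. \<mu> p (F i p) * g p (E i p) v)" if "v \<in> tangent_space A p" for v
        using \<mu>[OF N(2) that] J(2) g_sym[OF that Et] by (auto intro!: sum.cong simp: mult.commute)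
      define w where "w = (\<lambda>f. \<Sum>i\<in>J. \<mu> p (F i p) * E i p f)"
      have w: "w \<in> tangent_space A p" unfolding w_def
        using J Et by (intro tangent_space_sum) auto
      have "(\<lambda>f. E j p f - w f) = (\<lambda>f. 0)"
      proof (rule nondegenerateD[OF tangent_space_diff[OF Et[OF j] w]])
        fix v assume v: "v \<in> tangent_space A p"
        have "g p w v = (\<Sum>i\<in>J. \<mu> p (F i p) * g p (E i p) v)"
          unfolding w_def using J Et by (intro g_sum_left v) auto
        then show "g p (\<lambda>f. E j p f - w f) v = 0"
          using \<mu>0[OF v] g_sym[OF v Et[OF j]] by (simp add: g_diff_left[OF Et[OF j] w v] \<mu>_def)
      qed
      from fun_cong[OF this, of "\<xi> j"] have "w (\<xi> j) = 1" using dual[OF N0(2) j j] by simp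
      moreover have "w (\<xi> j) = 0" unfolding w_def
      proof (intro sum.neutral ballI)
        fix i assume "i \<in> J"
        then have "i \<in> Basis" "i \<noteq> j" using J(2,3) by auto
        then show "\<mu> p (F i p) * E i p (\<xi> j) = 0" using dual[OF N0(2) _ j, of i] by simp
      qed
      ultimately show False by simp
    qed
    then obtain k where k: "k \<in> K" "\<mu> p (H k p) \<noteq> 0" by blast
    have sm: "(\<lambda>q. \<mu> q (X q)) \<in> smooth_fun A" if "X \<in> vector_fields A" for X
      using field_inner_smooth[OF that E[OF j]] by (simp add: field_inner_def \<mu>_def)
    obtain r N1 where r: "r \<in> smooth_fun A" "open N1" "p \<in> N1" "\<And>x. x \<in> N1 \<Longrightarrow> r x * \<mu> x (H k x) = 1"
      using smooth_fun_local_inverse[OF sm[OF H[OF k(1)]], of p] k(2) by blast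
    have corr: "(\<lambda>q f. X q f - (r q * \<mu> q (X q)) * H k q f) \<in> vector_fields A" if "X \<in> vector_fields A" for X
      using vf_diff[OF that vf_scale[OF smooth_fun_mult[OF r(1) sm[OF that]] H[OF k(1)]]] .
    \<comment> \<open>Dividing by the pivot expresses \<open>v (\<xi> k)\<close> through g(v, E_j)
      and the other functionals. Substituting this into the expansion changes the coefficient fields
      as follows.\<close>
    define F' where "F' i = (if i = j then (\<lambda>q f. r q * H k q f) else (\<lambda>q f. F i q f - (r q * \<mu> q (F i q)) * H k q f))" for i
    define H' where "H' i = (\<lambda>q f. H i q f - (r q * \<mu> q (H i q)) * H k q f)" for i
    have "v f = (\<Sum>i\<in>insert j J. g q v (E i q) * F' i q f) + (\<Sum>i\<in>K - {k}. v (\<xi> i) * H' i q f)"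
      if q: "q \<in> N \<inter> N1" and v: "v \<in> tangent_space A q" for q v f
    proof -
      define SF where "SF = (\<Sum>i\<in>J. g q v (E i q) * F i q f)"
      define S\<mu> where "S\<mu> = (\<Sum>i\<in>J. g q v (E i q) * \<mu> q (F i q))"
      define TH where "TH = (\<Sum>i\<in>K - {k}. v (\<xi> i) * H i q f)"
      define T\<mu> where "T\<mu> = (\<Sum>i\<in>K - {k}. v (\<xi> i) * \<mu> q (H i q))"
      have 1: "v f = SF + (v (\<xi> k) * H k q f + TH)"
        using IH[of q v f] q v sum.remove[OF finK k(1), of "\<lambda>i. v (\<xi> i) * H i q f"] by (simp add: SF_def TH_def)
      have 2: "\<mu> q v = S\<mu> + (v (\<xi> k) * \<mu> q (H k q) + T\<mu>)"
        using \<mu>[of q v] q v sum.remove[OF finK k(1), of "\<lambda>i. v (\<xi> i) * \<mu> q (H i q)"] by (simp add: S\<mu>_def T\<mu>_def)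
      have 3: "r q * \<mu> q (H k q) = 1" using r(4) q by auto
      have "v (\<xi> k) = v (\<xi> k) * (r q * \<mu> q (H k q))" by (simp add: 3)
      also have "\<dots> = r q * (\<mu> q v - S\<mu> - T\<mu>)" by (simp add: 2)
      finally have 4: "v (\<xi> k) = r q * (\<mu> q v - S\<mu> - T\<mu>)" .
      have "(\<Sum>i\<in>insert j J. g q v (E i q) * F' i q f) = \<mu> q v * (r q * H k q f) + (\<Sum>i\<in>J. g q v (E i q) * F' i q f)"
        using J by (simp add: F'_def \<mu>_def)
      also have "(\<Sum>i\<in>J. g q v (E i q) * F' i q f)
          = (\<Sum>i\<in>J. g q v (E i q) * F i q f - (r q * H k q f) * (g q v (E i q) * \<mu> q (F i q)))"
        using J(3) by (intro sum.cong) (auto simp: F'_def algebra_simps)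
      also have "\<dots> = SF - (r q * H k q f) * S\<mu>"
        by (simp add: SF_def S\<mu>_def sum_subtractf sum_distrib_left)
      finally have 5: "(\<Sum>i\<in>insert j J. g q v (E i q) * F' i q f) = \<mu> q v * (r q * H k q f) + (SF - (r q * H k q f) * S\<mu>)" .
      have "(\<Sum>i\<in>K - {k}. v (\<xi> i) * H' i q f)
          = (\<Sum>i\<in>K - {k}. v (\<xi> i) * H i q f - (r q * H k q f) * (v (\<xi> i) * \<mu> q (H i q)))"
        by (intro sum.cong) (auto simp: H'_def algebra_simps)
      also have "\<dots> = TH - (r q * H k q f) * T\<mu>"
        by (simp add: TH_def T\<mu>_def sum_subtractf sum_distrib_left)
      finally show ?thesis unfolding 5 1 4 by (simp add: algebra_simps)
    qed
    moreover have "card (K - {k}) + card (insert j J) = card (Basis :: 'b set)"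
      using K(2) J finK k(1) card_gt_0_iff[of K] by (auto simp: card_Diff_singleton)
    moreover have "\<forall>i\<in>insert j J. F' i \<in> vector_fields A" "\<forall>i\<in>K - {k}. H' i \<in> vector_fields A"
      using corr F H vf_scale[OF r(1) H[OF k(1)]] by (auto simp: F'_def H'_def)
    moreover have "open (N \<inter> N1)" "p \<in> N \<inter> N1" "K - {k} \<subseteq> Basis" using N r K by auto
    ultimately show ?case
      by - (rule exI[of _ "N \<inter> N1"], rule exI[of _ "K - {k}"], rule exI[of _ F'], rule exI[of _ H'],
          intro conjI ballI allI, auto)
  qed
  from this[OF finite_Basis subset_refl] obtain N K F H where N: "open N" "p \<in> N"
      and K: "K \<subseteq> Basis" "card K + card (Basis :: 'b set) = card (Basis :: 'b set)"
      and F: "\<forall>i\<in>Basis. F i \<in> vector_fields A" and "\<forall>i\<in>K. H i \<in> vector_fields A"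
      and R: "\<forall>q\<in>N. \<forall>v\<in>tangent_space A q. \<forall>f.
        v f = (\<Sum>i\<in>Basis. g q v (E i q) * F i q f) + (\<Sum>i\<in>K. v (\<xi> i) * H i q f)"
    by (elim exE conjE)
  have "K = {}" using K finite_subset[OF K(1) finite_Basis] by simp
  then show thesis using N F R E by (intro that[of N E F]) simp_all
qed

definition sharp :: "'a \<Rightarrow> 'a covec \<Rightarrow> 'a tvec" where
  "sharp p \<alpha> = (SOME v. v \<in> tangent_space A p \<and> (\<forall>w\<in>tangent_space A p. g p v w = \<alpha> w))"

text \<open>In a dual frame w = sum g(w, E_i) F_i, so by linearity the combination of the E_i with
  coefficients \<alpha>(F_i) has inner product \<alpha>(w) with \<open>w\<close>.\<close>

lemma sharp:
  assumes "\<And>u v a c. u \<in> tangent_space A p \<Longrightarrow> v \<in> tangent_space A p \<Longrightarrow>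
    \<alpha> (\<lambda>f. a * u f + c * v f) = a * \<alpha> u + c * \<alpha> v"
  shows "sharp p \<alpha> \<in> tangent_space A p"
    and "w \<in> tangent_space A p \<Longrightarrow> g p (sharp p \<alpha>) w = \<alpha> w"
proof -
  obtain N E F where N: "open N" "p \<in> N"
    and E: "\<And>i. i \<in> Basis \<Longrightarrow> E i \<in> vector_fields A" and F: "\<And>i. i \<in> Basis \<Longrightarrow> F i \<in> vector_fields A"
    and rep: "\<And>q v f. q \<in> N \<Longrightarrow> v \<in> tangent_space A q \<Longrightarrow> v f = (\<Sum>i\<in>(Basis::'b set). g q v (E i q) * F i q f)"
    by (rule dual_frame) (rule that)
  have sum: "\<alpha> (\<lambda>f. \<Sum>i\<in>I. c i * F i p f) = (\<Sum>i\<in>I. c i * \<alpha> (F i p))" if "finite I" "I \<subseteq> Basis" for I c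
    using that
  proof (induction I rule: finite_induct)
    case empty
    show ?case using assms[of "\<lambda>f. 0" "\<lambda>f. 0" 0 0] by simp
  next
    case (insert i I)
    then have t: "F i p \<in> tangent_space A p" "(\<lambda>f. \<Sum>i\<in>I. c i * F i p f) \<in> tangent_space A p"
      using F vf_tangent by (auto intro!: tangent_space_sum)
    show ?case using insert assms[OF t, of "c i" 1] by simp
  qed
  define v where "v = (\<lambda>f. \<Sum>i\<in>Basis. \<alpha> (F i p) * E i p f)"
  have "v \<in> tangent_space A p" unfolding v_def using E vf_tangent by (intro tangent_space_sum) auto
  moreover have "g p v w = \<alpha> w" if w: "w \<in> tangent_space A p" for w
  proof -
    have "g p v w = (\<Sum>i\<in>Basis. \<alpha> (F i p) * g p (E i p) w)"
      unfolding v_def using E vf_tangent w by (intro g_sum_left) auto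
    also have "\<dots> = (\<Sum>i\<in>Basis. g p w (E i p) * \<alpha> (F i p))"
      using g_sym[OF w vf_tangent[OF E]] by (intro sum.cong) (auto simp: mult.commute)
    also have "\<dots> = \<alpha> (\<lambda>f. \<Sum>i\<in>Basis. g p w (E i p) * F i p f)" by (rule sum[symmetric]) auto
    also have "(\<lambda>f. \<Sum>i\<in>Basis. g p w (E i p) * F i p f) = w"
      by (rule ext) (rule rep[OF N(2) w, symmetric])
    finally show ?thesis .
  qed
  ultimately have "\<exists>v. v \<in> tangent_space A p \<and> (\<forall>w\<in>tangent_space A p. g p v w = \<alpha> w)" by blast
  from someI_ex[OF this] show "sharp p \<alpha> \<in> tangent_space A p"
    "w \<in> tangent_space A p \<Longrightarrow> g p (sharp p \<alpha>) w = \<alpha> w" unfolding sharp_def by blast+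
qed

text \<open>Smoothness of \<open>a\<close> and \<open>a'\<close> is known only through products with
  vector fields. A dual frame gives g(a, a') = sum g(a', E_i) g(a, F_i), which consists of such
  products.\<close>

lemma inner_along_smooth:
  assumes C: "smooth_manifold C" and \<pi>: "continuous_on UNIV \<pi>"
    and a: "\<And>z. a z \<in> tangent_space A (\<pi> z)" and a': "\<And>z. a' z \<in> tangent_space A (\<pi> z)"
    and sm: "\<And>Z. Z \<in> vector_fields A \<Longrightarrow> (\<lambda>z. g (\<pi> z) (a z) (Z (\<pi> z))) \<in> smooth_fun C"
    and sm': "\<And>Z. Z \<in> vector_fields A \<Longrightarrow> (\<lambda>z. g (\<pi> z) (a' z) (Z (\<pi> z))) \<in> smooth_fun C"
  shows "(\<lambda>z. g (\<pi> z) (a z) (a' z)) \<in> smooth_fun C"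
proof -
  interpret C: smooth_manifold C by fact
  show ?thesis
  proof (rule C.smooth_fun_local)
    fix z0
    obtain N E F where N: "open N" "\<pi> z0 \<in> N"
      and E: "\<And>i. i \<in> Basis \<Longrightarrow> E i \<in> vector_fields A" and F: "\<And>i. i \<in> Basis \<Longrightarrow> F i \<in> vector_fields A"
      and rep: "\<And>q v f. q \<in> N \<Longrightarrow> v \<in> tangent_space A q \<Longrightarrow> v f = (\<Sum>i\<in>(Basis::'b set). g q v (E i q) * F i q f)"
      by (rule dual_frame) (rule that)
    define h where "h z = (\<Sum>i\<in>(Basis::'b set). g (\<pi> z) (a' z) (E i (\<pi> z)) * g (\<pi> z) (a z) (F i (\<pi> z)))" for z
    have "h \<in> smooth_fun C" unfolding h_def[abs_def]
      by (intro C.smooth_fun_sum C.smooth_fun_mult sm sm' E F finite_Basis)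
    moreover have "g (\<pi> z) (a z) (a' z) = h z" if "\<pi> z \<in> N" for z
    proof -
      have "a' z = (\<lambda>f. \<Sum>i\<in>Basis. g (\<pi> z) (a' z) (E i (\<pi> z)) * F i (\<pi> z) f)"
        by (rule ext) (rule rep[OF that a'])
      from arg_cong[OF this, of "g (\<pi> z) (a z)"]
      have "g (\<pi> z) (a z) (a' z) = g (\<pi> z) (a z) (\<lambda>f. \<Sum>i\<in>Basis. g (\<pi> z) (a' z) (E i (\<pi> z)) * F i (\<pi> z) f)" .
      also have "\<dots> = h z" unfolding h_def
        using F vf_tangent a by (intro g_sum_right) auto
      finally show ?thesis .
    qed
    ultimately show "\<exists>N g'. open N \<and> z0 \<in> N \<and> g' \<in> smooth_fun C \<and> (\<forall>z\<in>N. g (\<pi> z) (a z) (a' z) = g' z)"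
      using N open_vimage[OF N(1) \<pi>] by (intro exI[of _ "\<pi> -` N"] exI[of _ h]) auto
  qed
qed

text \<open>For a non-degenerate metric this is the Levi-Civita connection.\<close>

definition connection :: "'a vfield \<Rightarrow> 'a vfield \<Rightarrow> 'a vfield" where
  "connection X Y p = sharp p (form_at A (koszul g X Y) p)"

lemma form_at_lincomb:
  assumes \<omega>: "tensorial \<omega>" and u: "u \<in> tangent_space A p" and v: "v \<in> tangent_space A p"
  shows "form_at A \<omega> p (\<lambda>f. a * u f + c * v f) = a * form_at A \<omega> p u + c * form_at A \<omega> p v"
proof -
  obtain Y Z where Y: "Y \<in> vector_fields A" "Y p = u" and Z: "Z \<in> vector_fields A" "Z p = v"
    using tangent_field u v by metis
  have aY: "(\<lambda>p f. a * Y p f) \<in> vector_fields A" and cZ: "(\<lambda>p f. c * Z p f) \<in> vector_fields A"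
    using vf_scale[OF smooth_fun_const] Y Z by auto
  have "form_at A \<omega> p (\<lambda>f. a * Y p f + c * Z p f) = \<omega> (\<lambda>p f. a * Y p f + c * Z p f) p"
    using form_at_field[OF \<omega> vf_add[OF aY cZ]] .
  also have "\<dots> = a * \<omega> Y p + c * \<omega> Z p"
    using tensorialD(1)[OF \<omega> aY cZ] tensorialD(2)[OF \<omega> smooth_fun_const Y(1), of a]
      tensorialD(2)[OF \<omega> smooth_fun_const Z(1), of c] by simp
  finally show ?thesis using form_at_field[OF \<omega> Y(1), of p] form_at_field[OF \<omega> Z(1), of p] Y Z by simp
qed

lemma connection_tangent: "X \<in> vector_fields A \<Longrightarrow> Y \<in> vector_fields A \<Longrightarrow> connection X Y p \<in> tangent_space A p"
  unfolding connection_def by (intro sharp(1) form_at_lincomb tensorial_koszul)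

lemma connection_inner:
  assumes X: "X \<in> vector_fields A" and Y: "Y \<in> vector_fields A" and Z: "Z \<in> vector_fields A"
  shows "g p (connection X Y p) (Z p) = koszul g X Y Z p"
  unfolding connection_def
  by (subst sharp(2)) (auto intro!: form_at_lincomb tensorial_koszul[OF X Y] vf_tangent[OF Z]
      form_at_field[OF tensorial_koszul[OF X Y] Z])

lemma connection_inner_right:
  assumes X: "X \<in> vector_fields A" and Y: "Y \<in> vector_fields A" and Z: "Z \<in> vector_fields A"
  shows "g p (Z p) (connection X Y p) = koszul g X Y Z p"
  using connection_inner[OF assms] g_sym[OF vf_tangent[OF Z] connection_tangent[OF X Y]] by metis

lemma connection_form:
  assumes X: "X \<in> vector_fields A" and Y: "Y \<in> vector_fields A"
  shows "form_at A (koszul g X Y) p = flat A g p (connection X Y p)"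
proof
  fix w
  show "form_at A (koszul g X Y) p w = flat A g p (connection X Y p) w"
  proof (cases "w \<in> tangent_space A p")
    case True
    then show ?thesis unfolding connection_def flat_def
      by (subst sharp(2)) (auto intro!: form_at_lincomb tensorial_koszul[OF X Y])
  qed (simp add: form_at_def flat_def)
qed

text \<open>With respect to a dual frame the coefficients of the connection are the smooth functions
  \<open>koszul g X Y (E i)\<close>.\<close>

lemma connection_vf:
  assumes X: "X \<in> vector_fields A" and Y: "Y \<in> vector_fields A"
  shows "connection X Y \<in> vector_fields A"
proof -
  note ct = connection_tangent[OF X Y]
  have "(\<lambda>p. connection X Y p f) \<in> smooth_fun A" if f: "f \<in> smooth_fun A" for f
  proof (rule smooth_fun_local)
    fix p
    obtain N E F where N: "open N" "p \<in> N"
      and E: "\<And>i. i \<in> Basis \<Longrightarrow> E i \<in> vector_fields A" and F: "\<And>i. i \<in> Basis \<Longrightarrow> F i \<in> vector_fields A"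
      and rep: "\<And>q v f. q \<in> N \<Longrightarrow> v \<in> tangent_space A q \<Longrightarrow> v f = (\<Sum>i\<in>(Basis::'b set). g q v (E i q) * F i q f)"
      by (rule dual_frame) (rule that)
    define h where "h q = (\<Sum>i\<in>(Basis::'b set). koszul g X Y (E i) q * F i q f)" for q
    have "h \<in> smooth_fun A" unfolding h_def[abs_def]
    proof (intro smooth_fun_sum smooth_fun_mult finite_Basis)
      fix i :: 'b assume "i \<in> Basis"
      then show "koszul g X Y (E i) \<in> smooth_fun A" "(\<lambda>q. F i q f) \<in> smooth_fun A"
        using koszul_smooth[OF X Y E] vf_smooth[OF F f] by auto
    qed
    moreover have "connection X Y q f = h q" if "q \<in> N" for q
      unfolding h_def using rep[OF that ct, of f] connection_inner[OF X Y E] by simp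
    ultimately show "\<exists>N h. open N \<and> p \<in> N \<and> h \<in> smooth_fun A \<and> (\<forall>x\<in>N. connection X Y x f = h x)"
      using N by blast
  qed
  then show ?thesis unfolding vector_fields_def using ct by blast
qed

text \<open>All points are regular, and the contraction of two Koszul forms is the inner product of
  the corresponding connection fields. In this shape the curvature of a factor can be recognised
  inside that of the twisted product.\<close>

lemma riemann_curvature_eq:
  assumes X: "X \<in> vector_fields A" and Y: "Y \<in> vector_fields A"
    and Z: "Z \<in> vector_fields A" and T: "T \<in> vector_fields A"
  shows "riemann_curvature A g X Y Z T p = X p (koszul g Y Z T) - Y p (koszul g X Z T)
    - koszul g (lie_bracket X Y) Z T p + g p (connection X Z p) (connection Y T p)
    - g p (connection Y Z p) (connection X T p)"
proof -
  have "contraction A g (koszul g X Y) (koszul g Z T) = field_inner g (connection X Y) (connection Z T)"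
    if "X \<in> vector_fields A" "Y \<in> vector_fields A" "Z \<in> vector_fields A" "T \<in> vector_fields A" for X Y Z T
  proof (rule contraction_eqI)
    show "field_inner g (connection X Y) (connection Z T) \<in> smooth_fun A"
      by (intro field_inner_smooth connection_vf that)
    show "cometric A g p (form_at A (koszul g X Y) p) (form_at A (koszul g Z T) p)
      = field_inner g (connection X Y) (connection Z T) p" for p
      using that by (simp add: connection_form cometric_flat connection_tangent field_inner_def)
  qed (simp add: regular_points_UNIV)
  from this[OF X Z Y T] this[OF Y Z X T] show ?thesis
    by (simp add: riemann_curvature_def curvature_of_def field_inner_def)
qed

end

section \<open>Product manifolds\<close>

lemma pushforward_tangent:
  assumes "smooth_manifold A'" and v: "v \<in> tangent_space A p"
    and \<phi>: "\<And>f. f \<in> smooth_fun A' \<Longrightarrow> f \<circ> \<phi> \<in> smooth_fun A"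
  shows "pushforward A' \<phi> v \<in> tangent_space A' (\<phi> p)"
proof -
  interpret smooth_manifold A' by fact
  have "v (\<lambda>x. a * f (\<phi> x) + c * h (\<phi> x)) = a * v (f \<circ> \<phi>) + c * v (h \<circ> \<phi>)"
    "v (\<lambda>x. f (\<phi> x) * h (\<phi> x)) = f (\<phi> p) * v (h \<circ> \<phi>) + h (\<phi> p) * v (f \<circ> \<phi>)"
    if "f \<in> smooth_fun A'" "h \<in> smooth_fun A'" for f h a c
    using v \<phi>[OF that(1)] \<phi>[OF that(2)] unfolding tangent_space_def by (auto simp: o_def)
  then show ?thesis
    unfolding tangent_space_def pushforward_def
    using smooth_fun_add[OF smooth_fun_scale smooth_fun_scale] smooth_fun_mult by (auto simp: o_def)
qed

lemma pushforward_lincomb: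
  "pushforward A' \<phi> (\<lambda>f. a * u f + c * v f) = (\<lambda>f. a * pushforward A' \<phi> u f + c * pushforward A' \<phi> v f)"
  by (auto simp: pushforward_def)

lemma pushforward_add:
  "pushforward A' \<phi> (\<lambda>f. u f + v f) = (\<lambda>f. pushforward A' \<phi> u f + pushforward A' \<phi> v f)"
  by (auto simp: pushforward_def)

lemma inv_into_map_prod:
  assumes "inj_on f U" "inj_on g V" "x \<in> f ` U" "y \<in> g ` V"
  shows "inv_into (U \<times> V) (map_prod f g) (x, y) = (inv_into U f x, inv_into V g y)"
  by (rule inv_into_f_eq) (use assms in \<open>auto simp: map_prod_inj_on inv_into_into f_inv_into_f\<close>)

section \<open>Charts of the product\<close>

locale product_manifold = B: smooth_manifold A\<^sub>B + F: smooth_manifold A\<^sub>F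
  for A\<^sub>B :: "('a::{t2_space, second_countable_topology}, 'm::euclidean_space) atlas"
    and A\<^sub>F :: "('b::{t2_space, second_countable_topology}, 'n::euclidean_space) atlas"
begin

abbreviation M :: "('a \<times> 'b, 'm \<times> 'n) atlas" where "M \<equiv> prod_atlas A\<^sub>B A\<^sub>F"

lemma prod_chart: "(U, \<phi>) \<in> A\<^sub>B \<Longrightarrow> (V, \<psi>) \<in> A\<^sub>F \<Longrightarrow> (U \<times> V, map_prod \<phi> \<psi>) \<in> M"
  unfolding prod_atlas_def by blast

lemma inv_prod_chart:
  assumes "(U, \<phi>) \<in> A\<^sub>B" "(V, \<psi>) \<in> A\<^sub>F" "z \<in> \<phi> ` U \<times> \<psi> ` V"
  shows "inv_into (U \<times> V) (map_prod \<phi> \<psi>) z = (inv_into U \<phi> (fst z), inv_into V \<psi> (snd z))"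
proof -
  have "inj_on \<phi> U" "inj_on \<psi> V"
    using B.chart_inv(1)[OF assms(1)] F.chart_inv(1)[OF assms(2)] by (metis inj_on_inverseI)+
  from inv_into_map_prod[OF this] show ?thesis using assms(3) by (cases z) auto
qed

lemma prod_atlas_smooth: "smooth_atlas M"
  unfolding smooth_atlas_def
proof (intro conjI)
  show "(\<Union>(U, \<phi>)\<in>M. U) = UNIV"
  proof -
    have "z \<in> (\<Union>(U, \<phi>)\<in>M. U)" for z :: "'a \<times> 'b"
    proof -
      obtain U \<phi> where "(U, \<phi>) \<in> A\<^sub>B" "fst z \<in> U" using B.chart_cover by blast
      moreover obtain V \<psi> where "(V, \<psi>) \<in> A\<^sub>F" "snd z \<in> V" using F.chart_cover by blast
      ultimately have "(U \<times> V, map_prod \<phi> \<psi>) \<in> M" "z \<in> U \<times> V" by (auto simp: prod_chart mem_Times_iff)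
      then show ?thesis by (intro UN_I[of "(U \<times> V, map_prod \<phi> \<psi>)"]) auto
    qed
    then show ?thesis by blast
  qed
  show "\<forall>(W, \<chi>')\<in>M. open W \<and> open (\<chi>' ` W) \<and> homeomorphism W (\<chi>' ` W) \<chi>' (inv_into W \<chi>')"
  proof clarify
    fix W \<chi>' assume "(W, \<chi>') \<in> M"
    then obtain U \<phi> V \<psi> where c: "(U, \<phi>) \<in> A\<^sub>B" "(V, \<psi>) \<in> A\<^sub>F" and W: "W = U \<times> V" "\<chi>' = map_prod \<phi> \<psi>"
      by (auto simp: prod_atlas_def)
    have im: "\<chi>' ` W = \<phi> ` U \<times> \<psi> ` V" unfolding W by (rule map_prod_surj_on) auto
    note h = B.chart_homeo[OF c(1)] F.chart_homeo[OF c(2)]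
    have cont: "continuous_on U \<phi>" "continuous_on V \<psi>"
      "continuous_on (\<phi> ` U) (inv_into U \<phi>)" "continuous_on (\<psi> ` V) (inv_into V \<psi>)"
      using h by (simp_all add: homeomorphism_def)
    have "homeomorphism W (\<chi>' ` W) \<chi>' (inv_into W \<chi>')"
    proof (rule homeomorphismI)
      have "continuous_on W (\<lambda>z. (\<phi> (fst z), \<psi> (snd z)))" unfolding W
        by (intro continuous_on_Pair continuous_on_compose2[OF cont(1)] continuous_on_compose2[OF cont(2)] continuous_intros) auto
      then show "continuous_on W \<chi>'" by (simp add: W map_prod_def split_beta')
      have "continuous_on (\<chi>' ` W) (\<lambda>z. (inv_into U \<phi> (fst z), inv_into V \<psi> (snd z)))" unfolding im
        by (intro continuous_on_Pair continuous_on_compose2[OF cont(3)] continuous_on_compose2[OF cont(4)] continuous_intros) auto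
      then show "continuous_on (\<chi>' ` W) (inv_into W \<chi>')"
      proof (rule continuous_on_eq)
        fix y assume "y \<in> \<chi>' ` W"
        then show "(inv_into U \<phi> (fst y), inv_into V \<psi> (snd y)) = inv_into W \<chi>' y"
          unfolding im using inv_prod_chart[OF c] by (simp add: W)
      qed
      show "inv_into W \<chi>' ` \<chi>' ` W \<subseteq> W" using inv_into_into[of _ \<chi>' W] by blast
      show "inv_into W \<chi>' (\<chi>' z) = z" if "z \<in> W" for z
        using that by (auto simp: W inv_prod_chart[OF c] B.chart_inv(1)[OF c(1)] F.chart_inv(1)[OF c(2)])
      show "\<chi>' (inv_into W \<chi>' y) = y" if "y \<in> \<chi>' ` W" for y using that by (rule f_inv_into_f)
    qed simp
    moreover have "open W" using B.chart_open[OF c(1)] F.chart_open[OF c(2)] by (simp add: W open_Times)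
    moreover have "open (\<chi>' ` W)" using B.chart_image_open[OF c(1)] F.chart_image_open[OF c(2)] by (simp add: im open_Times)
    ultimately show "open W \<and> open (\<chi>' ` W) \<and> homeomorphism W (\<chi>' ` W) \<chi>' (inv_into W \<chi>')" by blast
  qed
  show "\<forall>(W, \<chi>')\<in>M. \<forall>(W', \<chi>'')\<in>M. smooth_on (\<chi>' ` (W \<inter> W')) (\<chi>'' \<circ> inv_into W \<chi>')"
  proof clarify
    fix W \<chi>' W' \<chi>'' assume "(W, \<chi>') \<in> M" "(W', \<chi>'') \<in> M"
    then obtain U \<phi> V \<psi> U' \<phi>' V' \<psi>' where c: "(U, \<phi>) \<in> A\<^sub>B" "(V, \<psi>) \<in> A\<^sub>F" and c': "(U', \<phi>') \<in> A\<^sub>B" "(V', \<psi>') \<in> A\<^sub>F"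
      and W: "W = U \<times> V" "\<chi>' = map_prod \<phi> \<psi>" and W': "W' = U' \<times> V'" "\<chi>'' = map_prod \<phi>' \<psi>'"
      by (auto simp: prod_atlas_def)
    define S where "S = \<phi> ` (U \<inter> U')"
    define T where "T = \<psi> ` (V \<inter> V')"
    have S: "open S" "S \<subseteq> \<phi> ` U" unfolding S_def
      using B.chart_image_open_subset[OF c(1), of "U \<inter> U'"] B.chart_open[OF c(1)] B.chart_open[OF c'(1)] by auto
    have T: "open T" "T \<subseteq> \<psi> ` V" unfolding T_def
      using F.chart_image_open_subset[OF c(2), of "V \<inter> V'"] F.chart_open[OF c(2)] F.chart_open[OF c'(2)] by auto
    have im: "\<chi>' ` (W \<inter> W') = S \<times> T"
      unfolding W W' S_def T_def Times_Int_Times by (rule map_prod_surj_on) auto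
    have ST: "open (S \<times> T)" using S T by (simp add: open_Times)
    have "smooth_on (S \<times> T) (\<lambda>z. ((\<phi>' \<circ> inv_into U \<phi>) (fst z), (\<psi>' \<circ> inv_into V \<psi>) (snd z)))"
    proof (rule smooth_on_Pair[OF ST])
      show "smooth_on (S \<times> T) (\<lambda>z. (\<phi>' \<circ> inv_into U \<phi>) (fst z))"
        by (rule smooth_on_compose_linear[OF bounded_linear_fst ST S(1) B.chart_transition[OF c(1) c'(1), folded S_def]]) auto
      show "smooth_on (S \<times> T) (\<lambda>z. (\<psi>' \<circ> inv_into V \<psi>) (snd z))"
        by (rule smooth_on_compose_linear[OF bounded_linear_snd ST T(1) F.chart_transition[OF c(2) c'(2), folded T_def]]) auto
    qed
    then show "smooth_on (\<chi>' ` (W \<inter> W')) (\<chi>'' \<circ> inv_into W \<chi>')"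
      unfolding im
    proof (rule smooth_on_cong[OF ST, rotated])
      fix z assume "z \<in> S \<times> T"
      then have "z \<in> \<phi> ` U \<times> \<psi> ` V" using S(2) T(2) by auto
      then show "((\<phi>' \<circ> inv_into U \<phi>) (fst z), (\<psi>' \<circ> inv_into V \<psi>) (snd z)) = (\<chi>'' \<circ> inv_into W \<chi>') z"
        by (simp add: W W' inv_prod_chart[OF c])
    qed
  qed
qed

sublocale M: smooth_manifold M
  by unfold_locales (rule prod_atlas_smooth)

section \<open>Smooth functions on the product and on its slices\<close>

lemma smooth_fun_fst:
  assumes f: "f \<in> smooth_fun A\<^sub>B"
  shows "(\<lambda>z. f (fst z)) \<in> smooth_fun M"
  unfolding smooth_fun_def
proof (clarify)
  fix W \<chi>' assume "(W, \<chi>') \<in> M"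
  then obtain U \<phi> V \<psi> where c: "(U, \<phi>) \<in> A\<^sub>B" "(V, \<psi>) \<in> A\<^sub>F" and W: "W = U \<times> V" "\<chi>' = map_prod \<phi> \<psi>"
    by (auto simp: prod_atlas_def)
  have im: "\<chi>' ` W = \<phi> ` U \<times> \<psi> ` V" unfolding W by (rule map_prod_surj_on) auto
  have o: "open (\<phi> ` U \<times> \<psi> ` V)" using B.chart_image_open[OF c(1)] F.chart_image_open[OF c(2)] by (simp add: open_Times)
  have "smooth_on (\<phi> ` U \<times> \<psi> ` V) (\<lambda>z. (f \<circ> inv_into U \<phi>) (fst z))"
    by (rule smooth_on_compose_linear[OF bounded_linear_fst o B.chart_image_open[OF c(1)] B.smooth_fun_chart[OF f c(1)]]) auto
  then show "smooth_on (\<chi>' ` W) ((\<lambda>z. f (fst z)) \<circ> inv_into W \<chi>')"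
    unfolding im by (rule smooth_on_cong[OF o, rotated]) (simp add: W inv_prod_chart[OF c])
qed

lemma smooth_fun_snd:
  assumes f: "f \<in> smooth_fun A\<^sub>F"
  shows "(\<lambda>z. f (snd z)) \<in> smooth_fun M"
  unfolding smooth_fun_def
proof (clarify)
  fix W \<chi>' assume "(W, \<chi>') \<in> M"
  then obtain U \<phi> V \<psi> where c: "(U, \<phi>) \<in> A\<^sub>B" "(V, \<psi>) \<in> A\<^sub>F" and W: "W = U \<times> V" "\<chi>' = map_prod \<phi> \<psi>"
    by (auto simp: prod_atlas_def)
  have im: "\<chi>' ` W = \<phi> ` U \<times> \<psi> ` V" unfolding W by (rule map_prod_surj_on) auto
  have o: "open (\<phi> ` U \<times> \<psi> ` V)" using B.chart_image_open[OF c(1)] F.chart_image_open[OF c(2)] by (simp add: open_Times)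
  have "smooth_on (\<phi> ` U \<times> \<psi> ` V) (\<lambda>z. (f \<circ> inv_into V \<psi>) (snd z))"
    by (rule smooth_on_compose_linear[OF bounded_linear_snd o F.chart_image_open[OF c(2)] F.smooth_fun_chart[OF f c(2)]]) auto
  then show "smooth_on (\<chi>' ` W) ((\<lambda>z. f (snd z)) \<circ> inv_into W \<chi>')"
    unfolding im by (rule smooth_on_cong[OF o, rotated]) (simp add: W inv_prod_chart[OF c])
qed

lemma smooth_fun_slice_fst:
  assumes f: "f \<in> smooth_fun M"
  shows "(\<lambda>x. f (x, y)) \<in> smooth_fun A\<^sub>B"
  unfolding smooth_fun_def
proof clarify
  fix U \<phi> assume U: "(U, \<phi>) \<in> A\<^sub>B"
  obtain V \<psi> where V: "(V, \<psi>) \<in> A\<^sub>F" "y \<in> V" using F.chart_cover by blast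
  have im: "map_prod \<phi> \<psi> ` (U \<times> V) = \<phi> ` U \<times> \<psi> ` V" by (rule map_prod_surj_on) auto
  note o = B.chart_image_open[OF U]
  have "smooth_on (\<phi> ` U) (\<lambda>u. (f \<circ> inv_into (U \<times> V) (map_prod \<phi> \<psi>)) (u, \<psi> y))"
  proof (rule smooth_on_compose[OF o M.chart_image_open[OF prod_chart[OF U V(1)]] M.smooth_fun_chart[OF f prod_chart[OF U V(1)]]])
    show "smooth_on (\<phi> ` U) (\<lambda>u. (u, \<psi> y))"
      by (intro smooth_on_Pair smooth_on_bounded_linear bounded_linear_ident smooth_on_const o)
  qed (use V(2) im in auto)
  then show "smooth_on (\<phi> ` U) ((\<lambda>x. f (x, y)) \<circ> inv_into U \<phi>)"
    by (rule smooth_on_cong[OF o, rotated])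
      (use V(2) in \<open>simp add: inv_prod_chart[OF U V(1)] F.chart_inv(1)[OF V(1)]\<close>)
qed

lemma smooth_fun_slice_snd:
  assumes f: "f \<in> smooth_fun M"
  shows "(\<lambda>y. f (x, y)) \<in> smooth_fun A\<^sub>F"
  unfolding smooth_fun_def
proof clarify
  fix V \<psi> assume V: "(V, \<psi>) \<in> A\<^sub>F"
  obtain U \<phi> where U: "(U, \<phi>) \<in> A\<^sub>B" "x \<in> U" using B.chart_cover by blast
  have im: "map_prod \<phi> \<psi> ` (U \<times> V) = \<phi> ` U \<times> \<psi> ` V" by (rule map_prod_surj_on) auto
  note o = F.chart_image_open[OF V]
  have "smooth_on (\<psi> ` V) (\<lambda>u. (f \<circ> inv_into (U \<times> V) (map_prod \<phi> \<psi>)) (\<phi> x, u))"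
  proof (rule smooth_on_compose[OF o M.chart_image_open[OF prod_chart[OF U(1) V]] M.smooth_fun_chart[OF f prod_chart[OF U(1) V]]])
    show "smooth_on (\<psi> ` V) (\<lambda>u. (\<phi> x, u))"
      by (intro smooth_on_Pair smooth_on_bounded_linear bounded_linear_ident smooth_on_const o)
  qed (use U(2) im in auto)
  then show "smooth_on (\<psi> ` V) ((\<lambda>y. f (x, y)) \<circ> inv_into V \<psi>)"
    by (rule smooth_on_cong[OF o, rotated])
      (use U(2) in \<open>simp add: inv_prod_chart[OF U(1) V] B.chart_inv(1)[OF U(1)]\<close>)
qed

text \<open>By linearity the derivative in direction \<open>(e\<^sub>1, e\<^sub>2)\<close> is the
  sum of those in directions \<open>(e\<^sub>1, 0)\<close> and \<open>(0, e\<^sub>2)\<close>, and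
  these are derivatives along the two slices through the point.\<close>

lemma chart_deriv_prod:
  assumes U: "(U, \<phi>) \<in> A\<^sub>B" "p \<in> U" and V: "(V, \<psi>) \<in> A\<^sub>F" "q \<in> V" and f: "f \<in> smooth_fun M"
  shows "M.chart_deriv (U \<times> V) (map_prod \<phi> \<psi>) (p, q) (e\<^sub>1, e\<^sub>2) f =
    B.chart_deriv U \<phi> p e\<^sub>1 (\<lambda>x. f (x, q)) + F.chart_deriv V \<psi> q e\<^sub>2 (\<lambda>y. f (p, y))"
proof -
  define D where "D e = M.chart_deriv (U \<times> V) (map_prod \<phi> \<psi>) (p, q) e f" for e
  define f' where "f' = f \<circ> inv_into (U \<times> V) (map_prod \<phi> \<psi>)"
  have pq: "(p, q) \<in> U \<times> V" using U V by simp
  have D: "(f' has_derivative D) (at (\<phi> p, \<psi> q))"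
    using M.chart_has_derivative[OF prod_chart[OF U(1) V(1)] pq f] unfolding D_def f'_def by simp
  have "B.chart_deriv U \<phi> p e\<^sub>1 (\<lambda>x. f (x, q)) = D (e\<^sub>1, 0)"
  proof (rule B.chart_deriv_eqI[OF U smooth_fun_slice_fst[OF f]])
    have "((\<lambda>u. (u, \<psi> q)) has_derivative (\<lambda>u. (u, 0))) (at (\<phi> p))"
      by (auto intro!: derivative_eq_intros)
    from has_derivative_compose[OF this D]
    have "((\<lambda>u. f' (u, \<psi> q)) has_derivative (\<lambda>u. D (u, 0))) (at (\<phi> p))" .
    then show "((\<lambda>x. f (x, q)) \<circ> inv_into U \<phi> has_derivative (\<lambda>u. D (u, 0))) (at (\<phi> p))"
      by (rule has_derivative_transform_within_open[OF _ B.chart_image_open[OF U(1)]])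
        (use U V in \<open>auto simp: f'_def inv_prod_chart[OF U(1) V(1)] F.chart_inv(1)[OF V(1)]\<close>)
  qed
  moreover have "F.chart_deriv V \<psi> q e\<^sub>2 (\<lambda>y. f (p, y)) = D (0, e\<^sub>2)"
  proof (rule F.chart_deriv_eqI[OF V smooth_fun_slice_snd[OF f]])
    have "((\<lambda>u. (\<phi> p, u)) has_derivative (\<lambda>u. (0, u))) (at (\<psi> q))"
      by (auto intro!: derivative_eq_intros)
    from has_derivative_compose[OF this D]
    have "((\<lambda>u. f' (\<phi> p, u)) has_derivative (\<lambda>u. D (0, u))) (at (\<psi> q))" .
    then show "((\<lambda>y. f (p, y)) \<circ> inv_into V \<psi> has_derivative (\<lambda>u. D (0, u))) (at (\<psi> q))"
      by (rule has_derivative_transform_within_open[OF _ F.chart_image_open[OF V(1)]])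
        (use U V in \<open>auto simp: f'_def inv_prod_chart[OF U(1) V(1)] B.chart_inv(1)[OF U(1)]\<close>)
  qed
  moreover have "D (e\<^sub>1, e\<^sub>2) = D (e\<^sub>1, 0) + D (0, e\<^sub>2)"
    using linear_add[OF has_derivative_linear[OF D], of "(e\<^sub>1, 0)" "(0, e\<^sub>2)"] by simp
  ultimately show ?thesis by (simp add: D_def)
qed

section \<open>Splitting of the tangent spaces\<close>

lemma pushforward_fst_tangent: "v \<in> tangent_space M z \<Longrightarrow> pushforward A\<^sub>B fst v \<in> tangent_space A\<^sub>B (fst z)"
  using smooth_fun_fst by (intro pushforward_tangent B.smooth_manifold_axioms) (auto simp: o_def)

lemma pushforward_snd_tangent: "v \<in> tangent_space M z \<Longrightarrow> pushforward A\<^sub>F snd v \<in> tangent_space A\<^sub>F (snd z)"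
  using smooth_fun_snd by (intro pushforward_tangent F.smooth_manifold_axioms) (auto simp: o_def)

definition incl_fst :: "'a \<times> 'b \<Rightarrow> 'a tvec \<Rightarrow> ('a \<times> 'b) tvec" where
  "incl_fst z = pushforward M (\<lambda>x. (x, snd z))"

definition incl_snd :: "'a \<times> 'b \<Rightarrow> 'b tvec \<Rightarrow> ('a \<times> 'b) tvec" where
  "incl_snd z = pushforward M (\<lambda>y. (fst z, y))"

lemma incl_fst_tangent: "u \<in> tangent_space A\<^sub>B (fst z) \<Longrightarrow> incl_fst z u \<in> tangent_space M z"
  using pushforward_tangent[OF M.smooth_manifold_axioms, of u A\<^sub>B "fst z" "\<lambda>x. (x, snd z)"] smooth_fun_slice_fst
  by (simp add: incl_fst_def o_def)

lemma incl_snd_tangent: "u \<in> tangent_space A\<^sub>F (snd z) \<Longrightarrow> incl_snd z u \<in> tangent_space M z"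
  using pushforward_tangent[OF M.smooth_manifold_axioms, of u A\<^sub>F "snd z" "\<lambda>y. (fst z, y)"] smooth_fun_slice_snd
  by (simp add: incl_snd_def o_def)

lemma pushforward_incl:
  assumes u: "u \<in> tangent_space A\<^sub>B (fst z)" and w: "w \<in> tangent_space A\<^sub>F (snd z)"
  shows "pushforward A\<^sub>B fst (incl_fst z u) = u" "pushforward A\<^sub>F snd (incl_fst z u) = (\<lambda>f. 0)"
    "pushforward A\<^sub>B fst (incl_snd z w) = (\<lambda>f. 0)" "pushforward A\<^sub>F snd (incl_snd z w) = w"
  using smooth_fun_fst smooth_fun_snd B.tv_nonsmooth[OF u] F.tv_nonsmooth[OF w] B.tv_const[OF u] F.tv_const[OF w]
  by (auto simp: pushforward_def incl_fst_def incl_snd_def o_def fun_eq_iff)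

text \<open>In a product chart \<open>v\<close> is the derivative in some direction
  \<open>(e\<^sub>1, e\<^sub>2)\<close>. Testing it on functions pulled back from a factor
  identifies its projections as the derivatives in directions \<open>e\<^sub>1\<close> and
  \<open>e\<^sub>2\<close>, and \<open>chart_deriv_prod\<close> adds them up.\<close>

lemma tangent_decomposition:
  assumes v: "v \<in> tangent_space M z"
  shows "v f = incl_fst z (pushforward A\<^sub>B fst v) f + incl_snd z (pushforward A\<^sub>F snd v) f"
proof (cases "f \<in> smooth_fun M")
  case f: True
  obtain p q where z: "z = (p, q)" by fastforce
  obtain U \<phi> where U: "(U, \<phi>) \<in> A\<^sub>B" "p \<in> U" using B.chart_cover by blast
  obtain V \<psi> where V: "(V, \<psi>) \<in> A\<^sub>F" "q \<in> V" using F.chart_cover by blast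
  have pq: "(p, q) \<in> U \<times> V" using U V by simp
  obtain e\<^sub>1 e\<^sub>2 where v': "v = M.chart_deriv (U \<times> V) (map_prod \<phi> \<psi>) (p, q) (e\<^sub>1, e\<^sub>2)"
    using M.tangent_chart[OF prod_chart[OF U(1) V(1)] pq, of v] v z by auto
  note eq = chart_deriv_prod[OF U V, of _ e\<^sub>1 e\<^sub>2, folded v']
  have "pushforward A\<^sub>B fst v = B.chart_deriv U \<phi> p e\<^sub>1"
  proof (rule B.tangent_space_eqI)
    show "pushforward A\<^sub>B fst v \<in> tangent_space A\<^sub>B p" using pushforward_fst_tangent[OF v] z by simp
    show "pushforward A\<^sub>B fst v h = B.chart_deriv U \<phi> p e\<^sub>1 h" if "h \<in> smooth_fun A\<^sub>B" for h
      using that eq[OF smooth_fun_fst[OF that]] F.tv_const[OF F.chart_deriv_tangent[OF V]]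
      by (simp add: pushforward_def o_def)
  qed (rule B.chart_deriv_tangent[OF U])
  moreover have "pushforward A\<^sub>F snd v = F.chart_deriv V \<psi> q e\<^sub>2"
  proof (rule F.tangent_space_eqI)
    show "pushforward A\<^sub>F snd v \<in> tangent_space A\<^sub>F q" using pushforward_snd_tangent[OF v] z by simp
    show "pushforward A\<^sub>F snd v h = F.chart_deriv V \<psi> q e\<^sub>2 h" if "h \<in> smooth_fun A\<^sub>F" for h
      using that eq[OF smooth_fun_snd[OF that]] B.tv_const[OF B.chart_deriv_tangent[OF U]]
      by (simp add: pushforward_def o_def)
  qed (rule F.chart_deriv_tangent[OF V])
  ultimately show ?thesis
    using eq[OF f] f z by (simp add: incl_fst_def incl_snd_def pushforward_def o_def)
qed (use M.tv_nonsmooth[OF v] in \<open>simp add: incl_fst_def incl_snd_def pushforward_def\<close>)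

lemma tangent_prod_eqI:
  assumes "v \<in> tangent_space M z" "w \<in> tangent_space M z"
    "pushforward A\<^sub>B fst v = pushforward A\<^sub>B fst w" "pushforward A\<^sub>F snd v = pushforward A\<^sub>F snd w"
  shows "v = w"
  using tangent_decomposition[OF assms(1)] tangent_decomposition[OF assms(2)] assms(3,4) by (simp add: fun_eq_iff)

section \<open>Lifts of vector fields\<close>

abbreviation "l\<^sub>B \<equiv> lift_fst A\<^sub>B A\<^sub>F"
abbreviation "l\<^sub>F \<equiv> lift_snd A\<^sub>B A\<^sub>F"

lemma lift_fst_incl: "l\<^sub>B X z = incl_fst z (X (fst z))"
  by (simp add: lift_fst_def incl_fst_def split_beta)

lemma lift_snd_incl: "l\<^sub>F X z = incl_snd z (X (snd z))"
  by (simp add: lift_snd_def incl_snd_def split_beta)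

lemma lift_fst_apply: "f \<in> smooth_fun M \<Longrightarrow> l\<^sub>B X (p, q) f = X p (\<lambda>x. f (x, q))"
  by (simp add: lift_fst_def pushforward_def o_def)

lemma lift_snd_apply: "f \<in> smooth_fun M \<Longrightarrow> l\<^sub>F X (p, q) f = X q (\<lambda>y. f (p, y))"
  by (simp add: lift_snd_def pushforward_def o_def)

text \<open>Smoothness on each slice is not enough; joint smoothness is required. In a product chart
  the lift applied to \<open>f\<close> is the sum of the X(\<xi>_i), pulled back from the factor,
  times the partial derivatives of \<open>f\<close> in directions \<open>(i, 0)\<close>, and both
  are jointly smooth.\<close>

lemma lift_fst_vf:
  assumes X: "X \<in> vector_fields A\<^sub>B"
  shows "l\<^sub>B X \<in> vector_fields M"
proof -
  have t: "l\<^sub>B X z \<in> tangent_space M z" for z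
    unfolding lift_fst_incl by (rule incl_fst_tangent[OF B.vf_tangent[OF X]])
  have "(\<lambda>z. l\<^sub>B X z f) \<in> smooth_fun M" if f: "f \<in> smooth_fun M" for f
  proof (rule M.smooth_funI_chart)
    fix z :: "'a \<times> 'b"
    obtain p q where z: "z = (p, q)" by fastforce
    obtain U \<phi> where U: "(U, \<phi>) \<in> A\<^sub>B" "p \<in> U" using B.chart_cover by blast
    obtain V \<psi> where V: "(V, \<psi>) \<in> A\<^sub>F" "q \<in> V" using F.chart_cover by blast
    note UV = prod_chart[OF U(1) V(1)]
    obtain \<xi> N where \<xi>: "open N" "p \<in> N" "N \<subseteq> U" "\<And>i. \<xi> i \<in> smooth_fun A\<^sub>B"
      and "\<And>q e i. q \<in> N \<Longrightarrow> B.chart_deriv U \<phi> q e (\<xi> i) = e \<bullet> i"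
      and rep: "\<And>q v f. q \<in> N \<Longrightarrow> v \<in> tangent_space A\<^sub>B q \<Longrightarrow>
        v f = (\<Sum>i\<in>(Basis::'m set). v (\<xi> i) * B.chart_deriv U \<phi> q i f)"
      using U by (rule B.tangent_coordinates) (rule that)
    define f' where "f' = f \<circ> inv_into (U \<times> V) (map_prod \<phi> \<psi>)"
    define S where "S = map_prod \<phi> \<psi> ` (N \<times> V)"
    have im: "S = \<phi> ` N \<times> \<psi> ` V" unfolding S_def by (rule map_prod_surj_on) auto
    have S: "open S" "S \<subseteq> map_prod \<phi> \<psi> ` (U \<times> V)" unfolding S_def
      using \<xi>(3) by (auto intro: M.chart_image_open_subset[OF UV] open_Times \<xi>(1) F.chart_open[OF V(1)])
    have "smooth_on S (\<lambda>y. \<Sum>i\<in>(Basis::'m set). ((\<lambda>z. X (fst z) (\<xi> i)) \<circ> inv_into (U \<times> V) (map_prod \<phi> \<psi>)) y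
        * frechet_derivative f' (at y) (i, 0))"
    proof (intro smooth_on_sum smooth_on_mult S(1) finite_Basis)
      fix i :: 'm
      show "smooth_on S ((\<lambda>z. X (fst z) (\<xi> i)) \<circ> inv_into (U \<times> V) (map_prod \<phi> \<psi>))"
        by (rule smooth_on_subset[OF M.smooth_fun_chart[OF smooth_fun_fst[OF B.vf_smooth[OF X \<xi>(4)]] UV] S(2)])
      show "smooth_on S (\<lambda>y. frechet_derivative f' (at y) (i, 0))"
        unfolding f'_def
        by (rule smooth_on_subset[OF smooth_on_frechet_derivative[OF M.smooth_fun_chart[OF f UV]] S(2)])
    qed
    then have "smooth_on S ((\<lambda>z. l\<^sub>B X z f) \<circ> inv_into (U \<times> V) (map_prod \<phi> \<psi>))"
    proof (rule smooth_on_cong[OF S(1), rotated])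
      fix y assume "y \<in> S"
      then obtain x w where xw: "x \<in> N" "w \<in> V" and y: "y = map_prod \<phi> \<psi> (x, w)" by (auto simp: S_def)
      have xU: "x \<in> U" using xw \<xi>(3) by auto
      have inv: "inv_into (U \<times> V) (map_prod \<phi> \<psi>) y = (x, w)"
        unfolding y using M.chart_inv(1)[OF UV, of "(x, w)"] xU xw by simp
      have "B.chart_deriv U \<phi> x i (\<lambda>x. f (x, w)) = frechet_derivative f' (at y) (i, 0)" for i
      proof -
        have "M.chart_deriv (U \<times> V) (map_prod \<phi> \<psi>) (x, w) (i, 0) f = B.chart_deriv U \<phi> x i (\<lambda>x. f (x, w))
            + F.chart_deriv V \<psi> w 0 (\<lambda>y. f (x, y))"
          by (rule chart_deriv_prod[OF U(1) xU V(1) xw(2) f])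
        moreover have "F.chart_deriv V \<psi> w 0 (\<lambda>y. f (x, y)) = 0"
          using linear_0[OF F.chart_deriv_linear[OF V(1) xw(2) smooth_fun_slice_snd[OF f]]] .
        ultimately show ?thesis using f by (simp add: M.chart_deriv_def f'_def y)
      qed
      then show "(\<Sum>i\<in>(Basis::'m set). ((\<lambda>z. X (fst z) (\<xi> i)) \<circ> inv_into (U \<times> V) (map_prod \<phi> \<psi>)) y
        * frechet_derivative f' (at y) (i, 0)) = ((\<lambda>z. l\<^sub>B X z f) \<circ> inv_into (U \<times> V) (map_prod \<phi> \<psi>)) y"
        using rep[OF xw(1) B.vf_tangent[OF X], of "\<lambda>x. f (x, w)"] by (simp add: inv lift_fst_apply[OF f])
    qed
    then show "\<exists>W \<chi>' S. (W, \<chi>') \<in> M \<and> z \<in> W \<and> open S \<and> \<chi>' z \<in> S \<and> S \<subseteq> \<chi>' ` W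
      \<and> smooth_on S ((\<lambda>z. l\<^sub>B X z f) \<circ> inv_into W \<chi>')"
      using UV S U(2) V(2) \<xi>(2) z
      by - (rule exI[of _ "U \<times> V"], rule exI[of _ "map_prod \<phi> \<psi>"], rule exI[of _ S], auto simp: im)
  qed
  then show ?thesis unfolding vector_fields_def using t by blast
qed

lemma lift_snd_vf:
  assumes X: "X \<in> vector_fields A\<^sub>F"
  shows "l\<^sub>F X \<in> vector_fields M"
proof -
  have t: "l\<^sub>F X z \<in> tangent_space M z" for z
    unfolding lift_snd_incl by (rule incl_snd_tangent[OF F.vf_tangent[OF X]])
  have "(\<lambda>z. l\<^sub>F X z f) \<in> smooth_fun M" if f: "f \<in> smooth_fun M" for f
  proof (rule M.smooth_funI_chart)
    fix z :: "'a \<times> 'b"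
    obtain p q where z: "z = (p, q)" by fastforce
    obtain U \<phi> where U: "(U, \<phi>) \<in> A\<^sub>B" "p \<in> U" using B.chart_cover by blast
    obtain V \<psi> where V: "(V, \<psi>) \<in> A\<^sub>F" "q \<in> V" using F.chart_cover by blast
    note UV = prod_chart[OF U(1) V(1)]
    obtain \<xi> N where \<xi>: "open N" "q \<in> N" "N \<subseteq> V" "\<And>i. \<xi> i \<in> smooth_fun A\<^sub>F"
      and "\<And>q e i. q \<in> N \<Longrightarrow> F.chart_deriv V \<psi> q e (\<xi> i) = e \<bullet> i"
      and rep: "\<And>q v f. q \<in> N \<Longrightarrow> v \<in> tangent_space A\<^sub>F q \<Longrightarrow>
        v f = (\<Sum>i\<in>(Basis::'n set). v (\<xi> i) * F.chart_deriv V \<psi> q i f)"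
      using V by (rule F.tangent_coordinates) (rule that)
    define f' where "f' = f \<circ> inv_into (U \<times> V) (map_prod \<phi> \<psi>)"
    define S where "S = map_prod \<phi> \<psi> ` (U \<times> N)"
    have im: "S = \<phi> ` U \<times> \<psi> ` N" unfolding S_def by (rule map_prod_surj_on) auto
    have S: "open S" "S \<subseteq> map_prod \<phi> \<psi> ` (U \<times> V)" unfolding S_def
      using \<xi>(3) by (auto intro: M.chart_image_open_subset[OF UV] open_Times \<xi>(1) B.chart_open[OF U(1)])
    have "smooth_on S (\<lambda>y. \<Sum>i\<in>(Basis::'n set). ((\<lambda>z. X (snd z) (\<xi> i)) \<circ> inv_into (U \<times> V) (map_prod \<phi> \<psi>)) y
        * frechet_derivative f' (at y) (0, i))"
    proof (intro smooth_on_sum smooth_on_mult S(1) finite_Basis)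
      fix i :: 'n
      show "smooth_on S ((\<lambda>z. X (snd z) (\<xi> i)) \<circ> inv_into (U \<times> V) (map_prod \<phi> \<psi>))"
        by (rule smooth_on_subset[OF M.smooth_fun_chart[OF smooth_fun_snd[OF F.vf_smooth[OF X \<xi>(4)]] UV] S(2)])
      show "smooth_on S (\<lambda>y. frechet_derivative f' (at y) (0, i))"
        unfolding f'_def
        by (rule smooth_on_subset[OF smooth_on_frechet_derivative[OF M.smooth_fun_chart[OF f UV]] S(2)])
    qed
    then have "smooth_on S ((\<lambda>z. l\<^sub>F X z f) \<circ> inv_into (U \<times> V) (map_prod \<phi> \<psi>))"
    proof (rule smooth_on_cong[OF S(1), rotated])
      fix y assume "y \<in> S"
      then obtain x w where xw: "x \<in> U" "w \<in> N" and y: "y = map_prod \<phi> \<psi> (x, w)" by (auto simp: S_def)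
      have wV: "w \<in> V" using xw \<xi>(3) by auto
      have inv: "inv_into (U \<times> V) (map_prod \<phi> \<psi>) y = (x, w)"
        unfolding y using M.chart_inv(1)[OF UV, of "(x, w)"] wV xw by simp
      have "F.chart_deriv V \<psi> w i (\<lambda>y. f (x, y)) = frechet_derivative f' (at y) (0, i)" for i
      proof -
        have "M.chart_deriv (U \<times> V) (map_prod \<phi> \<psi>) (x, w) (0, i) f = B.chart_deriv U \<phi> x 0 (\<lambda>x. f (x, w))
            + F.chart_deriv V \<psi> w i (\<lambda>y. f (x, y))"
          by (rule chart_deriv_prod[OF U(1) xw(1) V(1) wV f])
        moreover have "B.chart_deriv U \<phi> x 0 (\<lambda>x. f (x, w)) = 0"
          using linear_0[OF B.chart_deriv_linear[OF U(1) xw(1) smooth_fun_slice_fst[OF f]]] .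
        ultimately show ?thesis using f by (simp add: M.chart_deriv_def f'_def y)
      qed
      then show "(\<Sum>i\<in>(Basis::'n set). ((\<lambda>z. X (snd z) (\<xi> i)) \<circ> inv_into (U \<times> V) (map_prod \<phi> \<psi>)) y
        * frechet_derivative f' (at y) (0, i)) = ((\<lambda>z. l\<^sub>F X z f) \<circ> inv_into (U \<times> V) (map_prod \<phi> \<psi>)) y"
        using rep[OF xw(2) F.vf_tangent[OF X], of "\<lambda>y. f (x, y)"] by (simp add: inv lift_snd_apply[OF f])
    qed
    then show "\<exists>W \<chi>' S. (W, \<chi>') \<in> M \<and> z \<in> W \<and> open S \<and> \<chi>' z \<in> S \<and> S \<subseteq> \<chi>' ` W
      \<and> smooth_on S ((\<lambda>z. l\<^sub>F X z f) \<circ> inv_into W \<chi>')"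
      using UV S U(2) V(2) \<xi>(2) z
      by - (rule exI[of _ "U \<times> V"], rule exI[of _ "map_prod \<phi> \<psi>"], rule exI[of _ S], auto simp: im)
  qed
  then show ?thesis unfolding vector_fields_def using t by blast
qed

lemma lift_fst_on_fst:
  assumes "h \<in> smooth_fun A\<^sub>B" shows "l\<^sub>B X z (\<lambda>z. h (fst z)) = X (fst z) h"
  using lift_fst_apply[OF smooth_fun_fst[OF assms], of X "fst z" "snd z"] by simp

lemma lift_fst_on_snd:
  assumes "X \<in> vector_fields A\<^sub>B" "h \<in> smooth_fun A\<^sub>F" shows "l\<^sub>B X z (\<lambda>z. h (snd z)) = 0"
  using lift_fst_apply[OF smooth_fun_snd[OF assms(2)], of X "fst z" "snd z"] B.tv_const[OF B.vf_tangent[OF assms(1)]] by simp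

lemma lift_snd_on_snd:
  assumes "h \<in> smooth_fun A\<^sub>F" shows "l\<^sub>F X z (\<lambda>z. h (snd z)) = X (snd z) h"
  using lift_snd_apply[OF smooth_fun_snd[OF assms], of X "fst z" "snd z"] by simp

lemma lift_snd_on_fst:
  assumes "X \<in> vector_fields A\<^sub>F" "h \<in> smooth_fun A\<^sub>B" shows "l\<^sub>F X z (\<lambda>z. h (fst z)) = 0"
  using lift_snd_apply[OF smooth_fun_fst[OF assms(2)], of X "fst z" "snd z"] F.tv_const[OF F.vf_tangent[OF assms(1)]] by simp

lemma pushforward_lift:
  assumes "X \<in> vector_fields A\<^sub>B" "U \<in> vector_fields A\<^sub>F"
  shows "pushforward A\<^sub>B fst (l\<^sub>B X z) = X (fst z)" "pushforward A\<^sub>F snd (l\<^sub>B X z) = (\<lambda>f. 0)"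
    "pushforward A\<^sub>B fst (l\<^sub>F U z) = (\<lambda>f. 0)" "pushforward A\<^sub>F snd (l\<^sub>F U z) = U (snd z)"
  using pushforward_incl[OF B.vf_tangent[OF assms(1)] F.vf_tangent[OF assms(2)]]
  by (simp_all add: lift_fst_incl lift_snd_incl)

lemma lie_bracket_lift_fst:
  assumes X: "X \<in> vector_fields A\<^sub>B" and Y: "Y \<in> vector_fields A\<^sub>B"
  shows "lie_bracket (l\<^sub>B X) (l\<^sub>B Y) = l\<^sub>B (lie_bracket X Y)"
proof (rule M.vf_eqI)
  fix z :: "'a \<times> 'b" and f assume f: "f \<in> smooth_fun M"
  obtain p q where z: "z = (p, q)" by fastforce
  show "lie_bracket (l\<^sub>B X) (l\<^sub>B Y) z f = l\<^sub>B (lie_bracket X Y) z f"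
    using lift_fst_apply[OF M.vf_smooth[OF lift_fst_vf[OF Y] f]] lift_fst_apply[OF M.vf_smooth[OF lift_fst_vf[OF X] f]]
    by (simp add: z lie_bracket_def lift_fst_apply[OF f])
qed (intro M.lie_bracket_vf B.lie_bracket_vf lift_fst_vf X Y)+

lemma lie_bracket_lift_snd:
  assumes X: "X \<in> vector_fields A\<^sub>F" and Y: "Y \<in> vector_fields A\<^sub>F"
  shows "lie_bracket (l\<^sub>F X) (l\<^sub>F Y) = l\<^sub>F (lie_bracket X Y)"
proof (rule M.vf_eqI)
  fix z :: "'a \<times> 'b" and f assume f: "f \<in> smooth_fun M"
  obtain p q where z: "z = (p, q)" by fastforce
  show "lie_bracket (l\<^sub>F X) (l\<^sub>F Y) z f = l\<^sub>F (lie_bracket X Y) z f"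
    using lift_snd_apply[OF M.vf_smooth[OF lift_snd_vf[OF Y] f]] lift_snd_apply[OF M.vf_smooth[OF lift_snd_vf[OF X] f]]
    by (simp add: z lie_bracket_def lift_snd_apply[OF f])
qed (intro M.lie_bracket_vf F.lie_bracket_vf lift_snd_vf X Y)+

text \<open>No symmetry of second derivatives is needed: a derivation is determined by its values on the
  functions pulled back from the factors, and the bracket kills those.\<close>

lemma lie_bracket_lift_mixed:
  assumes X: "X \<in> vector_fields A\<^sub>B" and U: "U \<in> vector_fields A\<^sub>F"
  shows "lie_bracket (l\<^sub>B X) (l\<^sub>F U) = (\<lambda>z f. 0)" "lie_bracket (l\<^sub>F U) (l\<^sub>B X) = (\<lambda>z f. 0)"
proof -
  note Xt = M.vf_tangent[OF lift_fst_vf[OF X]] and Ut = M.vf_tangent[OF lift_snd_vf[OF U]]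
  show *: "lie_bracket (l\<^sub>B X) (l\<^sub>F U) = (\<lambda>z f. 0)"
  proof
    fix z
    show "lie_bracket (l\<^sub>B X) (l\<^sub>F U) z = (\<lambda>f. 0)"
    proof (rule tangent_prod_eqI)
      show "lie_bracket (l\<^sub>B X) (l\<^sub>F U) z \<in> tangent_space M z"
        by (intro M.vf_tangent M.lie_bracket_vf lift_fst_vf lift_snd_vf X U)
      show "pushforward A\<^sub>B fst (lie_bracket (l\<^sub>B X) (l\<^sub>F U) z) = pushforward A\<^sub>B fst (\<lambda>f. 0)"
        by (auto simp: pushforward_def lie_bracket_def o_def fun_eq_iff lift_snd_on_fst[OF U] lift_fst_on_fst
            M.tv_const[OF Xt] lift_snd_on_fst[OF U B.vf_smooth[OF X]])
      show "pushforward A\<^sub>F snd (lie_bracket (l\<^sub>B X) (l\<^sub>F U) z) = pushforward A\<^sub>F snd (\<lambda>f. 0)"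
        by (auto simp: pushforward_def lie_bracket_def o_def fun_eq_iff lift_fst_on_snd[OF X] lift_snd_on_snd
            M.tv_const[OF Ut] lift_fst_on_snd[OF X F.vf_smooth[OF U]])
    qed simp
  qed
  show "lie_bracket (l\<^sub>F U) (l\<^sub>B X) = (\<lambda>z f. 0)"
    by (subst M.lie_bracket_swap) (simp add: *)
qed

end

section \<open>Twisted products\<close>

locale twisted_product = product_manifold A\<^sub>B A\<^sub>F +
    B: nondegenerate_semi_riemannian A\<^sub>B g\<^sub>B + F: nondegenerate_semi_riemannian A\<^sub>F g\<^sub>F
  for A\<^sub>B :: "('a::{t2_space, second_countable_topology}, 'm::euclidean_space) atlas"
    and A\<^sub>F :: "('b::{t2_space, second_countable_topology}, 'n::euclidean_space) atlas"
    and g\<^sub>B :: "'a metric" and g\<^sub>F :: "'b metric" +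
  fixes b :: "'a \<times> 'b \<Rightarrow> real"
  assumes b: "b \<in> smooth_fun (prod_atlas A\<^sub>B A\<^sub>F)"
    and db: "\<And>z. b z = 0 \<Longrightarrow> differential (prod_atlas A\<^sub>B A\<^sub>F) b z = (\<lambda>_. 0)"
begin

abbreviation g where "g \<equiv> twisted_metric A\<^sub>B g\<^sub>B A\<^sub>F g\<^sub>F b"
abbreviation "p\<^sub>B \<equiv> pushforward A\<^sub>B (fst :: 'a \<times> 'b \<Rightarrow> 'a)"
abbreviation "p\<^sub>F \<equiv> pushforward A\<^sub>F (snd :: 'a \<times> 'b \<Rightarrow> 'b)"

lemma b_zero: "b z = 0 \<Longrightarrow> v \<in> tangent_space M z \<Longrightarrow> v b = 0"
  using fun_cong[OF db, of z v] by (simp add: differential_def)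

text \<open>Symmetry and linearity pass through the tangent maps of the projections. Smoothness
  takes two stages: projected fields are first paired with fields of the factor, and these products
  then give the inner product of two projected fields by means of a dual frame.\<close>

lemma twisted_ssr: "singular_semi_riemannian M g"
  unfolding singular_semi_riemannian_def
proof (intro conjI allI ballI)
  fix z u v assume uv: "u \<in> tangent_space M z" "v \<in> tangent_space M z"
  show "g z u v = g z v u"
    using B.g_sym[OF pushforward_fst_tangent[OF uv(1)] pushforward_fst_tangent[OF uv(2)]]
      F.g_sym[OF pushforward_snd_tangent[OF uv(1)] pushforward_snd_tangent[OF uv(2)]]
    by (simp add: twisted_metric_def)
next
  fix z u v w a c
  assume uv: "u \<in> tangent_space M z" "v \<in> tangent_space M z" "w \<in> tangent_space M z"
  show "g z (\<lambda>f. a * u f + c * v f) w = a * g z u w + c * g z v w"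
    using B.g_lincomb_left[OF pushforward_fst_tangent[OF uv(1)] pushforward_fst_tangent[OF uv(2)] pushforward_fst_tangent[OF uv(3)]]
      F.g_lincomb_left[OF pushforward_snd_tangent[OF uv(1)] pushforward_snd_tangent[OF uv(2)] pushforward_snd_tangent[OF uv(3)]]
    by (simp add: twisted_metric_def pushforward_lincomb algebra_simps)
next
  fix X Y assume X: "X \<in> vector_fields M" and Y: "Y \<in> vector_fields M"
  have smB: "(\<lambda>z. p\<^sub>B (V z) h) \<in> smooth_fun M" if "V \<in> vector_fields M" "h \<in> smooth_fun A\<^sub>B" for V h
    using M.vf_smooth[OF that(1) smooth_fun_fst[OF that(2)]] that(2) by (simp add: pushforward_def o_def)
  have smF: "(\<lambda>z. p\<^sub>F (V z) h) \<in> smooth_fun M" if "V \<in> vector_fields M" "h \<in> smooth_fun A\<^sub>F" for V h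
    using M.vf_smooth[OF that(1) smooth_fun_snd[OF that(2)]] that(2) by (simp add: pushforward_def o_def)
  note tB = pushforward_fst_tangent[OF M.vf_tangent] and tF = pushforward_snd_tangent[OF M.vf_tangent]
  have cont: "continuous_on UNIV (fst :: 'a \<times> 'b \<Rightarrow> 'a)" "continuous_on UNIV (snd :: 'a \<times> 'b \<Rightarrow> 'b)"
    by (intro continuous_intros)+
  have aB: "(\<lambda>z. g\<^sub>B (fst z) (p\<^sub>B (V z)) (Z (fst z))) \<in> smooth_fun M"
    if "V \<in> vector_fields M" "Z \<in> vector_fields A\<^sub>B" for V Z
    by (rule B.inner_along_field_smooth[OF M.smooth_manifold_axioms cont(1) _ tB[OF that(1)] _ that(2)])
      (use smooth_fun_fst smB[OF that(1)] in auto)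
  have aF: "(\<lambda>z. g\<^sub>F (snd z) (p\<^sub>F (V z)) (Z (snd z))) \<in> smooth_fun M"
    if "V \<in> vector_fields M" "Z \<in> vector_fields A\<^sub>F" for V Z
    by (rule F.inner_along_field_smooth[OF M.smooth_manifold_axioms cont(2) _ tF[OF that(1)] _ that(2)])
      (use smooth_fun_snd smF[OF that(1)] in auto)
  have "(\<lambda>z. g\<^sub>B (fst z) (p\<^sub>B (X z)) (p\<^sub>B (Y z))) \<in> smooth_fun M"
    by (rule B.inner_along_smooth[OF M.smooth_manifold_axioms cont(1) tB[OF X] tB[OF Y] aB[OF X] aB[OF Y]])
  moreover have "(\<lambda>z. g\<^sub>F (snd z) (p\<^sub>F (X z)) (p\<^sub>F (Y z))) \<in> smooth_fun M"
    by (rule F.inner_along_smooth[OF M.smooth_manifold_axioms cont(2) tF[OF X] tF[OF Y] aF[OF X] aF[OF Y]])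
  ultimately show "field_inner g X Y \<in> smooth_fun M"
    unfolding field_inner_def twisted_metric_def
    by (intro M.smooth_fun_add M.smooth_fun_mult M.smooth_fun_power b)
qed (rule prod_atlas_smooth)

sublocale G: semi_riemannian M g
  by unfold_locales (rule twisted_ssr)

lemma g_incl:
  assumes "u \<in> tangent_space A\<^sub>B (fst z)" "u' \<in> tangent_space A\<^sub>F (snd z)" "w \<in> tangent_space M z"
  shows "g z (\<lambda>f. incl_fst z u f + incl_snd z u' f) w
    = g\<^sub>B (fst z) u (p\<^sub>B w) + (b z)\<^sup>2 * g\<^sub>F (snd z) u' (p\<^sub>F w)"
  using pushforward_incl[OF assms(1,2)] by (simp add: twisted_metric_def pushforward_add)

section \<open>Rank and regular points of the twisted metric\<close>

lemma twisted_nondegenerate_at: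
  assumes bz: "b z \<noteq> 0" and v: "v \<in> tangent_space M z"
    and 0: "\<And>w. w \<in> tangent_space M z \<Longrightarrow> g z v w = 0"
  shows "v = (\<lambda>f. 0)"
proof (rule tangent_prod_eqI[OF v])
  have "p\<^sub>B v = (\<lambda>f. 0)"
  proof (rule B.nondegenerateD[OF pushforward_fst_tangent[OF v]])
    fix u assume u: "u \<in> tangent_space A\<^sub>B (fst z)"
    have "g z v (incl_fst z u) = g\<^sub>B (fst z) (p\<^sub>B v) u + (b z)\<^sup>2 * g\<^sub>F (snd z) (p\<^sub>F v) (\<lambda>f. 0)"
      using pushforward_incl[OF u F.tangent_space_zero] by (simp add: twisted_metric_def)
    moreover have "g\<^sub>F (snd z) (p\<^sub>F v) (\<lambda>f. 0) = 0"
      using F.g_scale_right[OF F.tangent_space_zero pushforward_snd_tangent[OF v], of 0] by simp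
    ultimately show "g\<^sub>B (fst z) (p\<^sub>B v) u = 0" using 0[OF incl_fst_tangent[OF u]] by simp
  qed
  then show "p\<^sub>B v = p\<^sub>B (\<lambda>f. 0)" by (simp add: pushforward_def)
  have "p\<^sub>F v = (\<lambda>f. 0)"
  proof (rule F.nondegenerateD[OF pushforward_snd_tangent[OF v]])
    fix u assume u: "u \<in> tangent_space A\<^sub>F (snd z)"
    have "g z v (incl_snd z u) = g\<^sub>B (fst z) (p\<^sub>B v) (\<lambda>f. 0) + (b z)\<^sup>2 * g\<^sub>F (snd z) (p\<^sub>F v) u"
      using pushforward_incl[OF B.tangent_space_zero u] by (simp add: twisted_metric_def)
    moreover have "g\<^sub>B (fst z) (p\<^sub>B v) (\<lambda>f. 0) = 0"
      using B.g_scale_right[OF B.tangent_space_zero pushforward_fst_tangent[OF v], of 0] by simp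
    ultimately show "g\<^sub>F (snd z) (p\<^sub>F v) u = 0" using 0[OF incl_snd_tangent[OF u]] bz by simp
  qed
  then show "p\<^sub>F v = p\<^sub>F (\<lambda>f. 0)" by (simp add: pushforward_def)
qed simp

text \<open>At a zero of \<open>b\<close> the metric is the pullback of \<open>g\<^sub>B\<close>, so
  the image of \<open>flat\<close> is parametrised by the tangent space of the first factor.\<close>

lemma metric_rank_zero:
  assumes bz: "b z = 0"
  shows "metric_rank M g z = DIM('m)"
proof -
  obtain U \<phi> where U: "(U, \<phi>) \<in> A\<^sub>B" "fst z \<in> U" using B.chart_cover by blast
  define d where "d = B.chart_deriv U \<phi> (fst z)"
  have d: "d e \<in> tangent_space A\<^sub>B (fst z)" for e using B.chart_deriv_tangent[OF U] by (simp add: d_def)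
  have lin: "d (a *\<^sub>R x + c *\<^sub>R y) = (\<lambda>f. a * d x f + c * d y f)" for a c x y
    unfolding d_def by (rule B.chart_deriv_lincomb[OF U])
  define L where "L e = (\<lambda>w. if w \<in> tangent_space M z then g\<^sub>B (fst z) (d e) (p\<^sub>B w) else 0)" for e
  have L: "L (a *\<^sub>R x + c *\<^sub>R y) = (\<lambda>w. a * L x w + c * L y w)" for a c x y
    using B.g_lincomb_left[OF d d pushforward_fst_tangent] by (auto simp: L_def lin)
  show ?thesis
  proof (rule G.metric_rank_eqI[of L])
    show "L (x + y) = (\<lambda>w. L x w + L y w)" for x y using L[of 1 x 1 y] by simp
    show "L (c *\<^sub>R x) = (\<lambda>w. c * L x w)" for c x using L[of c x 0 x] by simp
    show "x = 0" if Lx: "L x = (\<lambda>w. 0)" for x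
    proof -
      have "d x = (\<lambda>f. 0)"
      proof (rule B.nondegenerateD[OF d])
        fix u assume u: "u \<in> tangent_space A\<^sub>B (fst z)"
        show "g\<^sub>B (fst z) (d x) u = 0"
          using fun_cong[OF Lx, of "incl_fst z u"] incl_fst_tangent[OF u] pushforward_incl(1)[OF u F.tangent_space_zero]
          by (simp add: L_def)
      qed
      moreover have "d 0 = (\<lambda>f. 0)" using lin[of 0 0 0 0] by simp
      ultimately show ?thesis using B.chart_deriv_inj[OF U, of x 0] by (simp add: d_def)
    qed
    show "flat M g z ` tangent_space M z = range L"
    proof
      show "flat M g z ` tangent_space M z \<subseteq> range L"
      proof clarify
        fix v assume v: "v \<in> tangent_space M z"
        obtain e where "p\<^sub>B v = d e"
          using B.tangent_chart[OF U pushforward_fst_tangent[OF v]] unfolding d_def by blast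
        then have "flat M g z v = L e" using bz by (auto simp: flat_def L_def twisted_metric_def)
        then show "flat M g z v \<in> range L" by blast
      qed
      show "range L \<subseteq> flat M g z ` tangent_space M z"
      proof clarify
        fix e
        have "L e = flat M g z (incl_fst z (d e))"
          using bz pushforward_incl(1)[OF d F.tangent_space_zero] by (auto simp: flat_def L_def twisted_metric_def)
        then show "L e \<in> flat M g z ` tangent_space M z" using incl_fst_tangent[OF d] by blast
      qed
    qed
  qed
qed

text \<open>At a point with b \<noteq> 0 the metric is non-degenerate on a whole neighbourhood and
  the rank is maximal there. If \<open>N\<close> has no such point, then \<open>b\<close> vanishes
  on \<open>N\<close> and the rank is that of \<open>g\<^sub>B\<close> throughout
  \<open>N\<close>.\<close>

lemma regular_points_dense:
  assumes "open N" "N \<noteq> {}"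
  shows "N \<inter> regular_points M g \<noteq> {}"
proof (cases "\<exists>z\<in>N. b z \<noteq> 0")
  case True
  then obtain z where z: "z \<in> N" "b z \<noteq> 0" by blast
  have "open (b -` (- {0}))"
    using M.smooth_fun_continuous[OF b] by (intro open_vimage) auto
  then have "\<forall>\<^sub>F w in nhds z. b w \<noteq> 0"
    using eventually_nhds_in_open[of "b -` (- {0})" z] z(2) by (auto elim: eventually_mono)
  then have "\<forall>\<^sub>F w in nhds z. metric_rank M g w = metric_rank M g z"
    by (rule eventually_mono) (use G.metric_rank_nondegenerate[OF twisted_nondegenerate_at] z(2) in auto)
  then show ?thesis using z(1) by (auto simp: regular_points_def)
next
  case False
  obtain z where z: "z \<in> N" using assms(2) by blast
  have "\<forall>\<^sub>F w in nhds z. metric_rank M g w = metric_rank M g z"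
    using eventually_nhds_in_open[OF assms(1) z] by (rule eventually_mono) (use False z metric_rank_zero in auto)
  then show ?thesis using z by (auto simp: regular_points_def)
qed

text \<open>\<open>\<omega>\<close> is dual to the vector with components \<open>a\<close> and \<open>c / b\<close>. Because \<open>c\<close> vanishes with \<open>b\<close>
  and \<open>inverse 0 = 0\<close>, this is also true on the zero set of \<open>b\<close>, where \<open>g\<close> degenerates.\<close>

definition components :: "('a \<times> 'b) form1 \<Rightarrow> ('a \<times> 'b \<Rightarrow> 'a tvec) \<Rightarrow> ('a \<times> 'b \<Rightarrow> 'b tvec) \<Rightarrow> bool" where
  "components \<omega> a c \<longleftrightarrow> M.tensorial \<omega> \<and> (\<forall>Z\<in>vector_fields M. \<omega> Z \<in> smooth_fun M) \<and>
    (\<forall>z. a z \<in> tangent_space A\<^sub>B (fst z)) \<and> (\<forall>z. c z \<in> tangent_space A\<^sub>F (snd z)) \<and>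
    (\<forall>z. \<forall>Z\<in>vector_fields A\<^sub>B. \<omega> (l\<^sub>B Z) z = g\<^sub>B (fst z) (a z) (Z (fst z))) \<and>
    (\<forall>z. \<forall>W\<in>vector_fields A\<^sub>F. \<omega> (l\<^sub>F W) z = b z * g\<^sub>F (snd z) (c z) (W (snd z))) \<and>
    (\<forall>z. b z = 0 \<longrightarrow> c z = (\<lambda>f. 0)) \<and>
    (\<forall>W\<in>vector_fields A\<^sub>F. (\<lambda>z. g\<^sub>F (snd z) (c z) (W (snd z))) \<in> smooth_fun M)"

section \<open>Contraction of forms with components\<close>

lemma componentsD:
  assumes "components \<omega> a c"
  shows "M.tensorial \<omega>" "Z \<in> vector_fields M \<Longrightarrow> \<omega> Z \<in> smooth_fun M"
    "a z \<in> tangent_space A\<^sub>B (fst z)" "c z \<in> tangent_space A\<^sub>F (snd z)"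
    "X \<in> vector_fields A\<^sub>B \<Longrightarrow> \<omega> (l\<^sub>B X) z = g\<^sub>B (fst z) (a z) (X (fst z))"
    "W \<in> vector_fields A\<^sub>F \<Longrightarrow> \<omega> (l\<^sub>F W) z = b z * g\<^sub>F (snd z) (c z) (W (snd z))"
    "b z = 0 \<Longrightarrow> c z = (\<lambda>f. 0)"
    "W \<in> vector_fields A\<^sub>F \<Longrightarrow> (\<lambda>z. g\<^sub>F (snd z) (c z) (W (snd z))) \<in> smooth_fun M"
  using assms unfolding components_def by blast+

definition dual_vector :: "('a \<times> 'b \<Rightarrow> 'a tvec) \<Rightarrow> ('a \<times> 'b \<Rightarrow> 'b tvec) \<Rightarrow> ('a \<times> 'b) vfield" where
  "dual_vector a c z = (\<lambda>f. incl_fst z (a z) f + incl_snd z (\<lambda>f. inverse (b z) * c z f) f)"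

lemma dual_vector:
  assumes \<omega>: "components \<omega> a c"
  shows "dual_vector a c z \<in> tangent_space M z" "form_at M \<omega> z = flat M g z (dual_vector a c z)"
proof -
  note a = componentsD(3)[OF \<omega>, of z] and c = componentsD(4)[OF \<omega>, of z]
  note c' = F.tangent_space_scale[OF c, of "inverse (b z)"]
  show "dual_vector a c z \<in> tangent_space M z" unfolding dual_vector_def
    by (intro M.tangent_space_add incl_fst_tangent incl_snd_tangent a c')
  show "form_at M \<omega> z = flat M g z (dual_vector a c z)"
  proof
    fix w
    show "form_at M \<omega> z w = flat M g z (dual_vector a c z) w"
    proof (cases "w \<in> tangent_space M z")
      case True
      obtain Z where Z: "Z \<in> vector_fields A\<^sub>B" "Z (fst z) = p\<^sub>B w"
        using B.tangent_field[OF pushforward_fst_tangent[OF True]] by blast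
      obtain W where W: "W \<in> vector_fields A\<^sub>F" "W (snd z) = p\<^sub>F w"
        using F.tangent_field[OF pushforward_snd_tangent[OF True]] by blast
      have w: "w = (\<lambda>f. l\<^sub>B Z z f + l\<^sub>F W z f)"
        unfolding lift_fst_incl lift_snd_incl Z(2) W(2) by (rule ext) (rule tangent_decomposition[OF True])
      have "form_at M \<omega> z w = \<omega> (\<lambda>z f. l\<^sub>B Z z f + l\<^sub>F W z f) z"
        unfolding w by (rule M.form_at_field[OF componentsD(1)[OF \<omega>] M.vf_add[OF lift_fst_vf[OF Z(1)] lift_snd_vf[OF W(1)]]])
      also have "\<dots> = g\<^sub>B (fst z) (a z) (p\<^sub>B w) + b z * g\<^sub>F (snd z) (c z) (p\<^sub>F w)"
        using M.tensorialD(1)[OF componentsD(1)[OF \<omega>] lift_fst_vf[OF Z(1)] lift_snd_vf[OF W(1)]]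
          componentsD(5)[OF \<omega> Z(1), of z] componentsD(6)[OF \<omega> W(1), of z] Z(2) W(2) by simp
      \<comment> \<open>Off the zero set b = b^2 / b; at a zero both sides carry a vanishing
        factor.\<close>
      also have "b z * g\<^sub>F (snd z) (c z) (p\<^sub>F w) = (b z)\<^sup>2 * g\<^sub>F (snd z) (\<lambda>f. inverse (b z) * c z f) (p\<^sub>F w)"
        using F.g_scale_left[OF c pushforward_snd_tangent[OF True], of "inverse (b z)"]
        by (cases "b z = 0") (auto simp: power2_eq_square)
      finally show ?thesis
        using g_incl[OF a c' True] True by (simp add: flat_def dual_vector_def)
    qed (simp add: form_at_def flat_def)
  qed
qed

lemma contraction_components:
  assumes \<omega>: "components \<omega> a c" and \<tau>: "components \<tau> a' c'"
  shows "contraction M g \<omega> \<tau> z = g\<^sub>B (fst z) (a z) (a' z) + g\<^sub>F (snd z) (c z) (c' z)"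
proof -
  have cont: "continuous_on UNIV (fst :: 'a \<times> 'b \<Rightarrow> 'a)" "continuous_on UNIV (snd :: 'a \<times> 'b \<Rightarrow> 'b)"
    by (intro continuous_intros)+
  have smB: "(\<lambda>z. g\<^sub>B (fst z) (a z) (Z (fst z))) \<in> smooth_fun M"
    if "components \<omega> a c" "Z \<in> vector_fields A\<^sub>B" for Z \<omega> a c
  proof -
    have "\<omega> (l\<^sub>B Z) = (\<lambda>z. g\<^sub>B (fst z) (a z) (Z (fst z)))"
      by (rule ext) (rule componentsD(5)[OF that])
    then show ?thesis using componentsD(2)[OF that(1) lift_fst_vf[OF that(2)]] by simp
  qed
  have "contraction M g \<omega> \<tau> = (\<lambda>z. g\<^sub>B (fst z) (a z) (a' z) + g\<^sub>F (snd z) (c z) (c' z))"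
  proof (rule G.contraction_eqI[OF _ _ regular_points_dense])
    show "(\<lambda>z. g\<^sub>B (fst z) (a z) (a' z) + g\<^sub>F (snd z) (c z) (c' z)) \<in> smooth_fun M"
    proof (rule M.smooth_fun_add)
      show "(\<lambda>z. g\<^sub>B (fst z) (a z) (a' z)) \<in> smooth_fun M"
        by (rule B.inner_along_smooth[OF M.smooth_manifold_axioms cont(1) componentsD(3)[OF \<omega>]
              componentsD(3)[OF \<tau>] smB[OF \<omega>] smB[OF \<tau>]])
      show "(\<lambda>z. g\<^sub>F (snd z) (c z) (c' z)) \<in> smooth_fun M"
        by (rule F.inner_along_smooth[OF M.smooth_manifold_axioms cont(2) componentsD(4)[OF \<omega>]
              componentsD(4)[OF \<tau>] componentsD(8)[OF \<omega>] componentsD(8)[OF \<tau>]])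
    qed
    fix z
    note ta = componentsD(3)[OF \<omega>, of z] componentsD(3)[OF \<tau>, of z]
    note tc = componentsD(4)[OF \<omega>, of z] componentsD(4)[OF \<tau>, of z]
    have "cometric M g z (form_at M \<omega> z) (form_at M \<tau> z) = g z (dual_vector a c z) (dual_vector a' c' z)"
      unfolding dual_vector(2)[OF \<omega>] dual_vector(2)[OF \<tau>]
      by (rule G.cometric_flat[OF dual_vector(1)[OF \<omega>] dual_vector(1)[OF \<tau>]])
    also have "\<dots> = g\<^sub>B (fst z) (a z) (p\<^sub>B (dual_vector a' c' z))
        + (b z)\<^sup>2 * g\<^sub>F (snd z) (\<lambda>f. inverse (b z) * c z f) (p\<^sub>F (dual_vector a' c' z))"
      unfolding dual_vector_def[of a c]
      by (rule g_incl[OF ta(1) F.tangent_space_scale[OF tc(1)] dual_vector(1)[OF \<tau>]])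
    also have "p\<^sub>B (dual_vector a' c' z) = a' z"
      using pushforward_incl[OF ta(2) F.tangent_space_scale[OF tc(2)]]
      by (simp add: dual_vector_def pushforward_add)
    also have "p\<^sub>F (dual_vector a' c' z) = (\<lambda>f. inverse (b z) * c' z f)"
      using pushforward_incl[OF ta(2) F.tangent_space_scale[OF tc(2)]]
      by (simp add: dual_vector_def pushforward_add)
    also have "(b z)\<^sup>2 * g\<^sub>F (snd z) (\<lambda>f. inverse (b z) * c z f) (\<lambda>f. inverse (b z) * c' z f) = g\<^sub>F (snd z) (c z) (c' z)"
    \<comment> \<open>At a zero the left side is 0 because of b^2 and the right side because
      \<open>c\<close> is 0. This is the place where the vanishing of \<open>c\<close> decides the
      value of the contraction.\<close>
    proof (cases "b z = 0")
      case True
      then show ?thesis using componentsD(7)[OF \<omega> True] F.g_zero_left[OF tc(2)] by simp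
    next
      case False
      then show ?thesis
        using F.g_scale_left[OF tc(1) F.tangent_space_scale[OF tc(2)], of "inverse (b z)" "inverse (b z)"]
          F.g_scale_right[OF tc(2,1), of "inverse (b z)"] by (simp add: power2_eq_square field_simps)
    qed
    finally show "cometric M g z (form_at M \<omega> z) (form_at M \<tau> z) = g\<^sub>B (fst z) (a z) (a' z) + g\<^sub>F (snd z) (c z) (c' z)" .
  qed
  then show ?thesis by simp
qed

text \<open>The gradient of \<open>b\<close> along the slice through \<open>z\<close>, taken with
  the metric of the factor. Unlike a gradient for the twisted metric it is available on the zero set
  of \<open>b\<close> too.\<close>

definition grad\<^sub>B :: "'a \<times> 'b \<Rightarrow> 'a tvec" where
  "grad\<^sub>B z = B.sharp (fst z) (\<lambda>u. incl_fst z u b)"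

definition grad\<^sub>F :: "'a \<times> 'b \<Rightarrow> 'b tvec" where
  "grad\<^sub>F z = F.sharp (snd z) (\<lambda>u. incl_snd z u b)"

lemma grad\<^sub>B: "grad\<^sub>B z \<in> tangent_space A\<^sub>B (fst z)"
    "u \<in> tangent_space A\<^sub>B (fst z) \<Longrightarrow> g\<^sub>B (fst z) (grad\<^sub>B z) u = incl_fst z u b"
  unfolding grad\<^sub>B_def by (intro B.sharp; simp add: incl_fst_def pushforward_lincomb)+

lemma grad\<^sub>F: "grad\<^sub>F z \<in> tangent_space A\<^sub>F (snd z)"
    "u \<in> tangent_space A\<^sub>F (snd z) \<Longrightarrow> g\<^sub>F (snd z) (grad\<^sub>F z) u = incl_snd z u b"
  unfolding grad\<^sub>F_def by (intro F.sharp; simp add: incl_snd_def pushforward_lincomb)+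

lemma grad_field:
  assumes "X \<in> vector_fields A\<^sub>B" "U \<in> vector_fields A\<^sub>F"
  shows "g\<^sub>B (fst z) (grad\<^sub>B z) (X (fst z)) = l\<^sub>B X z b" "g\<^sub>F (snd z) (grad\<^sub>F z) (U (snd z)) = l\<^sub>F U z b"
  using grad\<^sub>B(2)[OF B.vf_tangent[OF assms(1)]] grad\<^sub>F(2)[OF F.vf_tangent[OF assms(2)]]
  by (simp_all add: lift_fst_incl lift_snd_incl)

text \<open>Every tangent vector annihilates \<open>b\<close> at a zero of \<open>b\<close>, so the
  gradient is orthogonal to the whole tangent space of the factor.\<close>

lemma grad\<^sub>F_zero: "b z = 0 \<Longrightarrow> grad\<^sub>F z = (\<lambda>f. 0)"
  by (rule F.nondegenerateD[OF grad\<^sub>F(1)]) (simp add: grad\<^sub>F(2) b_zero incl_snd_tangent)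

text \<open>Restricted differentials of \<open>b\<close> become flats of partial gradients, which is
  the form in which \<open>cometric\<close> can be evaluated.\<close>

lemma pullback_fst: "pullback_covec A\<^sub>B M (\<lambda>x. (x, q)) p (differential M b (p, q)) = flat A\<^sub>B g\<^sub>B p (grad\<^sub>B (p, q))"
  using grad\<^sub>B(2)[of _ "(p, q)"] incl_fst_tangent[of _ "(p, q)"]
  by (auto simp: pullback_covec_def flat_def differential_def incl_fst_def)

lemma pullback_snd: "pullback_covec A\<^sub>F M (\<lambda>y. (p, y)) q (differential M b (p, q)) = flat A\<^sub>F g\<^sub>F q (grad\<^sub>F (p, q))"
  using grad\<^sub>F(2)[of _ "(p, q)"] incl_snd_tangent[of _ "(p, q)"]
  by (auto simp: pullback_covec_def flat_def differential_def incl_snd_def)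

section \<open>Koszul forms of lifts\<close>

lemma field_inner_lift:
  assumes X: "X \<in> vector_fields A\<^sub>B" and Y: "Y \<in> vector_fields A\<^sub>B"
    and V: "V \<in> vector_fields A\<^sub>F" and W: "W \<in> vector_fields A\<^sub>F"
  shows "field_inner g (l\<^sub>B X) (l\<^sub>B Y) = (\<lambda>z. field_inner g\<^sub>B X Y (fst z))"
    "field_inner g (l\<^sub>B X) (l\<^sub>F V) = (\<lambda>z. 0)" "field_inner g (l\<^sub>F V) (l\<^sub>B X) = (\<lambda>z. 0)"
    "field_inner g (l\<^sub>F V) (l\<^sub>F W) = (\<lambda>z. (b z)\<^sup>2 * field_inner g\<^sub>F V W (snd z))"
proof -
  have z: "g\<^sub>B p u (\<lambda>f. 0) = 0" if "u \<in> tangent_space A\<^sub>B p" for p u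
    using B.g_scale_right[OF B.tangent_space_zero that, of 0] by simp
  have z': "g\<^sub>F p u (\<lambda>f. 0) = 0" if "u \<in> tangent_space A\<^sub>F p" for p u
    using F.g_scale_right[OF F.tangent_space_zero that, of 0] by simp
  show "field_inner g (l\<^sub>B X) (l\<^sub>B Y) = (\<lambda>z. field_inner g\<^sub>B X Y (fst z))"
    "field_inner g (l\<^sub>B X) (l\<^sub>F V) = (\<lambda>z. 0)" "field_inner g (l\<^sub>F V) (l\<^sub>B X) = (\<lambda>z. 0)"
    "field_inner g (l\<^sub>F V) (l\<^sub>F W) = (\<lambda>z. (b z)\<^sup>2 * field_inner g\<^sub>F V W (snd z))"
    using X Y V W
    by (simp_all add: fun_eq_iff field_inner_def twisted_metric_def pushforward_lift[OF X V] pushforward_lift[OF Y W]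
        z z' B.g_zero_left F.g_zero_left B.vf_tangent F.vf_tangent)
qed

lemma field_inner_zero: "X \<in> vector_fields M \<Longrightarrow> field_inner g X (\<lambda>z f. 0) = (\<lambda>z. 0)"
  using G.field_inner_scale_right[OF _ M.vf_zero, of X "\<lambda>z. 0"] by simp

lemma lift_on_warped:
  assumes X: "X \<in> vector_fields A\<^sub>B" and U: "U \<in> vector_fields A\<^sub>F" and h: "h \<in> smooth_fun A\<^sub>F"
  shows "l\<^sub>B X z (\<lambda>z. (b z)\<^sup>2 * h (snd z)) = 2 * b z * l\<^sub>B X z b * h (snd z)"
    "l\<^sub>F U z (\<lambda>z. (b z)\<^sup>2 * h (snd z)) = 2 * b z * l\<^sub>F U z b * h (snd z) + (b z)\<^sup>2 * U (snd z) h"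
  using M.tv_mult[OF M.vf_tangent[OF lift_fst_vf[OF X]] M.smooth_fun_power[OF b] smooth_fun_snd[OF h], of z 2]
    M.tv_mult[OF M.vf_tangent[OF lift_snd_vf[OF U]] M.smooth_fun_power[OF b] smooth_fun_snd[OF h], of z 2]
    M.tv_power[OF M.vf_tangent[OF lift_fst_vf[OF X]] b, of z 2] M.tv_power[OF M.vf_tangent[OF lift_snd_vf[OF U]] b, of z 2]
  by (simp_all add: lift_fst_on_snd[OF X h] lift_snd_on_snd[OF h])

text \<open>Mixed inner products and mixed brackets vanish, so first derivatives of \<open>b\<close>
  enter only by differentiating b^2; the 2 produced there cancels the 1/2 in the Koszul
  form.\<close>

lemma koszul_lift:
  assumes X: "X \<in> vector_fields A\<^sub>B" and Y: "Y \<in> vector_fields A\<^sub>B" and Z: "Z \<in> vector_fields A\<^sub>B"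
    and U: "U \<in> vector_fields A\<^sub>F" and V: "V \<in> vector_fields A\<^sub>F" and W: "W \<in> vector_fields A\<^sub>F"
  shows "koszul g (l\<^sub>B X) (l\<^sub>B Y) (l\<^sub>B Z) = (\<lambda>z. koszul g\<^sub>B X Y Z (fst z))"
    and "koszul g (l\<^sub>B X) (l\<^sub>B Y) (l\<^sub>F W) = (\<lambda>z. 0)"
    and "koszul g (l\<^sub>B X) (l\<^sub>F W) (l\<^sub>B Y) = (\<lambda>z. 0)"
    and "koszul g (l\<^sub>F W) (l\<^sub>B X) (l\<^sub>B Y) = (\<lambda>z. 0)"
    and "koszul g (l\<^sub>B X) (l\<^sub>F V) (l\<^sub>F W) = (\<lambda>z. b z * l\<^sub>B X z b * field_inner g\<^sub>F V W (snd z))"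
    and "koszul g (l\<^sub>F V) (l\<^sub>B X) (l\<^sub>F W) = (\<lambda>z. b z * l\<^sub>B X z b * field_inner g\<^sub>F V W (snd z))"
    and "koszul g (l\<^sub>F V) (l\<^sub>F W) (l\<^sub>B X) = (\<lambda>z. - (b z * l\<^sub>B X z b * field_inner g\<^sub>F V W (snd z)))"
    and "koszul g (l\<^sub>F U) (l\<^sub>F V) (l\<^sub>F W) = (\<lambda>z. (b z)\<^sup>2 * koszul g\<^sub>F U V W (snd z)
      + b z * (l\<^sub>F U z b * field_inner g\<^sub>F V W (snd z) + l\<^sub>F V z b * field_inner g\<^sub>F U W (snd z)
        - l\<^sub>F W z b * field_inner g\<^sub>F U V (snd z)))"
proof -
  note vfs = X Y Z U V W B.lie_bracket_vf F.lie_bracket_vf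
  note zero = M.tv_const[OF M.vf_tangent[OF lift_fst_vf]] M.tv_const[OF M.vf_tangent[OF lift_snd_vf]]
  note rules = koszul_def fun_eq_iff lie_bracket_lift_fst lie_bracket_lift_snd lie_bracket_lift_mixed
    field_inner_lift(1)[OF _ _ U U] field_inner_lift(2,3)[OF _ X _ U] field_inner_lift(4)[OF X X]
    field_inner_zero lift_fst_vf lift_snd_vf zero B.field_inner_smooth F.field_inner_smooth
    lift_fst_on_fst lift_snd_on_fst lift_on_warped(1)[OF _ U] lift_on_warped(2)[OF X]
    lift_snd_on_fst[OF _ B.field_inner_smooth] lift_fst_on_fst[OF B.field_inner_smooth]
    lift_on_warped(1)[OF _ U F.field_inner_smooth] lift_on_warped(2)[OF X _ F.field_inner_smooth]
  show "koszul g (l\<^sub>B X) (l\<^sub>B Y) (l\<^sub>B Z) = (\<lambda>z. koszul g\<^sub>B X Y Z (fst z))"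
    by (simp add: rules vfs)
  show "koszul g (l\<^sub>B X) (l\<^sub>B Y) (l\<^sub>F W) = (\<lambda>z. 0)"
    by (simp add: rules vfs)
  show "koszul g (l\<^sub>B X) (l\<^sub>F W) (l\<^sub>B Y) = (\<lambda>z. 0)"
    by (simp add: rules vfs)
  show "koszul g (l\<^sub>F W) (l\<^sub>B X) (l\<^sub>B Y) = (\<lambda>z. 0)"
    by (simp add: rules vfs)
  show "koszul g (l\<^sub>B X) (l\<^sub>F V) (l\<^sub>F W) = (\<lambda>z. b z * l\<^sub>B X z b * field_inner g\<^sub>F V W (snd z))"
    by (simp add: rules vfs F.field_inner_sym[OF W V] F.lie_bracket_swap[of W V])
  show "koszul g (l\<^sub>F V) (l\<^sub>B X) (l\<^sub>F W) = (\<lambda>z. b z * l\<^sub>B X z b * field_inner g\<^sub>F V W (snd z))"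
    by (simp add: rules vfs F.field_inner_sym[OF W V])
  show "koszul g (l\<^sub>F V) (l\<^sub>F W) (l\<^sub>B X) = (\<lambda>z. - (b z * l\<^sub>B X z b * field_inner g\<^sub>F V W (snd z)))"
    by (simp add: rules vfs)
  show "koszul g (l\<^sub>F U) (l\<^sub>F V) (l\<^sub>F W) = (\<lambda>z. (b z)\<^sup>2 * koszul g\<^sub>F U V W (snd z)
      + b z * (l\<^sub>F U z b * field_inner g\<^sub>F V W (snd z) + l\<^sub>F V z b * field_inner g\<^sub>F U W (snd z)
        - l\<^sub>F W z b * field_inner g\<^sub>F U V (snd z)))"
  proof
    fix z
    have e: "l\<^sub>F R z (field_inner g (l\<^sub>F S) (l\<^sub>F T)) = 2 * b z * l\<^sub>F R z b * field_inner g\<^sub>F S T (snd z)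
        + (b z)\<^sup>2 * R (snd z) (field_inner g\<^sub>F S T)"
      and i: "field_inner g (l\<^sub>F R) (lie_bracket (l\<^sub>F S) (l\<^sub>F T)) z = (b z)\<^sup>2 * field_inner g\<^sub>F R (lie_bracket S T) (snd z)"
      if "R \<in> vector_fields A\<^sub>F" "S \<in> vector_fields A\<^sub>F" "T \<in> vector_fields A\<^sub>F" for R S T
      using that by (simp_all add: rules vfs)
    show "koszul g (l\<^sub>F U) (l\<^sub>F V) (l\<^sub>F W) z = (b z)\<^sup>2 * koszul g\<^sub>F U V W (snd z)
      + b z * (l\<^sub>F U z b * field_inner g\<^sub>F V W (snd z) + l\<^sub>F V z b * field_inner g\<^sub>F U W (snd z)
        - l\<^sub>F W z b * field_inner g\<^sub>F U V (snd z))"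
      unfolding koszul_def e[OF U V W] e[OF V W U] e[OF W U V] i[OF U V W] i[OF V W U] i[OF W U V]
      by (simp add: F.field_inner_sym[OF W U] algebra_simps add_divide_distrib diff_divide_distrib)
  qed
qed

section \<open>The semi-symmetric metric Koszul form\<close>

text \<open>Since \<open>P\<close> comes from F, the term g(Y, P) g(X, Z) needs its second field on
  F, and g(X, Y) g(P, Z) its third. Each inner product on F brings a factor b^2, hence b^4 when all
  three fields come from F.\<close>

lemma semi_symmetric_koszul_lift:
  assumes P: "P \<in> vector_fields A\<^sub>F"
    and X: "X \<in> vector_fields A\<^sub>B" and Y: "Y \<in> vector_fields A\<^sub>B" and Z: "Z \<in> vector_fields A\<^sub>B"
    and U: "U \<in> vector_fields A\<^sub>F" and V: "V \<in> vector_fields A\<^sub>F" and W: "W \<in> vector_fields A\<^sub>F"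
  shows "semi_symmetric_koszul g (l\<^sub>F P) (l\<^sub>B X) (l\<^sub>B Y) (l\<^sub>B Z) = (\<lambda>z. koszul g\<^sub>B X Y Z (fst z))"
    and "semi_symmetric_koszul g (l\<^sub>F P) (l\<^sub>B X) (l\<^sub>B Y) (l\<^sub>F W)
      = (\<lambda>z. - ((b z)\<^sup>2 * field_inner g\<^sub>B X Y (fst z) * field_inner g\<^sub>F P W (snd z)))"
    and "semi_symmetric_koszul g (l\<^sub>F P) (l\<^sub>B X) (l\<^sub>F W) (l\<^sub>B Y)
      = (\<lambda>z. (b z)\<^sup>2 * field_inner g\<^sub>F W P (snd z) * field_inner g\<^sub>B X Y (fst z))"
    and "semi_symmetric_koszul g (l\<^sub>F P) (l\<^sub>F W) (l\<^sub>B X) (l\<^sub>B Y) = (\<lambda>z. 0)"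
    and "semi_symmetric_koszul g (l\<^sub>F P) (l\<^sub>B X) (l\<^sub>F V) (l\<^sub>F W) = (\<lambda>z. b z * l\<^sub>B X z b * field_inner g\<^sub>F V W (snd z))"
    and "semi_symmetric_koszul g (l\<^sub>F P) (l\<^sub>F V) (l\<^sub>B X) (l\<^sub>F W) = (\<lambda>z. b z * l\<^sub>B X z b * field_inner g\<^sub>F V W (snd z))"
    and "semi_symmetric_koszul g (l\<^sub>F P) (l\<^sub>F V) (l\<^sub>F W) (l\<^sub>B X) = (\<lambda>z. - (b z * l\<^sub>B X z b * field_inner g\<^sub>F V W (snd z)))"
    and "semi_symmetric_koszul g (l\<^sub>F P) (l\<^sub>F U) (l\<^sub>F V) (l\<^sub>F W) = (\<lambda>z. (b z)\<^sup>2 * koszul g\<^sub>F U V W (snd z)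
      + b z * (l\<^sub>F U z b * field_inner g\<^sub>F V W (snd z) + l\<^sub>F V z b * field_inner g\<^sub>F U W (snd z)
        - l\<^sub>F W z b * field_inner g\<^sub>F U V (snd z))
      + (b z)^4 * (field_inner g\<^sub>F V P (snd z) * field_inner g\<^sub>F U W (snd z)
        - field_inner g\<^sub>F U V (snd z) * field_inner g\<^sub>F P W (snd z)))"
  unfolding semi_symmetric_koszul_def koszul_lift[OF X Y Z U V W]
  by (simp_all add: field_inner_lift(1)[OF _ _ P P] field_inner_lift(2,3)[OF _ X _ P] field_inner_lift(4)[OF X X]
      P X Y Z U V W fun_eq_iff algebra_simps eval_nat_numeral)

text \<open>\<open>k W\<close> is the value on the lift of \<open>W\<close> after division by
  \<open>b\<close>. It is passed as an explicit function because the form alone does not determine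
  it on the zero set of \<open>b\<close>.\<close>

lemma componentsI:
  assumes P: "P \<in> vector_fields A\<^sub>F" and E: "E \<in> vector_fields M" "E' \<in> vector_fields M"
    and "\<And>z. a z \<in> tangent_space A\<^sub>B (fst z)" "\<And>z. c z \<in> tangent_space A\<^sub>F (snd z)"
    and "\<And>z Z. Z \<in> vector_fields A\<^sub>B \<Longrightarrow> semi_symmetric_koszul g (l\<^sub>F P) E E' (l\<^sub>B Z) z = g\<^sub>B (fst z) (a z) (Z (fst z))"
    and "\<And>z W. W \<in> vector_fields A\<^sub>F \<Longrightarrow> semi_symmetric_koszul g (l\<^sub>F P) E E' (l\<^sub>F W) z = b z * k W z"
    and "\<And>z W. W \<in> vector_fields A\<^sub>F \<Longrightarrow> g\<^sub>F (snd z) (c z) (W (snd z)) = k W z"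
    and "\<And>z. b z = 0 \<Longrightarrow> c z = (\<lambda>f. 0)"
    and "\<And>W. W \<in> vector_fields A\<^sub>F \<Longrightarrow> k W \<in> smooth_fun M"
  shows "components (semi_symmetric_koszul g (l\<^sub>F P) E E') a c"
  unfolding components_def
  using assms(4-9) G.tensorial_semi_symmetric_koszul[OF lift_snd_vf[OF P] E]
    G.semi_symmetric_koszul_smooth[OF lift_snd_vf[OF P] E] assms(10)
  by simp

section \<open>Components of the forms of two lifts\<close>

lemma lift_fst_b_smooth: "X \<in> vector_fields A\<^sub>B \<Longrightarrow> (\<lambda>z. l\<^sub>B X z b) \<in> smooth_fun M"
  by (rule M.vf_smooth[OF lift_fst_vf b])

lemma lift_snd_b_smooth: "U \<in> vector_fields A\<^sub>F \<Longrightarrow> (\<lambda>z. l\<^sub>F U z b) \<in> smooth_fun M"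
  by (rule M.vf_smooth[OF lift_snd_vf b])

lemma lift_fst_b_zero: "X \<in> vector_fields A\<^sub>B \<Longrightarrow> b z = 0 \<Longrightarrow> l\<^sub>B X z b = 0"
  by (rule b_zero[OF _ M.vf_tangent[OF lift_fst_vf]])

lemma lift_snd_b_zero: "U \<in> vector_fields A\<^sub>F \<Longrightarrow> b z = 0 \<Longrightarrow> l\<^sub>F U z b = 0"
  by (rule b_zero[OF _ M.vf_tangent[OF lift_snd_vf]])

text \<open>Dividing -b^2 g_B(X, Y) g_F(P, W) by \<open>b\<close> leaves the inner product of
  \<open>W\<close> with a multiple of \<open>P\<close>; the remaining factor \<open>b\<close> makes
  that vector vanish with \<open>b\<close>.\<close>

lemma components_fst_fst:
  assumes P: "P \<in> vector_fields A\<^sub>F" and X: "X \<in> vector_fields A\<^sub>B" and Y: "Y \<in> vector_fields A\<^sub>B"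
  shows "components (semi_symmetric_koszul g (l\<^sub>F P) (l\<^sub>B X) (l\<^sub>B Y)) (\<lambda>z. B.connection X Y (fst z))
    (\<lambda>z f. - (b z * field_inner g\<^sub>B X Y (fst z)) * P (snd z) f)"
proof (rule componentsI[OF P lift_fst_vf[OF X] lift_fst_vf[OF Y],
    where k="\<lambda>W z. - (b z * field_inner g\<^sub>B X Y (fst z)) * field_inner g\<^sub>F P W (snd z)"])
  fix z W assume W: "W \<in> vector_fields A\<^sub>F"
  show "semi_symmetric_koszul g (l\<^sub>F P) (l\<^sub>B X) (l\<^sub>B Y) (l\<^sub>F W) z
      = b z * (- (b z * field_inner g\<^sub>B X Y (fst z)) * field_inner g\<^sub>F P W (snd z))"
    by (simp add: semi_symmetric_koszul_lift(2)[OF P X Y X P P W] power2_eq_square)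
  show "g\<^sub>F (snd z) (\<lambda>f. - (b z * field_inner g\<^sub>B X Y (fst z)) * P (snd z) f) (W (snd z))
      = - (b z * field_inner g\<^sub>B X Y (fst z)) * field_inner g\<^sub>F P W (snd z)"
    unfolding field_inner_def[of g\<^sub>F] by (rule F.g_scale_left[OF F.vf_tangent[OF P] F.vf_tangent[OF W]])
  show "(\<lambda>z. - (b z * field_inner g\<^sub>B X Y (fst z)) * field_inner g\<^sub>F P W (snd z)) \<in> smooth_fun M"
    by (intro M.smooth_fun_mult M.smooth_fun_minus b smooth_fun_fst[OF B.field_inner_smooth[OF X Y]]
        smooth_fun_snd[OF F.field_inner_smooth[OF P W]])
next
  fix z Z assume Z: "Z \<in> vector_fields A\<^sub>B"
  show "semi_symmetric_koszul g (l\<^sub>F P) (l\<^sub>B X) (l\<^sub>B Y) (l\<^sub>B Z) z = g\<^sub>B (fst z) (B.connection X Y (fst z)) (Z (fst z))"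
    by (simp add: semi_symmetric_koszul_lift(1)[OF P X Y Z P P P] B.connection_inner[OF X Y Z])
qed (rule B.connection_tangent[OF X Y] F.tangent_space_scale[OF F.vf_tangent[OF P]] | simp)+

text \<open>The F-component X(b) V carries no further factor \<open>b\<close>, so its vanishing on
  the zero set rests on the hypothesis about db, here and for the opposite order of the two
  fields.\<close>

lemma components_fst_snd:
  assumes P: "P \<in> vector_fields A\<^sub>F" and X: "X \<in> vector_fields A\<^sub>B" and V: "V \<in> vector_fields A\<^sub>F"
  shows "components (semi_symmetric_koszul g (l\<^sub>F P) (l\<^sub>B X) (l\<^sub>F V))
    (\<lambda>z f. ((b z)\<^sup>2 * field_inner g\<^sub>F V P (snd z)) * X (fst z) f) (\<lambda>z f. l\<^sub>B X z b * V (snd z) f)"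
proof (rule componentsI[OF P lift_fst_vf[OF X] lift_snd_vf[OF V],
    where k="\<lambda>W z. l\<^sub>B X z b * field_inner g\<^sub>F V W (snd z)"])
  fix z W assume W: "W \<in> vector_fields A\<^sub>F"
  show "semi_symmetric_koszul g (l\<^sub>F P) (l\<^sub>B X) (l\<^sub>F V) (l\<^sub>F W) z = b z * (l\<^sub>B X z b * field_inner g\<^sub>F V W (snd z))"
    by (simp add: semi_symmetric_koszul_lift(5)[OF P X X X P V W])
  show "g\<^sub>F (snd z) (\<lambda>f. l\<^sub>B X z b * V (snd z) f) (W (snd z)) = l\<^sub>B X z b * field_inner g\<^sub>F V W (snd z)"
    unfolding field_inner_def by (rule F.g_scale_left[OF F.vf_tangent[OF V] F.vf_tangent[OF W]])
  show "(\<lambda>z. l\<^sub>B X z b * field_inner g\<^sub>F V W (snd z)) \<in> smooth_fun M"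
    by (intro M.smooth_fun_mult lift_fst_b_smooth[OF X] smooth_fun_snd[OF F.field_inner_smooth[OF V W]])
next
  fix z Z assume Z: "Z \<in> vector_fields A\<^sub>B"
  show "semi_symmetric_koszul g (l\<^sub>F P) (l\<^sub>B X) (l\<^sub>F V) (l\<^sub>B Z) z
    = g\<^sub>B (fst z) (\<lambda>f. ((b z)\<^sup>2 * field_inner g\<^sub>F V P (snd z)) * X (fst z) f) (Z (fst z))"
    unfolding semi_symmetric_koszul_lift(3)[OF P X Z X P P V] field_inner_def[of g\<^sub>B]
    by (rule B.g_scale_left[symmetric, OF B.vf_tangent[OF X] B.vf_tangent[OF Z]])
next
  fix z assume "b z = 0"
  then show "(\<lambda>f. l\<^sub>B X z b * V (snd z) f) = (\<lambda>f. 0)" by (simp add: lift_fst_b_zero[OF X])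
qed (rule B.tangent_space_scale[OF B.vf_tangent[OF X]] F.tangent_space_scale[OF F.vf_tangent[OF V]])+

lemma components_snd_fst:
  assumes P: "P \<in> vector_fields A\<^sub>F" and X: "X \<in> vector_fields A\<^sub>B" and V: "V \<in> vector_fields A\<^sub>F"
  shows "components (semi_symmetric_koszul g (l\<^sub>F P) (l\<^sub>F V) (l\<^sub>B X)) (\<lambda>z f. 0) (\<lambda>z f. l\<^sub>B X z b * V (snd z) f)"
proof (rule componentsI[OF P lift_snd_vf[OF V] lift_fst_vf[OF X],
    where k="\<lambda>W z. l\<^sub>B X z b * field_inner g\<^sub>F V W (snd z)"])
  fix z W assume W: "W \<in> vector_fields A\<^sub>F"
  show "semi_symmetric_koszul g (l\<^sub>F P) (l\<^sub>F V) (l\<^sub>B X) (l\<^sub>F W) z = b z * (l\<^sub>B X z b * field_inner g\<^sub>F V W (snd z))"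
    by (simp add: semi_symmetric_koszul_lift(6)[OF P X X X P V W])
  show "g\<^sub>F (snd z) (\<lambda>f. l\<^sub>B X z b * V (snd z) f) (W (snd z)) = l\<^sub>B X z b * field_inner g\<^sub>F V W (snd z)"
    unfolding field_inner_def by (rule F.g_scale_left[OF F.vf_tangent[OF V] F.vf_tangent[OF W]])
  show "(\<lambda>z. l\<^sub>B X z b * field_inner g\<^sub>F V W (snd z)) \<in> smooth_fun M"
    by (intro M.smooth_fun_mult lift_fst_b_smooth[OF X] smooth_fun_snd[OF F.field_inner_smooth[OF V W]])
next
  fix z Z assume Z: "Z \<in> vector_fields A\<^sub>B"
  show "semi_symmetric_koszul g (l\<^sub>F P) (l\<^sub>F V) (l\<^sub>B X) (l\<^sub>B Z) z = g\<^sub>B (fst z) (\<lambda>f. 0) (Z (fst z))"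
    by (simp add: semi_symmetric_koszul_lift(4)[OF P X Z X P P V] B.g_zero_left[OF B.vf_tangent[OF Z]])
next
  fix z assume "b z = 0"
  then show "(\<lambda>f. l\<^sub>B X z b * V (snd z) f) = (\<lambda>f. 0)" by (simp add: lift_fst_b_zero[OF X])
qed (rule B.tangent_space_zero F.tangent_space_scale[OF F.vf_tangent[OF V]])+

text \<open>The value on F-lifts of the form of two F-lifts, divided by \<open>b\<close> and with
  its last argument removed: \<open>connection\<close> represents the Koszul form,
  \<open>grad\<^sub>F\<close> represents db, and b^4 has become b^3. Negative coefficients are
  written with \<open>+ -\<close> to match the six-term linearity lemmas.\<close>

definition snd_component :: "'b vfield \<Rightarrow> 'b vfield \<Rightarrow> 'b vfield \<Rightarrow> 'a \<times> 'b \<Rightarrow> 'b tvec" where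
  "snd_component P U V z = (\<lambda>f. b z * F.connection U V (snd z) f + l\<^sub>F U z b * V (snd z) f
    + l\<^sub>F V z b * U (snd z) f + - field_inner g\<^sub>F U V (snd z) * grad\<^sub>F z f
    + ((b z)^3 * field_inner g\<^sub>F V P (snd z)) * U (snd z) f
    + - ((b z)^3 * field_inner g\<^sub>F U V (snd z)) * P (snd z) f)"

lemma snd_component_tangent:
  "P \<in> vector_fields A\<^sub>F \<Longrightarrow> U \<in> vector_fields A\<^sub>F \<Longrightarrow> V \<in> vector_fields A\<^sub>F \<Longrightarrow>
    snd_component P U V z \<in> tangent_space A\<^sub>F (snd z)"
  unfolding snd_component_def
  by (intro F.tangent_space_lincomb6 F.connection_tangent F.vf_tangent grad\<^sub>F)

lemma snd_component_inner_left:
  assumes "P \<in> vector_fields A\<^sub>F" "U \<in> vector_fields A\<^sub>F" "V \<in> vector_fields A\<^sub>F"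
    and w: "w \<in> tangent_space A\<^sub>F (snd z)"
  shows "g\<^sub>F (snd z) (snd_component P U V z) w = b z * g\<^sub>F (snd z) (F.connection U V (snd z)) w
    + l\<^sub>F U z b * g\<^sub>F (snd z) (V (snd z)) w + l\<^sub>F V z b * g\<^sub>F (snd z) (U (snd z)) w
    - field_inner g\<^sub>F U V (snd z) * g\<^sub>F (snd z) (grad\<^sub>F z) w
    + (b z)^3 * field_inner g\<^sub>F V P (snd z) * g\<^sub>F (snd z) (U (snd z)) w
    - (b z)^3 * field_inner g\<^sub>F U V (snd z) * g\<^sub>F (snd z) (P (snd z)) w"
  unfolding snd_component_def
  by (subst F.g_lincomb6_left) (auto intro: assms F.connection_tangent F.vf_tangent grad\<^sub>F)

lemma snd_component_inner_right:
  assumes "P \<in> vector_fields A\<^sub>F" "U \<in> vector_fields A\<^sub>F" "V \<in> vector_fields A\<^sub>F"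
    and w: "w \<in> tangent_space A\<^sub>F (snd z)"
  shows "g\<^sub>F (snd z) w (snd_component P U V z) = b z * g\<^sub>F (snd z) w (F.connection U V (snd z))
    + l\<^sub>F U z b * g\<^sub>F (snd z) w (V (snd z)) + l\<^sub>F V z b * g\<^sub>F (snd z) w (U (snd z))
    - field_inner g\<^sub>F U V (snd z) * g\<^sub>F (snd z) w (grad\<^sub>F z)
    + (b z)^3 * field_inner g\<^sub>F V P (snd z) * g\<^sub>F (snd z) w (U (snd z))
    - (b z)^3 * field_inner g\<^sub>F U V (snd z) * g\<^sub>F (snd z) w (P (snd z))"
  unfolding snd_component_def
  by (subst F.g_lincomb6_right) (auto intro: assms F.connection_tangent F.vf_tangent grad\<^sub>F)

lemma snd_component_field:
  assumes P: "P \<in> vector_fields A\<^sub>F" and U: "U \<in> vector_fields A\<^sub>F" and V: "V \<in> vector_fields A\<^sub>F"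
    and W: "W \<in> vector_fields A\<^sub>F"
  shows "g\<^sub>F (snd z) (snd_component P U V z) (W (snd z)) = b z * koszul g\<^sub>F U V W (snd z)
    + l\<^sub>F U z b * field_inner g\<^sub>F V W (snd z) + l\<^sub>F V z b * field_inner g\<^sub>F U W (snd z)
    - field_inner g\<^sub>F U V (snd z) * l\<^sub>F W z b
    + (b z)^3 * field_inner g\<^sub>F V P (snd z) * field_inner g\<^sub>F U W (snd z)
    - (b z)^3 * field_inner g\<^sub>F U V (snd z) * field_inner g\<^sub>F P W (snd z)"
  unfolding snd_component_inner_left[OF P U V F.vf_tangent[OF W]] F.connection_inner[OF U V W]
  using grad\<^sub>F(2)[OF F.vf_tangent[OF W], of z] by (simp add: field_inner_def lift_snd_incl)

text \<open>The value on the lift of a field \<open>Z\<close> from B is -b Z(b) g_F(U, V), and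
  \<open>grad\<^sub>B\<close> represents Z(b).\<close>

lemma components_snd_snd:
  assumes P: "P \<in> vector_fields A\<^sub>F" and U: "U \<in> vector_fields A\<^sub>F" and V: "V \<in> vector_fields A\<^sub>F"
  shows "components (semi_symmetric_koszul g (l\<^sub>F P) (l\<^sub>F U) (l\<^sub>F V))
    (\<lambda>z f. - (b z * field_inner g\<^sub>F U V (snd z)) * grad\<^sub>B z f) (snd_component P U V)"
proof (rule componentsI[OF P lift_snd_vf[OF U] lift_snd_vf[OF V],
    where k="\<lambda>W z. b z * koszul g\<^sub>F U V W (snd z)
    + l\<^sub>F U z b * field_inner g\<^sub>F V W (snd z) + l\<^sub>F V z b * field_inner g\<^sub>F U W (snd z)
    - field_inner g\<^sub>F U V (snd z) * l\<^sub>F W z b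
    + (b z)^3 * field_inner g\<^sub>F V P (snd z) * field_inner g\<^sub>F U W (snd z)
    - (b z)^3 * field_inner g\<^sub>F U V (snd z) * field_inner g\<^sub>F P W (snd z)"])
  fix z W assume W: "W \<in> vector_fields A\<^sub>F"
  \<comment> \<open>The zero field fills the slots of \<open>semi_symmetric_koszul_lift\<close> that
    belong to B.\<close>
  note X0 = B.vf_zero
  show "semi_symmetric_koszul g (l\<^sub>F P) (l\<^sub>F U) (l\<^sub>F V) (l\<^sub>F W) z = b z * (b z * koszul g\<^sub>F U V W (snd z)
    + l\<^sub>F U z b * field_inner g\<^sub>F V W (snd z) + l\<^sub>F V z b * field_inner g\<^sub>F U W (snd z)
    - field_inner g\<^sub>F U V (snd z) * l\<^sub>F W z b
    + (b z)^3 * field_inner g\<^sub>F V P (snd z) * field_inner g\<^sub>F U W (snd z)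
    - (b z)^3 * field_inner g\<^sub>F U V (snd z) * field_inner g\<^sub>F P W (snd z))"
    unfolding semi_symmetric_koszul_lift(8)[OF P X0 X0 X0 U V W] by (simp add: algebra_simps eval_nat_numeral)
  show "(\<lambda>z. b z * koszul g\<^sub>F U V W (snd z)
    + l\<^sub>F U z b * field_inner g\<^sub>F V W (snd z) + l\<^sub>F V z b * field_inner g\<^sub>F U W (snd z)
    - field_inner g\<^sub>F U V (snd z) * l\<^sub>F W z b
    + (b z)^3 * field_inner g\<^sub>F V P (snd z) * field_inner g\<^sub>F U W (snd z)
    - (b z)^3 * field_inner g\<^sub>F U V (snd z) * field_inner g\<^sub>F P W (snd z)) \<in> smooth_fun M"
    by (intro M.smooth_fun_add M.smooth_fun_diff M.smooth_fun_mult M.smooth_fun_power b lift_snd_b_smooth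
        smooth_fun_snd[OF F.koszul_smooth] smooth_fun_snd[OF F.field_inner_smooth] P U V W)
next
  fix z Z assume Z: "Z \<in> vector_fields A\<^sub>B"
  have "g\<^sub>B (fst z) (\<lambda>f. - (b z * field_inner g\<^sub>F U V (snd z)) * grad\<^sub>B z f) (Z (fst z))
    = - (b z * field_inner g\<^sub>F U V (snd z)) * l\<^sub>B Z z b"
    unfolding B.g_scale_left[OF grad\<^sub>B(1) B.vf_tangent[OF Z]] grad_field(1)[OF Z U] ..
  then show "semi_symmetric_koszul g (l\<^sub>F P) (l\<^sub>F U) (l\<^sub>F V) (l\<^sub>B Z) z
    = g\<^sub>B (fst z) (\<lambda>f. - (b z * field_inner g\<^sub>F U V (snd z)) * grad\<^sub>B z f) (Z (fst z))"
    by (simp add: semi_symmetric_koszul_lift(7)[OF P Z Z Z P U V])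
next
  fix z assume "b z = 0"
  then show "snd_component P U V z = (\<lambda>f. 0)"
    by (simp add: snd_component_def lift_snd_b_zero U V grad\<^sub>F_zero)
qed (rule B.tangent_space_scale[OF grad\<^sub>B(1)] snd_component_tangent[OF P U V]
    snd_component_field[OF P U V] | assumption)+

section \<open>Curvature\<close>

lemma lift_fst_derivatives:
  assumes X: "X \<in> vector_fields A\<^sub>B" and h: "h \<in> smooth_fun A\<^sub>B" and k: "k \<in> smooth_fun A\<^sub>F" and f: "f \<in> smooth_fun M"
  shows "l\<^sub>B X z (\<lambda>z. - ((b z)\<^sup>2 * h (fst z) * k (snd z)))
      = - (2 * b z * l\<^sub>B X z b * h (fst z) * k (snd z) + (b z)\<^sup>2 * X (fst z) h * k (snd z))"
    and "l\<^sub>B X z (\<lambda>z. b z * f z * k (snd z)) = l\<^sub>B X z b * f z * k (snd z) + b z * l\<^sub>B X z f * k (snd z)"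
proof -
  note t = M.vf_tangent[OF lift_fst_vf[OF X], of z]
  note sm = b f smooth_fun_fst[OF h] smooth_fun_snd[OF k] M.smooth_fun_mult M.smooth_fun_power
  show "l\<^sub>B X z (\<lambda>z. - ((b z)\<^sup>2 * h (fst z) * k (snd z)))
      = - (2 * b z * l\<^sub>B X z b * h (fst z) * k (snd z) + (b z)\<^sup>2 * X (fst z) h * k (snd z))"
    by (simp add: M.tv_minus[OF t] M.tv_mult[OF t] M.tv_power[OF t] sm lift_fst_on_fst[OF h] lift_fst_on_snd[OF X k] algebra_simps)
  show "l\<^sub>B X z (\<lambda>z. b z * f z * k (snd z)) = l\<^sub>B X z b * f z * k (snd z) + b z * l\<^sub>B X z f * k (snd z)"
    by (simp add: M.tv_mult[OF t] sm lift_fst_on_snd[OF X k] algebra_simps)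
qed

lemma lift_snd_derivatives:
  assumes U: "U \<in> vector_fields A\<^sub>F" and h: "h \<in> smooth_fun A\<^sub>B" and k: "k \<in> smooth_fun A\<^sub>F" and f: "f \<in> smooth_fun M"
  shows "l\<^sub>F U z (\<lambda>z. - ((b z)\<^sup>2 * h (fst z) * k (snd z)))
      = - (2 * b z * l\<^sub>F U z b * h (fst z) * k (snd z) + (b z)\<^sup>2 * h (fst z) * U (snd z) k)"
    and "l\<^sub>F U z (\<lambda>z. b z * f z * k (snd z))
      = l\<^sub>F U z b * f z * k (snd z) + b z * l\<^sub>F U z f * k (snd z) + b z * f z * U (snd z) k"
proof -
  note t = M.vf_tangent[OF lift_snd_vf[OF U], of z]
  note sm = b f smooth_fun_fst[OF h] smooth_fun_snd[OF k] M.smooth_fun_mult M.smooth_fun_power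
  show "l\<^sub>F U z (\<lambda>z. - ((b z)\<^sup>2 * h (fst z) * k (snd z)))
      = - (2 * b z * l\<^sub>F U z b * h (fst z) * k (snd z) + (b z)\<^sup>2 * h (fst z) * U (snd z) k)"
    by (simp add: M.tv_minus[OF t] M.tv_mult[OF t] M.tv_power[OF t] sm lift_snd_on_fst[OF U h] lift_snd_on_snd[OF k] algebra_simps)
  show "l\<^sub>F U z (\<lambda>z. b z * f z * k (snd z))
      = l\<^sub>F U z b * f z * k (snd z) + b z * l\<^sub>F U z f * k (snd z) + b z * f z * U (snd z) k"
    by (simp add: M.tv_mult[OF t] sm lift_snd_on_snd[OF k] algebra_simps)
qed

text \<open>The function differentiated has the shape of the semi-symmetric form of three F-lifts.
  With arbitrary functions and an arbitrary \<open>v\<close>, the product rule is expanded once for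
  derivatives in B-directions and in F-directions.\<close>

lemma koszul_snd_derivative:
  assumes v: "v \<in> tangent_space M z"
    and k: "k \<in> smooth_fun M" "a\<^sub>1 \<in> smooth_fun M" "a\<^sub>2 \<in> smooth_fun M" "a\<^sub>3 \<in> smooth_fun M"
      "h\<^sub>1 \<in> smooth_fun M" "h\<^sub>2 \<in> smooth_fun M" "h\<^sub>3 \<in> smooth_fun M" "h\<^sub>4 \<in> smooth_fun M"
      "h\<^sub>5 \<in> smooth_fun M" "h\<^sub>6 \<in> smooth_fun M" "h\<^sub>7 \<in> smooth_fun M"
  shows "v (\<lambda>z. (b z)\<^sup>2 * k z + b z * (a\<^sub>1 z * h\<^sub>1 z + a\<^sub>2 z * h\<^sub>2 z - a\<^sub>3 z * h\<^sub>3 z)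
      + (b z)^4 * (h\<^sub>4 z * h\<^sub>5 z - h\<^sub>6 z * h\<^sub>7 z))
    = 2 * b z * v b * k z + (b z)\<^sup>2 * v k + v b * (a\<^sub>1 z * h\<^sub>1 z + a\<^sub>2 z * h\<^sub>2 z - a\<^sub>3 z * h\<^sub>3 z)
      + b z * (v a\<^sub>1 * h\<^sub>1 z + a\<^sub>1 z * v h\<^sub>1 + v a\<^sub>2 * h\<^sub>2 z + a\<^sub>2 z * v h\<^sub>2 - v a\<^sub>3 * h\<^sub>3 z - a\<^sub>3 z * v h\<^sub>3)
      + 4 * (b z)^3 * v b * (h\<^sub>4 z * h\<^sub>5 z - h\<^sub>6 z * h\<^sub>7 z)
      + (b z)^4 * (v h\<^sub>4 * h\<^sub>5 z + h\<^sub>4 z * v h\<^sub>5 - v h\<^sub>6 * h\<^sub>7 z - h\<^sub>6 z * v h\<^sub>7)"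
  by (simp add: M.tv_add[OF v] M.tv_diff[OF v] M.tv_mult[OF v] M.tv_power[OF v] k b
      M.smooth_fun_add M.smooth_fun_diff M.smooth_fun_mult M.smooth_fun_power algebra_simps)

text \<open>The vanishing bracket of lifts from different factors, read as the exchange of two
  derivatives.\<close>

lemma lift_mixed_commute:
  assumes "X \<in> vector_fields A\<^sub>B" "U \<in> vector_fields A\<^sub>F"
  shows "l\<^sub>F U z (\<lambda>z. l\<^sub>B X z f) = l\<^sub>B X z (\<lambda>z. l\<^sub>F U z f)"
  using fun_cong[OF fun_cong[OF lie_bracket_lift_mixed(1)[OF assms]], of z f] by (simp add: lie_bracket_def)

lemma lift_bracket_fst:
  "X \<in> vector_fields A\<^sub>B \<Longrightarrow> Y \<in> vector_fields A\<^sub>B \<Longrightarrow>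
    l\<^sub>B (lie_bracket X Y) z f = l\<^sub>B X z (\<lambda>z. l\<^sub>B Y z f) - l\<^sub>B Y z (\<lambda>z. l\<^sub>B X z f)"
  unfolding lie_bracket_lift_fst[symmetric] by (simp add: lie_bracket_def)

lemma lift_bracket_snd:
  "U \<in> vector_fields A\<^sub>F \<Longrightarrow> V \<in> vector_fields A\<^sub>F \<Longrightarrow>
    l\<^sub>F (lie_bracket U V) z f = l\<^sub>F U z (\<lambda>z. l\<^sub>F V z f) - l\<^sub>F V z (\<lambda>z. l\<^sub>F U z f)"
  unfolding lie_bracket_lift_snd[symmetric] by (simp add: lie_bracket_def)

text \<open>This disposes of the bracket term of the curvature when its first two fields come from
  different factors.\<close>

lemma semi_symmetric_koszul_zero:
  assumes "P \<in> vector_fields A\<^sub>F" "Y \<in> vector_fields M" "Z \<in> vector_fields M"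
  shows "semi_symmetric_koszul g (l\<^sub>F P) (\<lambda>z f. 0) Y Z z = 0"
proof -
  have z: "lie_bracket Z (\<lambda>z f. 0) = (\<lambda>z f. 0)" "lie_bracket (\<lambda>z f. 0) Y = (\<lambda>z f. 0)"
    using M.tv_const[OF M.vf_tangent[OF assms(3)]] M.tv_const[OF M.vf_tangent[OF assms(2)]]
    by (simp_all add: lie_bracket_def fun_eq_iff)
  have l: "field_inner g (\<lambda>z f. 0) E = (\<lambda>z. 0)" if "E \<in> vector_fields M" for E
    using field_inner_zero[OF that] G.field_inner_sym[OF M.vf_zero that] by simp
  show ?thesis
    using assms M.tv_const[OF M.vf_tangent[OF assms(3)]] M.tv_const[OF M.vf_tangent[OF assms(2)]]
    by (simp add: semi_symmetric_koszul_def koszul_def z l field_inner_zero M.lie_bracket_vf)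
qed

section \<open>Curvature on each type of lifts\<close>

abbreviation "curv P E\<^sub>1 E\<^sub>2 E\<^sub>3 E\<^sub>4 \<equiv> semi_symmetric_curvature M g (l\<^sub>F P) E\<^sub>1 E\<^sub>2 E\<^sub>3 E\<^sub>4"

text \<open>The B-components reproduce the curvature of B. The terms with g_F(P, P) come from the
  F-components, which are multiples of b g_B(X, Z) P and the like.\<close>

lemma curvature_BBBB:
  assumes P: "P \<in> vector_fields A\<^sub>F" and X: "X \<in> vector_fields A\<^sub>B" and Y: "Y \<in> vector_fields A\<^sub>B"
    and Z: "Z \<in> vector_fields A\<^sub>B" and T: "T \<in> vector_fields A\<^sub>B"
  shows "curv P (l\<^sub>B X) (l\<^sub>B Y) (l\<^sub>B Z) (l\<^sub>B T) z = riemann_curvature A\<^sub>B g\<^sub>B X Y Z T (fst z)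
    + (b z)\<^sup>2 * field_inner g\<^sub>B X Z (fst z) * field_inner g\<^sub>B Y T (fst z) * field_inner g\<^sub>F P P (snd z)
    - (b z)\<^sup>2 * field_inner g\<^sub>B X T (fst z) * field_inner g\<^sub>B Y Z (fst z) * field_inner g\<^sub>F P P (snd z)"
proof -
  note L = B.lie_bracket_vf[OF X Y]
  show ?thesis
    unfolding semi_symmetric_curvature_def curvature_of_def lie_bracket_lift_fst[OF X Y]
      contraction_components[OF components_fst_fst[OF P X Z] components_fst_fst[OF P Y T]]
      contraction_components[OF components_fst_fst[OF P Y Z] components_fst_fst[OF P X T]]
      semi_symmetric_koszul_lift(1)[OF P Y Z T P P P] semi_symmetric_koszul_lift(1)[OF P X Z T P P P]
      semi_symmetric_koszul_lift(1)[OF P L Z T P P P]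
      lift_fst_on_fst[OF B.koszul_smooth[OF Y Z T]] lift_fst_on_fst[OF B.koszul_smooth[OF X Z T]]
      B.riemann_curvature_eq[OF X Y Z T] F.g_scale_both[OF F.vf_tangent[OF P] F.vf_tangent[OF P]]
    by (simp add: field_inner_def[of g\<^sub>F] algebra_simps power2_eq_square)
qed

text \<open>Differentiating -b^2 g_B(Y, Z) contributes -2 b X(b) g_B(Y, Z), of which the contraction
  takes back half. The derivatives of \<open>g\<^sub>B\<close>, the bracket term and the Koszul
  values from the contraction cancel by metric compatibility and vanishing torsion.\<close>

lemma curvature_BBBF:
  assumes P: "P \<in> vector_fields A\<^sub>F" and X: "X \<in> vector_fields A\<^sub>B" and Y: "Y \<in> vector_fields A\<^sub>B"
    and Z: "Z \<in> vector_fields A\<^sub>B" and W: "W \<in> vector_fields A\<^sub>F"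
  shows "curv P (l\<^sub>B X) (l\<^sub>B Y) (l\<^sub>B Z) (l\<^sub>F W) z =
    - b z * l\<^sub>B X z b * field_inner g\<^sub>B Y Z (fst z) * field_inner g\<^sub>F P W (snd z)
    + b z * l\<^sub>B Y z b * field_inner g\<^sub>B X Z (fst z) * field_inner g\<^sub>F P W (snd z)"
proof -
  note L = B.lie_bracket_vf[OF X Y]
  note GF = F.field_inner_smooth[OF P W]
  show ?thesis
    unfolding semi_symmetric_curvature_def curvature_of_def lie_bracket_lift_fst[OF X Y]
      contraction_components[OF components_fst_fst[OF P X Z] components_fst_snd[OF P Y W]]
      contraction_components[OF components_fst_fst[OF P Y Z] components_fst_snd[OF P X W]]
      semi_symmetric_koszul_lift(2)[OF P Y Z X P P W] semi_symmetric_koszul_lift(2)[OF P X Z X P P W]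
      semi_symmetric_koszul_lift(2)[OF P L Z X P P W]
      lift_fst_derivatives(1)[OF X B.field_inner_smooth[OF Y Z] GF b]
      lift_fst_derivatives(1)[OF Y B.field_inner_smooth[OF X Z] GF b]
      F.g_scale_both[OF F.vf_tangent[OF P] F.vf_tangent[OF W]]
      B.g_scale_right[OF B.vf_tangent[OF Y] B.connection_tangent[OF X Z]]
      B.g_scale_right[OF B.vf_tangent[OF X] B.connection_tangent[OF Y Z]]
      B.connection_inner[OF X Z Y] B.connection_inner[OF Y Z X]
      B.koszul_metric[OF X Y Z] B.koszul_metric[OF Y X Z] B.koszul_torsion[OF X Y Z, symmetric]
      F.field_inner_sym[OF W P]
    by (simp add: field_inner_def[of g\<^sub>F] algebra_simps power2_eq_square)
qed

text \<open>The derivative terms vanish: one Koszul value is 0, the other is constant along F. What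
  remains are the F-parts of the two contractions.\<close>

lemma curvature_BFBB:
  assumes P: "P \<in> vector_fields A\<^sub>F" and X: "X \<in> vector_fields A\<^sub>B" and Y: "Y \<in> vector_fields A\<^sub>B"
    and Z: "Z \<in> vector_fields A\<^sub>B" and W: "W \<in> vector_fields A\<^sub>F"
  shows "curv P (l\<^sub>B Z) (l\<^sub>F W) (l\<^sub>B X) (l\<^sub>B Y) z =
    b z * l\<^sub>B X z b * field_inner g\<^sub>B Y Z (fst z) * field_inner g\<^sub>F P W (snd z)
    - b z * l\<^sub>B Y z b * field_inner g\<^sub>B X Z (fst z) * field_inner g\<^sub>F P W (snd z)"
proof -
  note c0 = M.tv_const[OF M.vf_tangent[OF lift_fst_vf[OF Z]]]
  show ?thesis
    unfolding semi_symmetric_curvature_def curvature_of_def lie_bracket_lift_mixed(1)[OF Z W]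
      semi_symmetric_koszul_zero[OF P lift_fst_vf[OF X] lift_fst_vf[OF Y]]
      contraction_components[OF components_fst_fst[OF P Z X] components_snd_fst[OF P Y W]]
      contraction_components[OF components_snd_fst[OF P X W] components_fst_fst[OF P Z Y]]
      semi_symmetric_koszul_lift(4)[OF P X Y X P P W] semi_symmetric_koszul_lift(1)[OF P Z X Y P P W]
      c0 lift_snd_on_fst[OF W B.koszul_smooth[OF Z X Y]]
      F.g_scale_both[OF F.vf_tangent[OF P] F.vf_tangent[OF W]]
      F.g_scale_both[OF F.vf_tangent[OF W] F.vf_tangent[OF P]]
      F.g_sym[OF F.vf_tangent[OF W] F.vf_tangent[OF P]]
      B.g_zero_left[OF B.connection_tangent[OF Z Y]]
      B.g_sym[OF B.connection_tangent[OF Z X] B.tangent_space_zero] B.g_zero_left[OF B.connection_tangent[OF Z X]]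
    by (simp add: field_inner_def[of g\<^sub>F] algebra_simps B.field_inner_sym[OF Z X] B.field_inner_sym[OF Z Y])
qed

text \<open>The second derivatives cancel against [X, Y](b), the products X(b) Y(b) from the two
  derivatives cancel each other, and both contractions are symmetric in \<open>X\<close> and
  \<open>Y\<close>.\<close>

lemma curvature_BBFF:
  assumes P: "P \<in> vector_fields A\<^sub>F" and X: "X \<in> vector_fields A\<^sub>B" and Y: "Y \<in> vector_fields A\<^sub>B"
    and V: "V \<in> vector_fields A\<^sub>F" and W: "W \<in> vector_fields A\<^sub>F"
  shows "curv P (l\<^sub>B X) (l\<^sub>B Y) (l\<^sub>F V) (l\<^sub>F W) z = 0"
proof -
  note L = B.lie_bracket_vf[OF X Y]
  note GF = F.field_inner_smooth[OF V W]
  show ?thesis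
    unfolding semi_symmetric_curvature_def curvature_of_def lie_bracket_lift_fst[OF X Y]
      contraction_components[OF components_fst_snd[OF P X V] components_fst_snd[OF P Y W]]
      contraction_components[OF components_fst_snd[OF P Y V] components_fst_snd[OF P X W]]
      semi_symmetric_koszul_lift(5)[OF P Y Y Y V V W] semi_symmetric_koszul_lift(5)[OF P X X X V V W]
      semi_symmetric_koszul_lift(5)[OF P L L L V V W] lift_bracket_fst[OF X Y]
      lift_fst_derivatives(2)[OF X B.smooth_fun_const GF lift_fst_b_smooth[OF Y]]
      lift_fst_derivatives(2)[OF Y B.smooth_fun_const GF lift_fst_b_smooth[OF X]]
      F.g_scale_both[OF F.vf_tangent[OF V] F.vf_tangent[OF W]]
      B.g_scale_both[OF B.vf_tangent[OF X] B.vf_tangent[OF Y]]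
      B.g_scale_both[OF B.vf_tangent[OF Y] B.vf_tangent[OF X]]
      B.g_sym[OF B.vf_tangent[OF Y] B.vf_tangent[OF X]]
    by (simp add: field_inner_def[of g\<^sub>F] algebra_simps)
qed

text \<open>All Koszul values involved are 0, and both contractions equal X(b) Y(b) g_F(V,
  W).\<close>

lemma curvature_FFBB:
  assumes P: "P \<in> vector_fields A\<^sub>F" and X: "X \<in> vector_fields A\<^sub>B" and Y: "Y \<in> vector_fields A\<^sub>B"
    and V: "V \<in> vector_fields A\<^sub>F" and W: "W \<in> vector_fields A\<^sub>F"
  shows "curv P (l\<^sub>F V) (l\<^sub>F W) (l\<^sub>B X) (l\<^sub>B Y) z = 0"
proof -
  note L = F.lie_bracket_vf[OF V W]
  note c0 = M.tv_const[OF M.vf_tangent[OF lift_snd_vf[OF V]]] M.tv_const[OF M.vf_tangent[OF lift_snd_vf[OF W]]]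
  show ?thesis
    unfolding semi_symmetric_curvature_def curvature_of_def lie_bracket_lift_snd[OF V W]
      contraction_components[OF components_snd_fst[OF P X V] components_snd_fst[OF P Y W]]
      contraction_components[OF components_snd_fst[OF P X W] components_snd_fst[OF P Y V]]
      semi_symmetric_koszul_lift(4)[OF P X Y X P P W] semi_symmetric_koszul_lift(4)[OF P X Y X P P V]
      semi_symmetric_koszul_lift(4)[OF P X Y X P P L] c0
      F.g_scale_both[OF F.vf_tangent[OF V] F.vf_tangent[OF W]]
      F.g_scale_both[OF F.vf_tangent[OF W] F.vf_tangent[OF V]]
      F.g_sym[OF F.vf_tangent[OF W] F.vf_tangent[OF V]]
      B.g_zero_left[OF B.tangent_space_zero]
    by simp
qed

lemma grad_field_right:
  assumes "X \<in> vector_fields A\<^sub>B" "U \<in> vector_fields A\<^sub>F"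
  shows "g\<^sub>B (fst z) (X (fst z)) (grad\<^sub>B z) = l\<^sub>B X z b" "g\<^sub>F (snd z) (U (snd z)) (grad\<^sub>F z) = l\<^sub>F U z b"
  using grad_field[OF assms] B.g_sym[OF B.vf_tangent[OF assms(1)] grad\<^sub>B(1)]
    F.g_sym[OF F.vf_tangent[OF assms(2)] grad\<^sub>F(1)] by metis+

lemma snd_component_field_right:
  assumes "P \<in> vector_fields A\<^sub>F" "U \<in> vector_fields A\<^sub>F" "V \<in> vector_fields A\<^sub>F" "W \<in> vector_fields A\<^sub>F"
  shows "g\<^sub>F (snd z) (W (snd z)) (snd_component P U V z) = b z * koszul g\<^sub>F U V W (snd z)
    + l\<^sub>F U z b * field_inner g\<^sub>F V W (snd z) + l\<^sub>F V z b * field_inner g\<^sub>F U W (snd z)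
    - field_inner g\<^sub>F U V (snd z) * l\<^sub>F W z b
    + (b z)^3 * field_inner g\<^sub>F V P (snd z) * field_inner g\<^sub>F U W (snd z)
    - (b z)^3 * field_inner g\<^sub>F U V (snd z) * field_inner g\<^sub>F P W (snd z)"
  using snd_component_field[OF assms] F.g_sym[OF F.vf_tangent[OF assms(4)] snd_component_tangent[OF assms(1-3)]]
  by metis

text \<open>The second vector is expanded first; pairings of the first one with fields are the
  values \<open>s\<close>. The product of two connections is kept because it belongs to the
  curvature of F, and the square of the gradient because it is the term g_F^*(db, db).\<close>

lemma snd_component_inner:
  assumes P: "P \<in> vector_fields A\<^sub>F" and U: "U \<in> vector_fields A\<^sub>F" and W: "W \<in> vector_fields A\<^sub>F"
    and V: "V \<in> vector_fields A\<^sub>F" and Q: "Q \<in> vector_fields A\<^sub>F"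
  defines "s R S T z \<equiv> b z * koszul g\<^sub>F R S T (snd z)
    + l\<^sub>F R z b * field_inner g\<^sub>F S T (snd z) + l\<^sub>F S z b * field_inner g\<^sub>F R T (snd z)
    - field_inner g\<^sub>F R S (snd z) * l\<^sub>F T z b
    + (b z)^3 * field_inner g\<^sub>F S P (snd z) * field_inner g\<^sub>F R T (snd z)
    - (b z)^3 * field_inner g\<^sub>F R S (snd z) * field_inner g\<^sub>F P T (snd z)"
  shows "g\<^sub>F (snd z) (snd_component P U W z) (snd_component P V Q z) =
    b z * (b z * g\<^sub>F (snd z) (F.connection U W (snd z)) (F.connection V Q (snd z))
      + l\<^sub>F U z b * koszul g\<^sub>F V Q W (snd z) + l\<^sub>F W z b * koszul g\<^sub>F V Q U (snd z)
      - field_inner g\<^sub>F U W (snd z) * g\<^sub>F (snd z) (F.connection V Q (snd z)) (grad\<^sub>F z)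
      + (b z)^3 * field_inner g\<^sub>F W P (snd z) * koszul g\<^sub>F V Q U (snd z)
      - (b z)^3 * field_inner g\<^sub>F U W (snd z) * koszul g\<^sub>F V Q P (snd z))
    + l\<^sub>F V z b * s U W Q z + l\<^sub>F Q z b * s U W V z
    - field_inner g\<^sub>F V Q (snd z) * (b z * g\<^sub>F (snd z) (F.connection U W (snd z)) (grad\<^sub>F z)
      + 2 * l\<^sub>F U z b * l\<^sub>F W z b - field_inner g\<^sub>F U W (snd z) * g\<^sub>F (snd z) (grad\<^sub>F z) (grad\<^sub>F z)
      + (b z)^3 * field_inner g\<^sub>F W P (snd z) * l\<^sub>F U z b
      - (b z)^3 * field_inner g\<^sub>F U W (snd z) * l\<^sub>F P z b)
    + (b z)^3 * field_inner g\<^sub>F Q P (snd z) * s U W V z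
    - (b z)^3 * field_inner g\<^sub>F V Q (snd z) * s U W P z"
  unfolding snd_component_inner_right[OF P V Q snd_component_tangent[OF P U W]]
    snd_component_field[OF P U W Q] snd_component_field[OF P U W V] snd_component_field[OF P U W P]
    snd_component_inner_left[OF P U W F.connection_tangent[OF V Q]] snd_component_inner_left[OF P U W grad\<^sub>F(1)]
    F.connection_inner_right[OF V Q W] F.connection_inner_right[OF V Q U] F.connection_inner_right[OF V Q P]
    F.g_sym[OF grad\<^sub>F(1) F.connection_tangent[OF V Q]]
    grad_field_right(2)[OF B.vf_zero W] grad_field_right(2)[OF B.vf_zero U] grad_field_right(2)[OF B.vf_zero P] s_def
  by simp

text \<open>The derivative V(g_F(P, W)) splits into K_F(V, P, W) + K_F(V, W, P). The contraction
  cancels the second summand, so the first is the only Koszul value of F that survives.\<close>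

lemma curvature_BFBF:
  assumes P: "P \<in> vector_fields A\<^sub>F" and X: "X \<in> vector_fields A\<^sub>B" and Y: "Y \<in> vector_fields A\<^sub>B"
    and V: "V \<in> vector_fields A\<^sub>F" and W: "W \<in> vector_fields A\<^sub>F"
  shows "curv P (l\<^sub>B X) (l\<^sub>F V) (l\<^sub>B Y) (l\<^sub>F W) z =
    b z * l\<^sub>B X z (\<lambda>z. l\<^sub>B Y z b) * field_inner g\<^sub>F V W (snd z)
    - b z * g\<^sub>B (fst z) (B.connection X Y (fst z)) (grad\<^sub>B z) * field_inner g\<^sub>F V W (snd z)
    - (b z)^4 * field_inner g\<^sub>B X Y (fst z) * field_inner g\<^sub>F V P (snd z) * field_inner g\<^sub>F P W (snd z)
    + (b z)^4 * field_inner g\<^sub>B X Y (fst z) * field_inner g\<^sub>F V W (snd z) * field_inner g\<^sub>F P P (snd z)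
    + b z * l\<^sub>F V z b * field_inner g\<^sub>B X Y (fst z) * field_inner g\<^sub>F P W (snd z)
    + b z * l\<^sub>F P z b * field_inner g\<^sub>B X Y (fst z) * field_inner g\<^sub>F W V (snd z)
    - b z * l\<^sub>F W z b * field_inner g\<^sub>B X Y (fst z) * field_inner g\<^sub>F V P (snd z)
    + (b z)^2 * field_inner g\<^sub>B X Y (fst z) * koszul g\<^sub>F V P W (snd z)"
  unfolding semi_symmetric_curvature_def curvature_of_def lie_bracket_lift_mixed(1)[OF X V]
    semi_symmetric_koszul_zero[OF P lift_fst_vf[OF Y] lift_snd_vf[OF W]]
    contraction_components[OF components_fst_fst[OF P X Y] components_snd_snd[OF P V W]]
    contraction_components[OF components_snd_fst[OF P Y V] components_fst_snd[OF P X W]]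
    semi_symmetric_koszul_lift(6)[OF P Y Y Y V V W] semi_symmetric_koszul_lift(2)[OF P X Y X P P W]
    lift_fst_derivatives(2)[OF X B.smooth_fun_const F.field_inner_smooth[OF V W] lift_fst_b_smooth[OF Y]]
    lift_snd_derivatives(1)[OF V B.field_inner_smooth[OF X Y] F.field_inner_smooth[OF P W] b]
    B.g_scale_right[OF grad\<^sub>B(1) B.connection_tangent[OF X Y]]
    F.g_scale_left[OF F.vf_tangent[OF P] snd_component_tangent[OF P V W]]
    snd_component_field_right[OF P V W P]
    B.g_zero_left[OF B.tangent_space_scale[OF B.vf_tangent[OF X]]]
    F.g_scale_both[OF F.vf_tangent[OF V] F.vf_tangent[OF W]]
    F.koszul_metric[OF V P W] F.field_inner_sym[OF W V] F.field_inner_sym[OF W P]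
  by (simp add: field_inner_def[of g\<^sub>F] algebra_simps eval_nat_numeral)

text \<open>All Koszul values of F cancel: 2 b X(b) K_F(V, U, W) from the derivative of b^2 meets
  one copy from the contraction and one from V(g_F(U, W)), and the two copies of K_F(V, W, U) are
  opposite.\<close>

lemma curvature_BFFF:
  assumes P: "P \<in> vector_fields A\<^sub>F" and X: "X \<in> vector_fields A\<^sub>B" and V: "V \<in> vector_fields A\<^sub>F"
    and U: "U \<in> vector_fields A\<^sub>F" and W: "W \<in> vector_fields A\<^sub>F"
  shows "curv P (l\<^sub>B X) (l\<^sub>F V) (l\<^sub>F U) (l\<^sub>F W) z =
    b z * l\<^sub>B X z (\<lambda>z. l\<^sub>F U z b) * field_inner g\<^sub>F W V (snd z)
    - l\<^sub>B X z b * l\<^sub>F U z b * field_inner g\<^sub>F W V (snd z)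
    - b z * l\<^sub>B X z (\<lambda>z. l\<^sub>F W z b) * field_inner g\<^sub>F U V (snd z)
    + l\<^sub>B X z b * l\<^sub>F W z b * field_inner g\<^sub>F U V (snd z)
    + (b z)^3 * l\<^sub>B X z b * field_inner g\<^sub>F U P (snd z) * field_inner g\<^sub>F W V (snd z)
    - (b z)^3 * l\<^sub>B X z b * field_inner g\<^sub>F W P (snd z) * field_inner g\<^sub>F U V (snd z)"
proof -
  note k = F.koszul_smooth[OF V U W]
  note f = F.field_inner_smooth
  note d = koszul_snd_derivative[OF M.vf_tangent[OF lift_fst_vf[OF X]] smooth_fun_snd[OF k]
      lift_snd_b_smooth[OF V] lift_snd_b_smooth[OF U] lift_snd_b_smooth[OF W]
      smooth_fun_snd[OF f[OF U W]] smooth_fun_snd[OF f[OF V W]] smooth_fun_snd[OF f[OF V U]]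
      smooth_fun_snd[OF f[OF U P]] smooth_fun_snd[OF f[OF V W]] smooth_fun_snd[OF f[OF V U]] smooth_fun_snd[OF f[OF P W]]]
  note z = lift_fst_on_snd[OF X]
  show ?thesis
    unfolding semi_symmetric_curvature_def curvature_of_def lie_bracket_lift_mixed(1)[OF X V]
      semi_symmetric_koszul_zero[OF P lift_snd_vf[OF U] lift_snd_vf[OF W]]
      contraction_components[OF components_fst_snd[OF P X U] components_snd_snd[OF P V W]]
      contraction_components[OF components_snd_snd[OF P V U] components_fst_snd[OF P X W]]
      semi_symmetric_koszul_lift(8)[OF P X X X V U W] semi_symmetric_koszul_lift(5)[OF P X X X U U W]
      d z[OF k] z[OF f[OF U W]] z[OF f[OF V W]] z[OF f[OF V U]] z[OF f[OF U P]] z[OF f[OF P W]]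
      lift_snd_derivatives(2)[OF V B.smooth_fun_const f[OF U W] lift_fst_b_smooth[OF X]]
      lift_mixed_commute[OF X V]
      B.g_scale_both[OF B.vf_tangent[OF X] grad\<^sub>B(1)] B.g_scale_both[OF grad\<^sub>B(1) B.vf_tangent[OF X]]
      grad_field(1)[OF X P] grad_field_right(1)[OF X P]
      F.g_scale_left[OF F.vf_tangent[OF U] snd_component_tangent[OF P V W]]
      F.g_scale_right[OF F.vf_tangent[OF W] snd_component_tangent[OF P V U]]
      snd_component_field_right[OF P V W U] snd_component_field[OF P V U W]
      F.koszul_metric[OF V U W] F.field_inner_sym[OF W V] F.field_inner_sym[OF W P] F.field_inner_sym[OF W U]
      F.field_inner_sym[OF U V] F.field_inner_sym[OF P U]
    by (simp add: algebra_simps eval_nat_numeral)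
qed

text \<open>The contractions remove the Koszul values in which \<open>V\<close> is the middle
  argument; vanishing torsion removes the others together with g_F([U, W], V).\<close>

lemma curvature_FFBF:
  assumes P: "P \<in> vector_fields A\<^sub>F" and X: "X \<in> vector_fields A\<^sub>B" and V: "V \<in> vector_fields A\<^sub>F"
    and U: "U \<in> vector_fields A\<^sub>F" and W: "W \<in> vector_fields A\<^sub>F"
  shows "curv P (l\<^sub>F U) (l\<^sub>F W) (l\<^sub>B X) (l\<^sub>F V) z =
    b z * l\<^sub>B X z (\<lambda>z. l\<^sub>F U z b) * field_inner g\<^sub>F W V (snd z)
    - l\<^sub>B X z b * l\<^sub>F U z b * field_inner g\<^sub>F W V (snd z)
    - b z * l\<^sub>B X z (\<lambda>z. l\<^sub>F W z b) * field_inner g\<^sub>F U V (snd z)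
    + l\<^sub>B X z b * l\<^sub>F W z b * field_inner g\<^sub>F U V (snd z)
    - (b z)^3 * l\<^sub>B X z b * field_inner g\<^sub>F U P (snd z) * field_inner g\<^sub>F W V (snd z)
    + (b z)^3 * l\<^sub>B X z b * field_inner g\<^sub>F W P (snd z) * field_inner g\<^sub>F U V (snd z)"
proof -
  note L = F.lie_bracket_vf[OF U W]
  note f = F.field_inner_smooth
  show ?thesis
    unfolding semi_symmetric_curvature_def curvature_of_def lie_bracket_lift_snd[OF U W]
      contraction_components[OF components_snd_fst[OF P X U] components_snd_snd[OF P W V]]
      contraction_components[OF components_snd_fst[OF P X W] components_snd_snd[OF P U V]]
      semi_symmetric_koszul_lift(6)[OF P X X X U U V] semi_symmetric_koszul_lift(6)[OF P X X X W W V]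
      semi_symmetric_koszul_lift(6)[OF P X X X L L V]
      lift_snd_derivatives(2)[OF U B.smooth_fun_const f[OF W V] lift_fst_b_smooth[OF X]]
      lift_snd_derivatives(2)[OF W B.smooth_fun_const f[OF U V] lift_fst_b_smooth[OF X]]
      lift_mixed_commute[OF X U] lift_mixed_commute[OF X W]
      B.g_zero_left[OF B.tangent_space_scale[OF grad\<^sub>B(1)]]
      F.g_scale_left[OF F.vf_tangent[OF U] snd_component_tangent[OF P W V]]
      F.g_scale_left[OF F.vf_tangent[OF W] snd_component_tangent[OF P U V]]
      snd_component_field_right[OF P W V U] snd_component_field_right[OF P U V W]
      F.koszul_metric[OF U W V] F.koszul_metric[OF W U V] F.koszul_torsion[OF U W V, symmetric]
      F.field_inner_sym[OF V U] F.field_inner_sym[OF V W] F.field_inner_sym[OF P W]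
      F.field_inner_sym[OF P U] F.field_inner_sym[OF V P] F.field_inner_sym[OF W U]
    by (simp add: algebra_simps eval_nat_numeral)
qed

text \<open>The b^2 multiples of Koszul derivatives and of products of connections assemble into
  R_F, and [U, V](b) absorbs the commutator of second derivatives. The terms b^4 K_F(E, P, E') in
  \<open>H\<close> are what metric compatibility leaves of the derivatives of g_F(., P) once the
  contraction has removed K_F(E, E', P).\<close>

lemma curvature_FFFF:
  assumes P: "P \<in> vector_fields A\<^sub>F" and U: "U \<in> vector_fields A\<^sub>F" and V: "V \<in> vector_fields A\<^sub>F"
    and W: "W \<in> vector_fields A\<^sub>F" and Q: "Q \<in> vector_fields A\<^sub>F"
  defines "G \<equiv> \<lambda>E\<^sub>1 E\<^sub>2 z. field_inner g\<^sub>F E\<^sub>1 E\<^sub>2 (snd z)"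
  defines "H \<equiv> \<lambda>E\<^sub>1 E\<^sub>2 z. b z * l\<^sub>F E\<^sub>1 z (\<lambda>z. l\<^sub>F E\<^sub>2 z b) - 2 * l\<^sub>F E\<^sub>1 z b * l\<^sub>F E\<^sub>2 z b
    + (b z)^4 * koszul g\<^sub>F E\<^sub>1 P E\<^sub>2 (snd z) - b z * g\<^sub>F (snd z) (F.connection E\<^sub>1 E\<^sub>2 (snd z)) (grad\<^sub>F z)"
  shows "curv P (l\<^sub>F U) (l\<^sub>F V) (l\<^sub>F W) (l\<^sub>F Q) z = (b z)^2 * riemann_curvature A\<^sub>F g\<^sub>F U V W Q (snd z)
    + ((b z)^2 * g\<^sub>B (fst z) (grad\<^sub>B z) (grad\<^sub>B z) + g\<^sub>F (snd z) (grad\<^sub>F z) (grad\<^sub>F z)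
        + 2 * (b z)^3 * l\<^sub>F P z b + (b z)^6 * G P P z) * (G U W z * G V Q z - G V W z * G U Q z)
    + H U W z * G V Q z + H V Q z * G U W z - H V W z * G U Q z - H U Q z * G V W z
    + (b z)^3 * l\<^sub>F Q z b * (G U P z * G V W z - G V P z * G U W z)
    + ((b z)^6 * G U P z - (b z)^3 * l\<^sub>F U z b) * (G V W z * G P Q z - G P W z * G V Q z)
    - ((b z)^6 * G V P z - (b z)^3 * l\<^sub>F V z b) * (G U W z * G P Q z - G P W z * G U Q z)
    - (b z)^3 * l\<^sub>F W z b * (G U P z * G V Q z - G V P z * G U Q z)"
proof -
  note L = F.lie_bracket_vf[OF U V] and f = F.field_inner_smooth and k = F.koszul_smooth and X0 = B.vf_zero
  note dU = koszul_snd_derivative[OF M.vf_tangent[OF lift_snd_vf[OF U]] smooth_fun_snd[OF k[OF V W Q]]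
      lift_snd_b_smooth[OF V] lift_snd_b_smooth[OF W] lift_snd_b_smooth[OF Q]
      smooth_fun_snd[OF f[OF W Q]] smooth_fun_snd[OF f[OF V Q]] smooth_fun_snd[OF f[OF V W]]
      smooth_fun_snd[OF f[OF W P]] smooth_fun_snd[OF f[OF V Q]] smooth_fun_snd[OF f[OF V W]] smooth_fun_snd[OF f[OF P Q]]]
  note dV = koszul_snd_derivative[OF M.vf_tangent[OF lift_snd_vf[OF V]] smooth_fun_snd[OF k[OF U W Q]]
      lift_snd_b_smooth[OF U] lift_snd_b_smooth[OF W] lift_snd_b_smooth[OF Q]
      smooth_fun_snd[OF f[OF W Q]] smooth_fun_snd[OF f[OF U Q]] smooth_fun_snd[OF f[OF U W]]
      smooth_fun_snd[OF f[OF W P]] smooth_fun_snd[OF f[OF U Q]] smooth_fun_snd[OF f[OF U W]] smooth_fun_snd[OF f[OF P Q]]]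
  note s = lift_snd_on_snd
  show ?thesis
    unfolding semi_symmetric_curvature_def curvature_of_def lie_bracket_lift_snd[OF U V]
      contraction_components[OF components_snd_snd[OF P U W] components_snd_snd[OF P V Q]]
      contraction_components[OF components_snd_snd[OF P V W] components_snd_snd[OF P U Q]]
      semi_symmetric_koszul_lift(8)[OF P X0 X0 X0 V W Q] semi_symmetric_koszul_lift(8)[OF P X0 X0 X0 U W Q]
      semi_symmetric_koszul_lift(8)[OF P X0 X0 X0 L W Q]
      dU dV s[OF k[OF V W Q]] s[OF k[OF U W Q]] s[OF f[OF W Q]] s[OF f[OF V Q]] s[OF f[OF V W]] s[OF f[OF W P]]
      s[OF f[OF P Q]] s[OF f[OF U Q]] s[OF f[OF U W]]
      lift_bracket_snd[OF U V] B.g_scale_both[OF grad\<^sub>B(1) grad\<^sub>B(1)]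
      snd_component_inner[OF P U W V Q] snd_component_inner[OF P V W U Q]
      F.riemann_curvature_eq[OF U V W Q]
      F.koszul_metric[OF U W Q] F.koszul_metric[OF U V Q] F.koszul_metric[OF U V W] F.koszul_metric[OF U W P]
      F.koszul_metric[OF U P Q] F.koszul_metric[OF V W Q] F.koszul_metric[OF V U Q] F.koszul_metric[OF V U W]
      F.koszul_metric[OF V W P] F.koszul_metric[OF V P Q]
      F.koszul_torsion[OF U V Q, symmetric] F.koszul_torsion[OF U V W, symmetric] G_def H_def
    \<comment> \<open>Inner products are brought into one fixed order of their arguments, after
      which the claim is a polynomial identity.\<close>
    unfolding F.field_inner_sym[OF V U] F.field_inner_sym[OF W U] F.field_inner_sym[OF W V] F.field_inner_sym[OF Q U]
      F.field_inner_sym[OF Q V] F.field_inner_sym[OF Q W] F.field_inner_sym[OF P U] F.field_inner_sym[OF P V]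
      F.field_inner_sym[OF P W] F.field_inner_sym[OF P Q]
    by (simp add: algebra_simps eval_nat_numeral)
qed

end

section \<open>The formulas at a point of the product\<close>

theorem theorem5p10:
  fixes A\<^sub>B :: "('a::{t2_space, second_countable_topology}, 'm::euclidean_space) atlas"
    and A\<^sub>F :: "('b::{t2_space, second_countable_topology}, 'n::euclidean_space) atlas"
    and g\<^sub>B :: "'a metric" and g\<^sub>F :: "'b metric"
    and b :: "'a \<times> 'b \<Rightarrow> real"
    and X Y Z T :: "'a vfield" and P U V W Q :: "'b vfield"
    and p :: 'a and q :: 'b
  defines "M \<equiv> prod_atlas A\<^sub>B A\<^sub>F"
  defines "l\<^sub>B \<equiv> lift_fst A\<^sub>B A\<^sub>F" and "l\<^sub>F \<equiv> lift_snd A\<^sub>B A\<^sub>F"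
  defines "R \<equiv> (\<lambda>E\<^sub>1 E\<^sub>2 E\<^sub>3 E\<^sub>4. semi_symmetric_curvature M (twisted_metric A\<^sub>B g\<^sub>B A\<^sub>F g\<^sub>F b) (l\<^sub>F P)
                     E\<^sub>1 E\<^sub>2 E\<^sub>3 E\<^sub>4 (p, q))"
  defines "R\<^sub>B \<equiv> (\<lambda>E\<^sub>1 E\<^sub>2 E\<^sub>3 E\<^sub>4. riemann_curvature A\<^sub>B g\<^sub>B E\<^sub>1 E\<^sub>2 E\<^sub>3 E\<^sub>4 p)"
    and "R\<^sub>F \<equiv> (\<lambda>E\<^sub>1 E\<^sub>2 E\<^sub>3 E\<^sub>4. riemann_curvature A\<^sub>F g\<^sub>F E\<^sub>1 E\<^sub>2 E\<^sub>3 E\<^sub>4 q)"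
  defines "G\<^sub>B \<equiv> (\<lambda>E\<^sub>1 E\<^sub>2. field_inner g\<^sub>B E\<^sub>1 E\<^sub>2 p)"
    and "G\<^sub>F \<equiv> (\<lambda>E\<^sub>1 E\<^sub>2. field_inner g\<^sub>F E\<^sub>1 E\<^sub>2 q)"
    and "K\<^sub>F \<equiv> (\<lambda>E\<^sub>1 E\<^sub>2 E\<^sub>3. koszul g\<^sub>F E\<^sub>1 E\<^sub>2 E\<^sub>3 q)"
  defines "\<beta> \<equiv> b (p, q)"
    and "D \<equiv> (\<lambda>E. E (p, q) b)"
    and "DD \<equiv> (\<lambda>E\<^sub>1 E\<^sub>2. E\<^sub>1 (p, q) (\<lambda>z. E\<^sub>2 z b))"
  defines "db\<^sub>B \<equiv> pullback_covec A\<^sub>B M (\<lambda>x. (x, q)) p (differential M b (p, q))"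
    and "db\<^sub>F \<equiv> pullback_covec A\<^sub>F M (\<lambda>y. (p, y)) q (differential M b (p, q))"
  defines "C\<^sub>B \<equiv> (\<lambda>E\<^sub>1 E\<^sub>2. cometric A\<^sub>B g\<^sub>B p (form_at A\<^sub>B (koszul g\<^sub>B E\<^sub>1 E\<^sub>2) p) db\<^sub>B)"
    and "C\<^sub>F \<equiv> (\<lambda>E\<^sub>1 E\<^sub>2. cometric A\<^sub>F g\<^sub>F q (form_at A\<^sub>F (koszul g\<^sub>F E\<^sub>1 E\<^sub>2) q) db\<^sub>F)"
  defines "H \<equiv> (\<lambda>E\<^sub>1 E\<^sub>2. \<beta> * DD (l\<^sub>F E\<^sub>1) (l\<^sub>F E\<^sub>2) - 2 * D (l\<^sub>F E\<^sub>1) * D (l\<^sub>F E\<^sub>2)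
                     + \<beta>^4 * K\<^sub>F E\<^sub>1 P E\<^sub>2 - \<beta> * C\<^sub>F E\<^sub>1 E\<^sub>2)"
  assumes "singular_semi_riemannian A\<^sub>B g\<^sub>B" and "nondegenerate A\<^sub>B g\<^sub>B"
    and "singular_semi_riemannian A\<^sub>F g\<^sub>F" and "nondegenerate A\<^sub>F g\<^sub>F"
    and "b \<in> smooth_fun M"
    and "\<And>z. b z = 0 \<Longrightarrow> differential M b z = (\<lambda>_. 0)"
    and "P \<in> vector_fields A\<^sub>F"
    and "X \<in> vector_fields A\<^sub>B" and "Y \<in> vector_fields A\<^sub>B"
    and "Z \<in> vector_fields A\<^sub>B" and "T \<in> vector_fields A\<^sub>B"
    and "U \<in> vector_fields A\<^sub>F" and "V \<in> vector_fields A\<^sub>F"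
    and "W \<in> vector_fields A\<^sub>F" and "Q \<in> vector_fields A\<^sub>F"
  shows
    "(R (l\<^sub>B X) (l\<^sub>B Y) (l\<^sub>B Z) (l\<^sub>B T) =
        R\<^sub>B X Y Z T + \<beta>^2 * G\<^sub>B X Z * G\<^sub>B Y T * G\<^sub>F P P - \<beta>^2 * G\<^sub>B X T * G\<^sub>B Y Z * G\<^sub>F P P) \<and>
     (R (l\<^sub>B X) (l\<^sub>B Y) (l\<^sub>B Z) (l\<^sub>F W) = - R (l\<^sub>B Z) (l\<^sub>F W) (l\<^sub>B X) (l\<^sub>B Y)) \<and>
     (R (l\<^sub>B X) (l\<^sub>B Y) (l\<^sub>B Z) (l\<^sub>F W) =
        - \<beta> * D (l\<^sub>B X) * G\<^sub>B Y Z * G\<^sub>F P W + \<beta> * D (l\<^sub>B Y) * G\<^sub>B X Z * G\<^sub>F P W) \<and>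
     (R (l\<^sub>B X) (l\<^sub>B Y) (l\<^sub>F V) (l\<^sub>F W) = 0) \<and>
     (R (l\<^sub>F V) (l\<^sub>F W) (l\<^sub>B X) (l\<^sub>B Y) = 0) \<and>
     (R (l\<^sub>B X) (l\<^sub>F V) (l\<^sub>B Y) (l\<^sub>F W) =
        \<beta> * DD (l\<^sub>B X) (l\<^sub>B Y) * G\<^sub>F V W - \<beta> * C\<^sub>B X Y * G\<^sub>F V W
        - \<beta>^4 * G\<^sub>B X Y * G\<^sub>F V P * G\<^sub>F P W + \<beta>^4 * G\<^sub>B X Y * G\<^sub>F V W * G\<^sub>F P P
        + \<beta> * D (l\<^sub>F V) * G\<^sub>B X Y * G\<^sub>F P W + \<beta> * D (l\<^sub>F P) * G\<^sub>B X Y * G\<^sub>F W V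
        - \<beta> * D (l\<^sub>F W) * G\<^sub>B X Y * G\<^sub>F V P + \<beta>^2 * G\<^sub>B X Y * K\<^sub>F V P W) \<and>
     (R (l\<^sub>B X) (l\<^sub>F V) (l\<^sub>F U) (l\<^sub>F W) =
        \<beta> * DD (l\<^sub>B X) (l\<^sub>F U) * G\<^sub>F W V - D (l\<^sub>B X) * D (l\<^sub>F U) * G\<^sub>F W V
        - \<beta> * DD (l\<^sub>B X) (l\<^sub>F W) * G\<^sub>F U V + D (l\<^sub>B X) * D (l\<^sub>F W) * G\<^sub>F U V
        + \<beta>^3 * D (l\<^sub>B X) * G\<^sub>F U P * G\<^sub>F W V - \<beta>^3 * D (l\<^sub>B X) * G\<^sub>F W P * G\<^sub>F U V) \<and>
     (R (l\<^sub>F U) (l\<^sub>F W) (l\<^sub>B X) (l\<^sub>F V) =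
        \<beta> * DD (l\<^sub>B X) (l\<^sub>F U) * G\<^sub>F W V - D (l\<^sub>B X) * D (l\<^sub>F U) * G\<^sub>F W V
        - \<beta> * DD (l\<^sub>B X) (l\<^sub>F W) * G\<^sub>F U V + D (l\<^sub>B X) * D (l\<^sub>F W) * G\<^sub>F U V
        - \<beta>^3 * D (l\<^sub>B X) * G\<^sub>F U P * G\<^sub>F W V + \<beta>^3 * D (l\<^sub>B X) * G\<^sub>F W P * G\<^sub>F U V) \<and>
     (R (l\<^sub>F U) (l\<^sub>F V) (l\<^sub>F W) (l\<^sub>F Q) =
        \<beta>^2 * R\<^sub>F U V W Q
        + (\<beta>^2 * cometric A\<^sub>B g\<^sub>B p db\<^sub>B db\<^sub>B + cometric A\<^sub>F g\<^sub>F q db\<^sub>F db\<^sub>F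
             + 2 * \<beta>^3 * D (l\<^sub>F P) + \<beta>^6 * G\<^sub>F P P)
           * (G\<^sub>F U W * G\<^sub>F V Q - G\<^sub>F V W * G\<^sub>F U Q)
        + H U W * G\<^sub>F V Q + H V Q * G\<^sub>F U W - H V W * G\<^sub>F U Q - H U Q * G\<^sub>F V W
        + \<beta>^3 * D (l\<^sub>F Q) * (G\<^sub>F U P * G\<^sub>F V W - G\<^sub>F V P * G\<^sub>F U W)
        + (\<beta>^6 * G\<^sub>F U P - \<beta>^3 * D (l\<^sub>F U)) * (G\<^sub>F V W * G\<^sub>F P Q - G\<^sub>F P W * G\<^sub>F V Q)
        - (\<beta>^6 * G\<^sub>F V P - \<beta>^3 * D (l\<^sub>F V)) * (G\<^sub>F U W * G\<^sub>F P Q - G\<^sub>F P W * G\<^sub>F U Q)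
        - \<beta>^3 * D (l\<^sub>F W) * (G\<^sub>F U P * G\<^sub>F V Q - G\<^sub>F V P * G\<^sub>F U Q))"
proof -
  \<comment> \<open>The seventeen definitions of the statement are the first seventeen facts of
    \<open>assms\<close>, so the hypotheses start at number 18.\<close>
  interpret twisted_product A\<^sub>B A\<^sub>F g\<^sub>B g\<^sub>F b
    using assms(18-23) unfolding M_def
    by unfold_locales (auto simp: singular_semi_riemannian_def)
  note vf = assms(24-32)
  \<comment> \<open>After \<open>pullback_fst\<close>, \<open>pullback_snd\<close> and
    \<open>connection_form\<close>, every argument of a cometric in the statement is a flat, and
    these equations evaluate it.\<close>
  note C = B.cometric_flat[OF B.connection_tangent grad\<^sub>B(1)[of "(p, q)", unfolded fst_conv]]
    B.cometric_flat[OF grad\<^sub>B(1)[of "(p, q)", unfolded fst_conv] grad\<^sub>B(1)[of "(p, q)", unfolded fst_conv]]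
    F.cometric_flat[OF F.connection_tangent grad\<^sub>F(1)[of "(p, q)", unfolded snd_conv]]
    F.cometric_flat[OF grad\<^sub>F(1)[of "(p, q)", unfolded snd_conv] grad\<^sub>F(1)[of "(p, q)", unfolded snd_conv]]
  note at_pq = curvature_BBBB[OF vf(1-5), of "(p, q)", unfolded fst_conv snd_conv]
    curvature_BBBF[OF vf(1-4,8), of "(p, q)", unfolded fst_conv snd_conv]
    curvature_BFBB[OF vf(1-4,8), of "(p, q)", unfolded fst_conv snd_conv]
    curvature_BBFF[OF vf(1-3,7,8), of "(p, q)"]
    curvature_FFBB[OF vf(1-3,7,8), of "(p, q)"]
    curvature_BFBF[OF vf(1-3,7,8), of "(p, q)", unfolded fst_conv snd_conv]
    curvature_BFFF[OF vf(1,2,7,6,8), of "(p, q)", unfolded fst_conv snd_conv]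
    curvature_FFBF[OF vf(1,2,7,6,8), of "(p, q)", unfolded fst_conv snd_conv]
    curvature_FFFF[OF vf(1,6-9), of "(p, q)", unfolded fst_conv snd_conv]
  show ?thesis
    unfolding R_def R\<^sub>B_def R\<^sub>F_def G\<^sub>B_def G\<^sub>F_def K\<^sub>F_def \<beta>_def D_def DD_def C\<^sub>B_def C\<^sub>F_def H_def
      db\<^sub>B_def db\<^sub>F_def
    unfolding M_def l\<^sub>B_def l\<^sub>F_def
    unfolding pullback_fst pullback_snd B.connection_form[OF vf(2,3)] F.connection_form[OF vf(6,8)]
      F.connection_form[OF vf(7,9)] F.connection_form[OF vf(7,8)] F.connection_form[OF vf(6,9)]
      C(1)[OF vf(2,3)] C(2) C(3)[OF vf(6,8)] C(3)[OF vf(7,9)] C(3)[OF vf(7,8)] C(3)[OF vf(6,9)] C(4)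
    unfolding at_pq
    by (intro conjI refl) simp
qed

end
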